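(* $\mathbf{PMA}\subseteq\mathbf{U\Sigma_2^P}$.
   Context: Decision problems are identified with languages over $\Sigma=\{0,1\}$ under a standard encoding; $A\leq_P B$ means that $A$ is many-one reducible to $B$ in polynomial time. $\Vert$ (or juxtaposition) denotes concatenation of bit strings; bit strings are compared with integers by reading them as binary numbers. The problem Edge-Majority: the input consists of two Boolean circuits $C\colon\{0,1\}^{n+m}\to\{0,1\}^{m+1}$ and $V\colon\{0,1\}^{m+1}\to\{0,1\}^{n+m}$ and an integer $k\geq1$; the question is whether there exists $x\in\{0,1\}^n$ such that for all $y\in\{0,1\}^m$ we have $V(C(x\Vert y))=xy$ and $C(x\Vert y)\geq k$. The class Polynomial Majority Argument is $\mathbf{PMA}=\{L\subseteq\Sigma^*: L\leq_P\text{Edge-Majority}\}$. The class $\mathbf{U\Sigma_2^P}$: a language $L\subseteq\Sigma^*$ is in $\mathbf{U\Sigma_2^P}$ if there is a polynomial-time Turing machine $M$ and a polynomial $p$ such that for all $w\in\Sigma^*$: (i) $w\in L\iff\exists x_1\,\forall x_2\; M(w,x_1,x_2)=1$, and (ii) there is at most one $x_1$ such that $\forall x_2\; M(w,x_1,x_2)=1$; here $x_1,x_2$ range over strings in $\Sigma^*$ with $|x_i|\leq p(|w|)$. *)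

theory Defs
  imports "HOL-Computational_Algebra.Polynomial"
begin

section \<open>Multi-tape Turing machines\<close>

text \<open>
  Deterministic machines with a fixed number of two-way infinite tapes. Since types cannot be
  existentially quantified in HOL, states are natural numbers and non-input tape symbols are
  tagged natural numbers; every machine uses only finitely many of them.
\<close>

datatype sym = Blank | Bit bool | Aux nat

datatype dir = MoveLeft | Stay | MoveRight

fun shift :: "dir \<Rightarrow> int" where
  "shift MoveLeft = -1"
| "shift Stay = 0"
| "shift MoveRight = 1"

record tm =
  ntapes :: nat
  states :: "nat set"
  symbols :: "sym set"
  start_state :: nat
  halt_state :: nat
  delta :: "nat \<Rightarrow> sym list \<Rightarrow> nat \<times> (sym \<times> dir) list"

definition wf_tm :: "tm \<Rightarrow> bool" where
  "wf_tm M \<longleftrightarrow>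
     1 \<le> ntapes M \<and> finite (states M) \<and> finite (symbols M) \<and>
     start_state M \<in> states M \<and> halt_state M \<in> states M \<and>
     {Blank, Bit False, Bit True} \<subseteq> symbols M \<and>
     (\<forall>q \<in> states M. \<forall>ss. q \<noteq> halt_state M \<and> length ss = ntapes M \<and> set ss \<subseteq> symbols M \<longrightarrow>
        (case delta M q ss of (q', as) \<Rightarrow>
           q' \<in> states M \<and> length as = ntapes M \<and> fst ` set as \<subseteq> symbols M))"

text \<open>A tape is its content together with the head position.\<close>

type_synonym tape = "(int \<Rightarrow> sym) \<times> int"
type_synonym config = "nat \<times> tape list"

fun read_tape :: "tape \<Rightarrow> sym" where
  "read_tape (c, h) = c h"

fun act_tape :: "sym \<times> dir \<Rightarrow> tape \<Rightarrow> tape" where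
  "act_tape (s, d) (c, h) = (c(h := s), h + shift d)"

fun tm_step :: "tm \<Rightarrow> config \<Rightarrow> config" where
  "tm_step M (q, ts) =
     (if q = halt_state M then (q, ts)
      else case delta M q (map read_tape ts) of (q', as) \<Rightarrow> (q', map2 act_tape as ts))"

definition input_tape :: "bool list \<Rightarrow> tape" where
  "input_tape w = (\<lambda>i. if 0 \<le> i \<and> i < int (length w) then Bit (w ! nat i) else Blank, 0)"

text \<open>
  A machine taking several arguments receives them on its first tapes, one argument per tape;
  all further tapes are blank. The output is the bit string on the first tape that begins at the
  head position and extends to the next blank.
\<close>

definition init_config :: "tm \<Rightarrow> bool list list \<Rightarrow> config" where
  "init_config M ws =
     (start_state M,
      map (\<lambda>i. if i < length ws then input_tape (ws ! i) else input_tape []) [0..<ntapes M])"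

definition config_after :: "tm \<Rightarrow> bool list list \<Rightarrow> nat \<Rightarrow> config" where
  "config_after M ws t = (tm_step M ^^ t) (init_config M ws)"

definition halted_after :: "tm \<Rightarrow> bool list list \<Rightarrow> nat \<Rightarrow> bool" where
  "halted_after M ws t \<longleftrightarrow> fst (config_after M ws t) = halt_state M"

fun tape_holds :: "tape \<Rightarrow> bool list \<Rightarrow> bool" where
  "tape_holds (c, h) u \<longleftrightarrow>
     (\<forall>i < length u. c (h + int i) = Bit (u ! i)) \<and> c (h + int (length u)) = Blank"

definition outputs :: "tm \<Rightarrow> bool list list \<Rightarrow> bool list \<Rightarrow> bool" where
  "outputs M ws u \<longleftrightarrow>
     (\<exists>t. halted_after M ws t \<and> tape_holds (snd (config_after M ws t) ! 0) u)"

definition poly_time_tm :: "nat \<Rightarrow> tm \<Rightarrow> bool" where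
  "poly_time_tm r M \<longleftrightarrow>
     wf_tm M \<and> r \<le> ntapes M \<and>
     (\<exists>p :: nat poly. \<forall>ws. length ws = r \<longrightarrow>
        (\<exists>t \<le> poly p (sum_list (map length ws)). halted_after M ws t))"


section \<open>Languages and reductions\<close>

type_synonym language = "bool list set"

definition poly_time_computable :: "(bool list \<Rightarrow> bool list) \<Rightarrow> bool" where
  "poly_time_computable f \<longleftrightarrow> (\<exists>M. poly_time_tm 1 M \<and> (\<forall>w. outputs M [w] (f w)))"

definition poly_reducible :: "language \<Rightarrow> language \<Rightarrow> bool" (infix "\<le>\<^sub>P" 50) where
  "A \<le>\<^sub>P B \<longleftrightarrow> (\<exists>f. poly_time_computable f \<and> (\<forall>w. w \<in> A \<longleftrightarrow> f w \<in> B))"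


section \<open>Boolean circuits\<close>

text \<open>
  The wires of a circuit are numbered consecutively: first the inputs, then the gates in
  topological order. Constant gates are included so that circuits without inputs can have outputs.
\<close>

datatype gate = Const bool | Not nat | And nat nat | Or nat nat

fun gate_args :: "gate \<Rightarrow> nat set" where
  "gate_args (Const b) = {}"
| "gate_args (Not i) = {i}"
| "gate_args (And i j) = {i, j}"
| "gate_args (Or i j) = {i, j}"

record circuit =
  num_inputs :: nat
  gates :: "gate list"
  output_wires :: "nat list"

text \<open>\<open>circuit_type C a b\<close>: \<open>C\<close> is a circuit computing a function from \<open>a\<close> bits to \<open>b\<close> bits.\<close>

definition circuit_type :: "circuit \<Rightarrow> nat \<Rightarrow> nat \<Rightarrow> bool" where
  "circuit_type C a b \<longleftrightarrow>
     num_inputs C = a \<and> length (output_wires C) = b \<and>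
     (\<forall>j < length (gates C). \<forall>i \<in> gate_args (gates C ! j). i < num_inputs C + j) \<and>
     (\<forall>i \<in> set (output_wires C). i < num_inputs C + length (gates C))"

fun eval_gate :: "bool list \<Rightarrow> gate \<Rightarrow> bool" where
  "eval_gate vs (Const b) = b"
| "eval_gate vs (Not i) = (\<not> vs ! i)"
| "eval_gate vs (And i j) = (vs ! i \<and> vs ! j)"
| "eval_gate vs (Or i j) = (vs ! i \<or> vs ! j)"

definition eval_circuit :: "circuit \<Rightarrow> bool list \<Rightarrow> bool list" where
  "eval_circuit C x =
     (let vs = foldl (\<lambda>vs g. vs @ [eval_gate vs g]) x (gates C)
      in map (\<lambda>i. vs ! i) (output_wires C))"


section \<open>Binary numbers and the encoding of instances\<close>

text \<open>Most significant bit first.\<close>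

definition bits_to_nat :: "bool list \<Rightarrow> nat" where
  "bits_to_nat bs = horner_sum of_bool 2 (rev bs)"

fun nat_to_bits :: "nat \<Rightarrow> bool list" where
  "nat_to_bits n = (if n = 0 then [] else nat_to_bits (n div 2) @ [odd n])"

declare nat_to_bits.simps [simp del]

text \<open>
  The number \<open>k\<close> is encoded in binary. Wire numbers are encoded in unary: the input count is given
  in unary and the gates are listed one by one, so wire numbers are at most linear in the length
  of the code, and this changes the length only polynomially compared with binary wire numbers.
  All codes are self-delimiting, hence can be concatenated without separators.
\<close>

definition enc_unary :: "nat \<Rightarrow> bool list" where
  "enc_unary n = replicate n True @ [False]"

definition enc_list :: "('a \<Rightarrow> bool list) \<Rightarrow> 'a list \<Rightarrow> bool list" where
  "enc_list e xs = concat (map (\<lambda>x. True # e x) xs) @ [False]"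

fun enc_gate :: "gate \<Rightarrow> bool list" where
  "enc_gate (Const b) = [False, False, b]"
| "enc_gate (Not i) = [False, True] @ enc_unary i"
| "enc_gate (And i j) = [True, False] @ enc_unary i @ enc_unary j"
| "enc_gate (Or i j) = [True, True] @ enc_unary i @ enc_unary j"

definition enc_circuit :: "circuit \<Rightarrow> bool list" where
  "enc_circuit C =
     enc_unary (num_inputs C) @ enc_list enc_gate (gates C) @ enc_list enc_unary (output_wires C)"

definition enc_instance :: "circuit \<Rightarrow> circuit \<Rightarrow> nat \<Rightarrow> bool list" where
  "enc_instance C V k = enc_circuit C @ enc_circuit V @ enc_list (\<lambda>b. [b]) (nat_to_bits k)"

subsection \<open>The encoding is injective\<close>

definition prefix_code :: "('a \<Rightarrow> bool list) \<Rightarrow> bool" where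
  "prefix_code e \<longleftrightarrow> (\<forall>x y u v. e x @ u = e y @ v \<longrightarrow> x = y \<and> u = v)"

lemma prefix_code_unary: "prefix_code enc_unary"
proof -
  have "m = n \<and> u = v" if "enc_unary m @ u = enc_unary n @ v" for m n u v
    using that
  proof (induction m arbitrary: n)
    case 0
    then show ?case by (cases n) (auto simp: enc_unary_def)
  next
    case (Suc m)
    then show ?case by (cases n) (auto simp: enc_unary_def)
  qed
  then show ?thesis unfolding prefix_code_def by blast
qed

lemma prefix_code_list:
  assumes "prefix_code e"
  shows "prefix_code (enc_list e)"
proof -
  have "xs = ys \<and> u = v" if "enc_list e xs @ u = enc_list e ys @ v" for xs ys u v
    using that
  proof (induction xs arbitrary: ys)
    case Nil
    then show ?case by (cases ys) (auto simp: enc_list_def)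
  next
    case (Cons x xs)
    then obtain y ys' where ys: "ys = y # ys'"
      by (cases ys) (auto simp: enc_list_def)
    with Cons.prems have "e x @ (enc_list e xs @ u) = e y @ (enc_list e ys' @ v)"
      by (simp add: enc_list_def)
    with assms have "x = y" "enc_list e xs @ u = enc_list e ys' @ v"
      unfolding prefix_code_def by blast+
    with Cons.IH ys show ?case by blast
  qed
  then show ?thesis unfolding prefix_code_def by blast
qed

lemma prefix_code_gate: "prefix_code enc_gate"
proof -
  note u = prefix_code_unary[unfolded prefix_code_def, rule_format]
  have "g = h \<and> u = v" if "enc_gate g @ u = enc_gate h @ v" for g h u v
    using that by (cases g; cases h) (auto dest!: u)
  then show ?thesis unfolding prefix_code_def by blast
qed

lemma prefix_code_circuit: "prefix_code enc_circuit"
  unfolding prefix_code_def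
proof (intro allI impI)
  fix C D :: circuit and u v
  note un = prefix_code_unary[unfolded prefix_code_def, rule_format]
    and ga = prefix_code_list[OF prefix_code_gate, unfolded prefix_code_def, rule_format]
    and ou = prefix_code_list[OF prefix_code_unary, unfolded prefix_code_def, rule_format]
  assume "enc_circuit C @ u = enc_circuit D @ v"
  then show "C = D \<and> u = v"
    by (auto simp: enc_circuit_def dest!: un ga ou)
qed

lemma bits_to_nat_nat_to_bits: "bits_to_nat (nat_to_bits n) = n"
proof (induction n rule: less_induct)
  case (less n)
  show ?case
  proof (cases "n = 0")
    case True
    then show ?thesis by (simp add: bits_to_nat_def nat_to_bits.simps)
  next
    case False
    then have "bits_to_nat (nat_to_bits (n div 2)) = n div 2"
      by (intro less.IH) simp
    moreover have "bits_to_nat (nat_to_bits n) = of_bool (odd n) + 2 * bits_to_nat (nat_to_bits (n div 2))"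
      using False by (subst nat_to_bits.simps) (simp add: bits_to_nat_def)
    ultimately show ?thesis
      by simp
  qed
qed

lemma enc_instance_inject:
  assumes "enc_instance C V k = enc_instance C' V' k'"
  shows "C = C' \<and> V = V' \<and> k = k'"
proof -
  note ci = prefix_code_circuit[unfolded prefix_code_def, rule_format]
  have "prefix_code (\<lambda>b :: bool. [b])"
    by (simp add: prefix_code_def)
  note li = prefix_code_list[OF this, unfolded prefix_code_def, rule_format, of _ "[]" _ "[]", simplified]
  from assms have "C = C'" "V = V'" "nat_to_bits k = nat_to_bits k'"
    by (auto simp: enc_instance_def dest!: ci li)
  then show ?thesis
    by (metis bits_to_nat_nat_to_bits)
qed


section \<open>Edge-Majority and the complexity classes\<close>

definition Edge_Majority :: language where
  "Edge_Majority =
     {enc_instance C V k | C V k n m.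
        circuit_type C (n + m) (m + 1) \<and> circuit_type V (m + 1) (n + m) \<and> 1 \<le> k \<and>
        (\<exists>x. length x = n \<and>
           (\<forall>y. length y = m \<longrightarrow>
              eval_circuit V (eval_circuit C (x @ y)) = x @ y \<and>
              k \<le> bits_to_nat (eval_circuit C (x @ y))))}"

definition PMA :: "language set" where
  "PMA = {L. L \<le>\<^sub>P Edge_Majority}"

text \<open>The condition \<open>\<forall>x\<^sub>2. M(w, x\<^sub>1, x\<^sub>2) = 1\<close>, with \<open>x\<^sub>2\<close> ranging over strings of length at most \<open>l\<close>.\<close>

definition all_accepted :: "tm \<Rightarrow> nat \<Rightarrow> bool list \<Rightarrow> bool list \<Rightarrow> bool" where
  "all_accepted M l w x1 \<longleftrightarrow> (\<forall>x2. length x2 \<le> l \<longrightarrow> outputs M [w, x1, x2] [True])"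

definition USigma2P :: "language set" where
  "USigma2P =
     {L. \<exists>M. \<exists>p :: nat poly. poly_time_tm 3 M \<and>
        (\<forall>w. (w \<in> L \<longleftrightarrow>
                (\<exists>x1. length x1 \<le> poly p (length w) \<and> all_accepted M (poly p (length w)) w x1)) \<and>
             (\<exists>\<^sub>\<le>\<^sub>1 x1. length x1 \<le> poly p (length w) \<and> all_accepted M (poly p (length w)) w x1))}"

end

theory Submission
  imports Defs
begin

text \<open>
  Let \<open>f\<close> reduce \<open>L\<close> to Edge-Majority. The \<open>U\<Sigma>\<^sub>2\<close> machine computes \<open>f w\<close>, decodes it as \<open>(C, V, k)\<close>, takes \<open>x\<^sub>1\<close>
  as \<open>x\<close> and \<open>x\<^sub>2\<close> as \<open>y\<close>, and evaluates both circuits. The witness is unique because \<open>V\<close> inverts \<open>C\<close> on every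
  string that extends an admissible \<open>x\<close>: two such \<open>x\<close> would give \<open>2 * 2 ^ m\<close> different outputs of \<open>m + 1\<close> bits,
  whereas \<open>k \<ge> 1\<close> excludes the output 0.

  The machine is compiled from a small while language on stores of tapes. The reduction machine, given only by an
  arbitrary transition function, is run inside this language by a loop whose body performs one of its steps.
\<close>

section \<open>Structured programs and their compilation to Turing machines\<close>

text \<open>Every defect, be it a malformed code, a wrong arity or a failed comparison, is handled
  alike: the run stops with an empty output. So the parsers need only be exact about which strings
  they accept.

  For uniqueness this is turned around: the outputs of \<open>C\<close> determine \<open>m\<close>,
  hence the length of an admissible \<open>x\<close>, so witnesses of different lengths cannot
  coexist either.

  All bounds come from two facts. A machine that runs for \<open>t\<close> steps leaves at most
  \<open>t\<close> more nonblank cells than its input had, so \<open>f w\<close> is polynomially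
  long; and input counts are written in unary, so \<open>x\<close> and \<open>y\<close> are no
  longer than \<open>f w\<close>. One polynomial thus serves both quantifiers.

  About the tape left by the reduction only the string from the head to the next blank is known; the
  other cells may hold anything. This tape is therefore read once from left to right, and gates are
  evaluated while they are decoded.\<close>

type_synonym store = "nat \<Rightarrow> tape"

text \<open>
  The program \<open>Fail\<close> rejects at once: it blanks the scanned cell of tape 0, so that the output is empty,
  and jumps to the halting state.
\<close>

datatype prog =
    Act "(nat \<Rightarrow> sym) \<Rightarrow> nat \<Rightarrow> sym \<times> dir"
  | Fail
  | Seq prog prog (infixr ";;" 60)
  | Cond "(nat \<Rightarrow> sym) \<Rightarrow> bool" prog prog
  | Loop "(nat \<Rightarrow> sym) \<Rightarrow> bool" prog

definition reads :: "store \<Rightarrow> nat \<Rightarrow> sym" where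
  "reads st i = read_tape (st i)"

definition act :: "((nat \<Rightarrow> sym) \<Rightarrow> nat \<Rightarrow> sym \<times> dir) \<Rightarrow> store \<Rightarrow> store" where
  "act f st i = act_tape (f (reads st) i) (st i)"

text \<open>Times are exact step counts of the compiled code: a test costs one step, and so does the
  jump that closes a \<open>then\<close> branch or a loop body, whereas an \<open>else\<close>
  branch falls through. The result \<open>None\<close> stands for a run ended by
  \<open>Fail\<close>.\<close>

inductive exec :: "prog \<Rightarrow> store \<Rightarrow> nat \<Rightarrow> store option \<Rightarrow> bool" where
  Act: "exec (Act f) st 1 (Some (act f st))"
| Fail: "exec Fail st 1 None"
| Seq_None: "exec p st t None \<Longrightarrow> exec (p ;; q) st t None"
| Seq_Some: "exec p st t (Some st') \<Longrightarrow> exec q st' t' r \<Longrightarrow> exec (p ;; q) st (t + t') r"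
| Cond_None: "b (reads st) \<Longrightarrow> exec p st t None \<Longrightarrow> exec (Cond b p q) st (1 + t) None"
| Cond_Some: "b (reads st) \<Longrightarrow> exec p st t (Some st') \<Longrightarrow> exec (Cond b p q) st (1 + t + 1) (Some st')"
| Cond_else: "\<not> b (reads st) \<Longrightarrow> exec q st t r \<Longrightarrow> exec (Cond b p q) st (1 + t) r"
| Loop_end: "\<not> b (reads st) \<Longrightarrow> exec (Loop b p) st 1 (Some st)"
| Loop_None: "b (reads st) \<Longrightarrow> exec p st t None \<Longrightarrow> exec (Loop b p) st (1 + t) None"
| Loop_Some: "b (reads st) \<Longrightarrow> exec p st t (Some st') \<Longrightarrow> exec (Loop b p) st' t' r \<Longrightarrow>
    exec (Loop b p) st (1 + t + 1 + t') r"

inductive_cases exec_ActE: "exec (Act f) st t r"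
inductive_cases exec_FailE: "exec Fail st t r"
inductive_cases exec_SeqE: "exec (p ;; q) st t r"
inductive_cases exec_CondE: "exec (Cond b p q) st t r"
inductive_cases exec_LoopE: "exec (Loop b p) st t r"

fun plen :: "prog \<Rightarrow> nat" where
  "plen (Act f) = 1"
| "plen Fail = 1"
| "plen (p ;; q) = plen p + plen q"
| "plen (Cond b p q) = plen p + plen q + 2"
| "plen (Loop b p) = plen p + 2"

abbreviation idle :: "(nat \<Rightarrow> sym) \<Rightarrow> nat \<Rightarrow> sym \<times> dir" where
  "idle r \<equiv> \<lambda>i. (r i, Stay)"

text \<open>
  \<open>compile h p n\<close> is the code of \<open>p\<close> placed at address \<open>n\<close> in a program whose halting state is \<open>h\<close>;
  states are addresses.
\<close>

fun compile :: "nat \<Rightarrow> prog \<Rightarrow> nat \<Rightarrow> ((nat \<Rightarrow> sym) \<Rightarrow> nat \<times> (nat \<Rightarrow> sym \<times> dir)) list" where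
  "compile h (Act f) n = [\<lambda>r. (n + 1, f r)]"
| "compile h Fail n = [\<lambda>r. (h, (idle r)(0 := (Blank, Stay)))]"
| "compile h (p ;; q) n = compile h p n @ compile h q (n + plen p)"
| "compile h (Cond b p q) n =
     [\<lambda>r. (if b r then n + 1 else n + plen p + 2, idle r)] @ compile h p (n + 1) @
     [\<lambda>r. (n + plen p + plen q + 2, idle r)] @ compile h q (n + plen p + 2)"
| "compile h (Loop b p) n =
     [\<lambda>r. (if b r then n + 1 else n + plen p + 2, idle r)] @ compile h p (n + 1) @ [\<lambda>r. (n, idle r)]"

lemma length_compile [simp]: "length (compile h p n) = plen p"
  by (induction p arbitrary: n) auto

section \<open>Locality and closure conditions on programs\<close>

definition agree :: "nat \<Rightarrow> (nat \<Rightarrow> 'a) \<Rightarrow> (nat \<Rightarrow> 'a) \<Rightarrow> bool" where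
  "agree K r r' \<longleftrightarrow> (\<forall>i<K. r i = r' i)"

text \<open>Programs see the scanned symbols as a function on all of \<open>nat\<close>, while the
  machine has only a list of \<open>K\<close> of them, whose further entries are unspecified. Code
  must not depend on these.\<close>

definition local_test :: "nat \<Rightarrow> ((nat \<Rightarrow> sym) \<Rightarrow> 'a) \<Rightarrow> bool" where
  "local_test K b \<longleftrightarrow> (\<forall>r r'. agree K r r' \<longrightarrow> b r = b r')"

definition closed_act :: "nat \<Rightarrow> sym set \<Rightarrow> ((nat \<Rightarrow> sym) \<Rightarrow> nat \<Rightarrow> sym \<times> dir) \<Rightarrow> bool" where
  "closed_act K S f \<longleftrightarrow>
     (\<forall>r r'. agree K r r' \<longrightarrow> agree K (f r) (f r')) \<and>
     (\<forall>r. (\<forall>i<K. r i \<in> S) \<longrightarrow> (\<forall>i<K. fst (f r i) \<in> S))"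

fun wf_prog :: "nat \<Rightarrow> sym set \<Rightarrow> prog \<Rightarrow> bool" where
  "wf_prog K S (Act f) = closed_act K S f"
| "wf_prog K S Fail = True"
| "wf_prog K S (p ;; q) = (wf_prog K S p \<and> wf_prog K S q)"
| "wf_prog K S (Cond b p q) = (local_test K b \<and> wf_prog K S p \<and> wf_prog K S q)"
| "wf_prog K S (Loop b p) = (local_test K b \<and> wf_prog K S p)"

lemma closed_act_idle: "closed_act K S idle"
  by (simp add: closed_act_def agree_def)

lemma closed_act_fail: "Blank \<in> S \<Longrightarrow> closed_act K S (\<lambda>r. (idle r)(0 := (Blank, Stay)))"
  by (simp add: closed_act_def agree_def)

lemma local_test_const: "local_test K (\<lambda>r. c)"
  by (simp add: local_test_def)

lemma local_test_if: "local_test K b \<Longrightarrow> local_test K (\<lambda>r. if b r then x else y)"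
  by (simp add: local_test_def)

text \<open>Jumps lead into the block, to its end \<open>n + plen p\<close>, or to \<open>h\<close>.
  This and closure of the alphabet are what \<open>wf_tm\<close> asks of a transition
  function.\<close>

lemma compile_closed:
  assumes "wf_prog K S p" "Blank \<in> S" "n + plen p \<le> L" "h \<le> L" "g \<in> set (compile h p n)"
  shows "local_test K (\<lambda>r. fst (g r)) \<and> (\<forall>r. fst (g r) \<le> L) \<and> closed_act K S (\<lambda>r. snd (g r))"
  using assms
proof (induction p arbitrary: n)
  case (Seq p q)
  from Seq.prems(5) consider "g \<in> set (compile h p n)" | "g \<in> set (compile h q (n + plen p))" by auto
  then show ?case
    using Seq.IH(1)[of n] Seq.IH(2)[of "n + plen p"] Seq.prems by cases simp_all
next
  case (Cond b p q)
  from Cond.prems(5) consider "g = (\<lambda>r. (if b r then n + 1 else n + plen p + 2, idle r))"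
    | "g \<in> set (compile h p (n + 1))" | "g = (\<lambda>r. (n + plen p + plen q + 2, idle r))"
    | "g \<in> set (compile h q (n + plen p + 2))" by auto
  then show ?case
    using Cond.IH(1)[of "n + 1"] Cond.IH(2)[of "n + plen p + 2"] Cond.prems
    by cases (simp_all add: closed_act_idle local_test_const local_test_if)
next
  case (Loop b p)
  from Loop.prems(5) consider "g = (\<lambda>r. (if b r then n + 1 else n + plen p + 2, idle r))"
    | "g \<in> set (compile h p (n + 1))" | "g = (\<lambda>r. (n, idle r))" by auto
  then show ?case
    using Loop.IH[of "n + 1"] Loop.prems
    by cases (simp_all add: closed_act_idle local_test_const local_test_if)
qed (simp_all add: closed_act_fail local_test_const)

text \<open>The halting state is the address just behind the code, so a program that ends normally
  falls into it without a further jump.\<close>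

definition machine :: "nat \<Rightarrow> sym set \<Rightarrow> prog \<Rightarrow> tm" where
  "machine K S p =
     \<lparr>ntapes = K, states = {0..plen p}, symbols = S, start_state = 0, halt_state = plen p,
      delta = (\<lambda>q ss. let g = compile (plen p) p 0 ! q; r = (!) ss in (fst (g r), map (snd (g r)) [0..<K]))\<rparr>"

lemma wf_machine:
  assumes "wf_prog K S p" "1 \<le> K" "finite S" "{Blank, Bit False, Bit True} \<subseteq> S"
  shows "wf_tm (machine K S p)"
proof -
  have "fst (g ((!) ss)) \<le> plen p \<and> fst ` set (map (snd (g ((!) ss))) [0..<K]) \<subseteq> S"
    if "q < plen p" "length ss = K" "set ss \<subseteq> S" "g = compile (plen p) p 0 ! q" for q ss g
  proof -
    have "g \<in> set (compile (plen p) p 0)" using that by simp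
    from compile_closed[OF assms(1) _ _ _ this, of "plen p"] assms that show ?thesis
      by (auto simp: closed_act_def subset_iff)
  qed
  then show ?thesis
    using assms by (auto simp: wf_tm_def machine_def Let_def)
qed

declare tm_step.simps [simp del]

lemma machine_step:
  assumes "wf_prog K S p" "Blank \<in> S" "q < plen p" "compile (plen p) p 0 ! q = g"
  shows "tm_step (machine K S p) (q, map st [0..<K]) =
           (fst (g (reads st)), map (act (\<lambda>r. snd (g r)) st) [0..<K])"
proof -
  have "g \<in> set (compile (plen p) p 0)" using assms by auto
  from compile_closed[OF assms(1,2) _ _ this, of "plen p"]
  have g: "local_test K (\<lambda>r. fst (g r))" "closed_act K S (\<lambda>r. snd (g r))" by auto
  have "agree K ((!) (map (\<lambda>i. read_tape (st i)) [0..<K])) (reads st)"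
    by (simp add: agree_def reads_def)
  with g have "fst (g ((!) (map (\<lambda>i. read_tape (st i)) [0..<K]))) = fst (g (reads st))"
    "agree K (snd (g ((!) (map (\<lambda>i. read_tape (st i)) [0..<K])))) (snd (g (reads st)))"
    by (auto simp: local_test_def closed_act_def)
  then show ?thesis using assms(3,4)
    by (auto simp: machine_def Let_def comp_def agree_def act_def map2_map_map tm_step.simps intro!: nth_equalityI)
qed

lemma act_idle [simp]: "act idle st = st"
  by (rule ext, simp add: act_def reads_def) (metis act_tape.simps add_0_right fun_upd_triv read_tape.simps shift.simps(2) surj_pair)

lemma steps_add: "(f ^^ (m + n)) x = (f ^^ n) ((f ^^ m) x)"
  by (metis add.commute comp_apply funpow_add)

text \<open>The induction follows the derivation of \<open>exec\<close>, since loops rule out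
  induction on the program. The whole program \<open>P\<close> stays fixed while \<open>pre\<close>
  and \<open>post\<close> vary with the block being executed; a failure leaves all enclosing blocks
  at once, since \<open>Fail\<close> jumps straight to the end of \<open>P\<close>.\<close>

lemma exec_steps:
  assumes "exec p st t r" and wf: "wf_prog K S P" "Blank \<in> S" "0 < K"
    and "compile (plen P) P 0 = pre @ compile (plen P) p (length pre) @ post"
  shows "case r of
      Some st' \<Rightarrow> (tm_step (machine K S P) ^^ t) (length pre, map st [0..<K]) = (length pre + plen p, map st' [0..<K])
    | None \<Rightarrow> \<exists>st'. (tm_step (machine K S P) ^^ t) (length pre, map st [0..<K]) = (plen P, map st' [0..<K])
        \<and> read_tape (st' 0) = Blank"
  using assms(1) assms(5)
proof (induction arbitrary: pre post rule: exec.induct)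
  have L: "length pre + plen p \<le> plen P" if "compile (plen P) P 0 = pre @ compile (plen P) p (length pre) @ post" for pre p post
    by (metis add.assoc length_append length_compile that le_add1)
  have step: "tm_step (machine K S P) (length xs, map st [0..<K]) =
           (fst (g (reads st)), map (act (\<lambda>r. snd (g r)) st) [0..<K])"
    if "compile (plen P) P 0 = xs @ g # ys" for xs ys g st
    by (rule machine_step[OF wf(1,2)])
       (metis length_compile length_append length_Cons less_add_Suc1 that add_Suc_right, metis that nth_append_length)
  {
    case (Act f st)
    then show ?case by (simp add: step)
  next
    case (Fail st)
    have "read_tape (act (\<lambda>r. (idle r)(0 := (Blank, Stay))) st 0) = Blank"
      by (cases "st 0") (simp add: act_def)
    with Fail show ?case
      by (auto simp: step)
  next
    case (Seq_None p st t q)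
    from Seq_None.IH[of pre] Seq_None.prems show ?case by simp
  next
    case (Seq_Some p st t st' q t' r)
    have 1: "(tm_step (machine K S P) ^^ t) (length pre, map st [0..<K]) = (length pre + plen p, map st' [0..<K])"
      using Seq_Some.IH(1)[of pre] Seq_Some.prems by simp
    show ?case
      using Seq_Some.IH(2)[of "pre @ compile (plen P) p (length pre)" post] Seq_Some.prems
      by (simp add: steps_add 1 add.assoc split: option.splits)
  next
    case (Cond_None b st p t q)
    from Cond_None.prems have 1: "tm_step (machine K S P) (length pre, map st [0..<K]) = (length pre + 1, map st [0..<K])"
      using Cond_None.hyps by (simp add: step)
    show ?case
      using Cond_None.IH[of "pre @ [_]"] Cond_None.prems by (simp add: funpow_Suc_right 1 del: funpow.simps(2))
  next
    case (Cond_Some b st p t st' q)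
    from Cond_Some.prems have 1: "tm_step (machine K S P) (length pre, map st [0..<K]) = (length pre + 1, map st [0..<K])"
      using Cond_Some.hyps by (simp add: step)
    from Cond_Some.prems have 2: "tm_step (machine K S P) (length pre + 1 + plen p, map st' [0..<K]) = (length pre + plen p + plen q + 2, map st' [0..<K])"
      using step[of "pre @ [_] @ compile (plen P) p (Suc (length pre))"] by simp
    have 3: "(tm_step (machine K S P) ^^ t) (length pre + 1, map st [0..<K]) = (length pre + 1 + plen p, map st' [0..<K])"
      using Cond_Some.IH[of "pre @ [_]"] Cond_Some.prems by simp
    show ?case
      using 1 2 3 by (simp only: steps_add) simp
  next
    case (Cond_else b st q t r p)
    from Cond_else.prems have 1: "tm_step (machine K S P) (length pre, map st [0..<K]) = (length pre + plen p + 2, map st [0..<K])"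
      using Cond_else.hyps by (simp add: step)
    show ?case
      using Cond_else.IH[of "pre @ [_] @ compile (plen P) p (Suc (length pre)) @ [_]" post] Cond_else.prems
      by (simp add: funpow_Suc_right 1 del: funpow.simps(2) split: option.splits)
  next
    case (Loop_end b st p)
    then show ?case by (simp add: step)
  next
    case (Loop_None b st p t)
    from Loop_None.prems have 1: "tm_step (machine K S P) (length pre, map st [0..<K]) = (length pre + 1, map st [0..<K])"
      using Loop_None.hyps by (simp add: step)
    show ?case
      using Loop_None.IH[of "pre @ [_]"] Loop_None.prems by (simp add: funpow_Suc_right 1 del: funpow.simps(2))
  next
    case (Loop_Some b st p t st' t' r)
    from Loop_Some.prems have 1: "tm_step (machine K S P) (length pre, map st [0..<K]) = (length pre + 1, map st [0..<K])"
      using Loop_Some.hyps by (simp add: step)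
    from Loop_Some.prems have 2: "tm_step (machine K S P) (length pre + 1 + plen p, map st' [0..<K]) = (length pre, map st' [0..<K])"
      using step[of "pre @ [_] @ compile (plen P) p (Suc (length pre))"] by simp
    have 3: "(tm_step (machine K S P) ^^ t) (length pre + 1, map st [0..<K]) = (length pre + 1 + plen p, map st' [0..<K])"
      using Loop_Some.IH(1)[of "pre @ [_]"] Loop_Some.prems by simp
    have "(tm_step (machine K S P) ^^ (1 + t + 1)) (length pre, map st [0..<K]) = (length pre, map st' [0..<K])"
      using 1 2 3 by (simp only: steps_add) simp
    then show ?case
      using Loop_Some.IH(2)[OF Loop_Some.prems] by (simp only: steps_add)
  }
qed

text \<open>
  The argument \<open>t\<close> is the time elapsed so far, so that \<open>F\<close> and \<open>Q\<close> (the conditions on failing and on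
  regular termination) can bound the total running time.
\<close>

definition wp :: "prog \<Rightarrow> (nat \<Rightarrow> bool) \<Rightarrow> (nat \<Rightarrow> store \<Rightarrow> bool) \<Rightarrow> nat \<Rightarrow> store \<Rightarrow> bool" where
  "wp p F Q t st \<longleftrightarrow>
     (\<exists>t' r. exec p st t' r \<and> (case r of None \<Rightarrow> F (t + t') | Some st' \<Rightarrow> Q (t + t') st'))"

section \<open>Proof rules with time accounting\<close>

lemma wp_Act: "wp (Act f) F Q t st = Q (t + 1) (act f st)"
  unfolding wp_def by (auto intro!: exI exec.Act elim!: exec_ActE)

lemma wp_Fail [simp]: "wp Fail F Q t st = F (t + 1)"
  unfolding wp_def by (auto intro!: exI exec.Fail elim!: exec_FailE)

lemma wp_Seq [simp]: "wp (p ;; q) F Q t st = wp p F (wp q F Q) t st"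
proof
  assume "wp (p ;; q) F Q t st"
  then obtain t' r where e: "exec (p ;; q) st t' r" and
    r: "case r of None \<Rightarrow> F (t + t') | Some st' \<Rightarrow> Q (t + t') st'"
    unfolding wp_def by blast
  from e show "wp p F (wp q F Q) t st"
  proof (rule exec_SeqE)
    assume "r = None" "exec p st t' None"
    with r show ?thesis unfolding wp_def by (intro exI[of _ t'] exI[of _ None]) simp
  next
    fix t1 st' t2
    assume "t' = t1 + t2" "exec p st t1 (Some st')" "exec q st' t2 r"
    with r have "wp q F Q (t + t1) st'"
      unfolding wp_def by (intro exI[of _ t2] exI[of _ r]) (simp add: add.assoc split: option.splits)
    with \<open>exec p st t1 (Some st')\<close> show ?thesis
      unfolding wp_def[of p] by (intro exI[of _ t1] exI[of _ "Some st'"]) simp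
  qed
next
  assume "wp p F (wp q F Q) t st"
  then obtain t' r where e: "exec p st t' r" and
    r: "case r of None \<Rightarrow> F (t + t') | Some st' \<Rightarrow> wp q F Q (t + t') st'"
    unfolding wp_def[of p] by blast
  then show "wp (p ;; q) F Q t st"
  proof (cases r)
    case None
    with e r show ?thesis
      unfolding wp_def by (intro exI[of _ t'] exI[of _ None]) (auto intro: exec.intros)
  next
    case (Some st')
    with r obtain t2 r2 where "exec q st' t2 r2" and
      r2: "case r2 of None \<Rightarrow> F (t + t' + t2) | Some st' \<Rightarrow> Q (t + t' + t2) st'"
      unfolding wp_def by auto
    with e Some have "exec (p ;; q) st (t' + t2) r2"
      by (auto intro: exec.intros)
    with r2 show ?thesis
      unfolding wp_def by (intro exI[of _ "t' + t2"] exI[of _ r2]) (simp add: add.assoc split: option.splits)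
  qed
qed

lemma wp_Cond [simp]:
  "wp (Cond b p q) F Q t st =
     (if b (reads st) then wp p F (\<lambda>t. Q (t + 1)) (t + 1) st else wp q F Q (t + 1) st)" (is "_ = ?R")
proof
  assume "wp (Cond b p q) F Q t st"
  then obtain t' r where e: "exec (Cond b p q) st t' r" and
    r: "case r of None \<Rightarrow> F (t + t') | Some st' \<Rightarrow> Q (t + t') st'"
    unfolding wp_def by blast
  from e show ?R
  proof (rule exec_CondE)
    fix t1 assume "t' = Suc t1" "r = None" "b (reads st)" "exec p st t1 None"
    with r show ?R unfolding wp_def by (auto intro!: exI[of _ t1] exI[of _ None])
  next
    fix t1 st' assume "t' = Suc (Suc t1)" "r = Some st'" "b (reads st)" "exec p st t1 (Some st')"
    with r show ?R unfolding wp_def by (auto intro!: exI[of _ t1] exI[of _ "Some st'"])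
  next
    fix t1 assume "t' = Suc t1" "\<not> b (reads st)" "exec q st t1 r"
    with r show ?R unfolding wp_def by (auto intro!: exI[of _ t1] exI[of _ r] split: option.splits)
  qed
next
  assume ?R
  show "wp (Cond b p q) F Q t st"
  proof (cases "b (reads st)")
    case True
    with \<open>?R\<close> obtain t' r where e: "exec p st t' r" and
      r: "case r of None \<Rightarrow> F (t + 1 + t') | Some st' \<Rightarrow> Q (t + 1 + t' + 1) st'"
      unfolding wp_def by auto
    show ?thesis
    proof (cases r)
      case None
      with e r True show ?thesis
        unfolding wp_def by (intro exI[of _ "1 + t'"] exI[of _ None]) (auto simp: exec.Cond_None simp del: One_nat_def plus_1_eq_Suc simp: add.assoc)
    next
      case (Some st')
      with e r True show ?thesis
        unfolding wp_def by (intro exI[of _ "1 + t' + 1"] exI[of _ r]) (auto dest: exec.Cond_Some[where b = b and q = q] simp: add.assoc simp del: One_nat_def plus_1_eq_Suc)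
    qed
  next
    case False
    with \<open>?R\<close> obtain t' r where "exec q st t' r" and
      "case r of None \<Rightarrow> F (t + 1 + t') | Some st' \<Rightarrow> Q (t + 1 + t') st'"
      unfolding wp_def by auto
    with False show ?thesis
      unfolding wp_def by (intro exI[of _ "1 + t'"] exI[of _ r]) (auto simp: exec.Cond_else add.assoc simp del: One_nat_def plus_1_eq_Suc split: option.splits)
  qed
qed

text \<open>Unrolls one iteration. As a simp rule it would rewrite forever, so it is applied by hand
  or through the counting rules for loops.\<close>

lemma wp_Loop:
  "wp (Loop b p) F Q t st =
     (if b (reads st) then wp p F (\<lambda>t. wp (Loop b p) F Q (t + 1)) (t + 1) st else Q (t + 1) st)" (is "_ = ?R")
proof
  assume "wp (Loop b p) F Q t st"
  then obtain t' r where e: "exec (Loop b p) st t' r" and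
    r: "case r of None \<Rightarrow> F (t + t') | Some st' \<Rightarrow> Q (t + t') st'"
    unfolding wp_def by blast
  from e show ?R
  proof (rule exec_LoopE)
    assume "t' = Suc 0" "r = Some st" "\<not> b (reads st)"
    with r show ?R by simp
  next
    fix t1 assume "t' = Suc t1" "r = None" "b (reads st)" "exec p st t1 None"
    with r show ?R unfolding wp_def by (auto intro!: exI[of _ t1] exI[of _ None])
  next
    fix t1 st' t2
    assume *: "t' = Suc (Suc (t1 + t2))" "b (reads st)" "exec p st t1 (Some st')" "exec (Loop b p) st' t2 r"
    with r have "wp (Loop b p) F Q (t + 1 + t1 + 1) st'"
      unfolding wp_def by (intro exI[of _ t2] exI[of _ r]) (simp add: add.assoc split: option.splits)
    with * show ?R unfolding wp_def[of p] by (auto intro!: exI[of _ t1] exI[of _ "Some st'"])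
  qed
next
  assume ?R
  show "wp (Loop b p) F Q t st"
  proof (cases "b (reads st)")
    case True
    with \<open>?R\<close> obtain t' r where e: "exec p st t' r" and
      r: "case r of None \<Rightarrow> F (t + 1 + t') | Some st' \<Rightarrow> wp (Loop b p) F Q (t + 1 + t' + 1) st'"
      unfolding wp_def[of p] by auto
    show ?thesis
    proof (cases r)
      case None
      with e r True show ?thesis
        unfolding wp_def by (intro exI[of _ "1 + t'"] exI[of _ None]) (auto simp: exec.Loop_None add.assoc simp del: One_nat_def plus_1_eq_Suc)
    next
      case (Some st')
      with r obtain t2 r2 where "exec (Loop b p) st' t2 r2" and
        r2: "case r2 of None \<Rightarrow> F (t + 1 + t' + 1 + t2) | Some st' \<Rightarrow> Q (t + 1 + t' + 1 + t2) st'"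
        unfolding wp_def by auto
      with e Some True have "exec (Loop b p) st (1 + t' + 1 + t2) r2"
        by (auto intro: exec.Loop_Some simp del: One_nat_def plus_1_eq_Suc)
      with r2 show ?thesis
        unfolding wp_def by (intro exI[of _ "1 + t' + 1 + t2"] exI[of _ r2]) (simp add: add.assoc split: option.splits)
    qed
  next
    case False
    with \<open>?R\<close> show ?thesis
      unfolding wp_def by (intro exI[of _ 1] exI[of _ "Some st"]) (auto simp: exec.Loop_end simp del: One_nat_def plus_1_eq_Suc)
  qed
qed

section \<open>Parsing instances and uniqueness of the witness\<close>

fun unary :: "bool list \<Rightarrow> (nat \<times> bool list) option" where
  "unary [] = None"
| "unary (False # u) = Some (0, u)"
| "unary (True # u) = map_option (apfst Suc) (unary u)"

lemma unary_eq_Some_iff: "unary u = Some (n, u') \<longleftrightarrow> u = enc_unary n @ u'"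
proof (induction u arbitrary: n rule: unary.induct)
  case (3 u)
  then show ?case by (cases n) (auto simp: enc_unary_def)
qed (auto simp: enc_unary_def Cons_eq_append_conv Cons_replicate_eq)

lemma unary_eq_NoneE:
  assumes "unary u = None"
  obtains n where "u = replicate n True"
proof -
  have "\<exists>n. u = replicate n True"
    using assms by (induction u rule: unary.induct) (auto intro: exI[of _ 0] exI[of _ "Suc _"])
  with that show ?thesis by blast
qed

text \<open>Decoding a wire number and looking up its value are one operation, as the machine stores
  wire values but no gates. The range check is what later makes a successful run certify the wiring
  condition of \<open>circuit_type\<close>.\<close>

definition fetch :: "bool list \<Rightarrow> bool list \<Rightarrow> (bool \<times> bool list) option" where
  "fetch vs u = (case unary u of None \<Rightarrow> None | Some (i, u') \<Rightarrow> if i < length vs then Some (vs ! i, u') else None)"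

lemma fetch_eq_Some_iff:
  "fetch vs u = Some (a, u') \<longleftrightarrow> (\<exists>i < length vs. u = enc_unary i @ u' \<and> a = vs ! i)"
    (is "?L \<longleftrightarrow> ?R")
proof
  assume ?L then show ?R
    by (auto simp: fetch_def unary_eq_Some_iff split: option.splits if_splits)
next
  assume ?R
  then obtain i where "i < length vs" "unary u = Some (i, u')" "a = vs ! i"
    by (auto simp: unary_eq_Some_iff)
  then show ?L by (simp add: fetch_def)
qed

lemma length_fetch: "fetch vs u = Some (a, u') \<Longrightarrow> length u' < length u"
  by (auto simp: fetch_eq_Some_iff enc_unary_def)

fun run_gate :: "bool list \<Rightarrow> bool list \<Rightarrow> (bool \<times> bool list) option" where
  "run_gate vs (False # False # b # u) = Some (b, u)"
| "run_gate vs (False # True # u) =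
     (case fetch vs u of None \<Rightarrow> None | Some (a, u) \<Rightarrow> Some (\<not> a, u))"
| "run_gate vs (True # b # u) =
     (case fetch vs u of None \<Rightarrow> None | Some (a1, u) \<Rightarrow>
      case fetch vs u of None \<Rightarrow> None | Some (a2, u) \<Rightarrow> Some (if b then a1 \<or> a2 else a1 \<and> a2, u))"
| "run_gate vs u = None"

lemma run_gate_eq_Some_iff:
  "run_gate vs u = Some (a, u') \<longleftrightarrow>
     (\<exists>g. u = enc_gate g @ u' \<and> (\<forall>i \<in> gate_args g. i < length vs) \<and> a = eval_gate vs g)"
    (is "?L \<longleftrightarrow> ?R")
proof
  assume ?L
  then show ?R
  proof (induction vs u rule: run_gate.induct)
    case (1 vs b u)
    then show ?case by (intro exI[of _ "Const b"]) auto
  next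
    case (2 vs u)
    then obtain b where "fetch vs u = Some (b, u')" "a = (\<not> b)"
      by (auto split: option.splits)
    then obtain i where "i < length vs" "u = enc_unary i @ u'" "a = (\<not> vs ! i)"
      by (auto simp: fetch_eq_Some_iff)
    then show ?case by (intro exI[of _ "gate.Not i"]) auto
  next
    case (3 vs b u)
    then obtain i j where "i < length vs" "j < length vs" "u = enc_unary i @ enc_unary j @ u'"
      "a = (if b then vs ! i \<or> vs ! j else vs ! i \<and> vs ! j)"
      by (fastforce simp: fetch_eq_Some_iff split: option.splits)
    then show ?case by (intro exI[of _ "if b then Or i j else And i j"]) auto
  qed auto
next
  assume ?R
  then obtain g where g: "u = enc_gate g @ u'" "\<forall>i \<in> gate_args g. i < length vs" "a = eval_gate vs g"
    by blast
  have f: "fetch vs (enc_unary i @ u) = Some (vs ! i, u)" if "i < length vs" for i u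
    using that by (auto simp: fetch_eq_Some_iff)
  show ?L by (cases g) (use g in \<open>simp_all add: f\<close>)
qed

lemma length_run_gate: "run_gate vs u = Some (a, u') \<Longrightarrow> length u' < length u"
  by (cases "(vs, u)" rule: run_gate.cases) (auto split: option.splits dest!: length_fetch)

function run_gates :: "bool list \<Rightarrow> bool list \<Rightarrow> (bool list \<times> bool list) option" where
  "run_gates vs [] = None"
| "run_gates vs (False # u) = Some (vs, u)"
| "run_gates vs (True # u) =
     (case run_gate vs u of None \<Rightarrow> None | Some (a, u) \<Rightarrow> run_gates (vs @ [a]) u)"
  by pat_completeness auto
termination
  by (relation "measure (length \<circ> snd)") (auto dest: length_run_gate)

function run_outs :: "bool list \<Rightarrow> bool list \<Rightarrow> (bool list \<times> bool list) option" where
  "run_outs vs [] = None"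
| "run_outs vs (False # u) = Some ([], u)"
| "run_outs vs (True # u) =
     (case fetch vs u of None \<Rightarrow> None | Some (a, u) \<Rightarrow> map_option (apfst ((#) a)) (run_outs vs u))"
  by pat_completeness auto
termination
  by (relation "measure (length \<circ> snd)") (auto dest: length_fetch)

abbreviation eval_gates :: "bool list \<Rightarrow> gate list \<Rightarrow> bool list" where
  "eval_gates \<equiv> foldl (\<lambda>vs g. vs @ [eval_gate vs g])"

text \<open>The gate condition of \<open>circuit_type\<close> with a variable starting index, so
  that an induction can remove the first gate and count it as a further wire.\<close>

definition wf_gates :: "nat \<Rightarrow> gate list \<Rightarrow> bool" where
  "wf_gates n gs \<longleftrightarrow> (\<forall>j < length gs. \<forall>i \<in> gate_args (gs ! j). i < n + j)"

lemma wf_gates_Nil [simp]: "wf_gates n []"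
  by (simp add: wf_gates_def)

lemma wf_gates_Cons [simp]:
  "wf_gates n (g # gs) \<longleftrightarrow> (\<forall>i \<in> gate_args g. i < n) \<and> wf_gates (Suc n) gs"
  by (simp add: wf_gates_def All_less_Suc2 del: All_less_Suc)

lemma enc_list_Nil [simp]: "enc_list e [] = [False]"
  and enc_list_Cons [simp]: "enc_list e (x # xs) = True # e x @ enc_list e xs"
  by (simp_all add: enc_list_def)

lemma length_eval_gates [simp]: "length (eval_gates vs gs) = length vs + length gs"
  by (induction gs arbitrary: vs) auto

lemma run_gates_eq_Some_iff:
  "run_gates vs u = Some (vs', u') \<longleftrightarrow>
     (\<exists>gs. u = enc_list enc_gate gs @ u' \<and> wf_gates (length vs) gs \<and> vs' = eval_gates vs gs)"
    (is "?L vs u \<longleftrightarrow> ?R vs u")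
proof
  show "?L vs u \<Longrightarrow> ?R vs u"
  proof (induction vs u rule: run_gates.induct)
    case (2 vs u)
    then show ?case by (intro exI[of _ "[]"]) auto
  next
    case (3 vs u)
    then obtain a u1 where 1: "run_gate vs u = Some (a, u1)" "run_gates (vs @ [a]) u1 = Some (vs', u')"
      by (auto split: option.splits)
    with 3 obtain g gs where "u = enc_gate g @ u1" "\<forall>i \<in> gate_args g. i < length vs" "a = eval_gate vs g"
      "u1 = enc_list enc_gate gs @ u'" "wf_gates (Suc (length vs)) gs" "vs' = eval_gates (vs @ [a]) gs"
      by (fastforce simp: run_gate_eq_Some_iff)
    then show ?case by (intro exI[of _ "g # gs"]) auto
  qed auto
  assume "?R vs u"
  then obtain gs where "u = enc_list enc_gate gs @ u'" "wf_gates (length vs) gs" "vs' = eval_gates vs gs"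
    by blast
  then show "?L vs u"
  proof (induction gs arbitrary: vs u)
    case (Cons g gs)
    then have "run_gate vs (enc_gate g @ enc_list enc_gate gs @ u') = Some (eval_gate vs g, enc_list enc_gate gs @ u')"
      by (auto simp: run_gate_eq_Some_iff)
    with Cons show ?case by simp
  qed auto
qed

lemma run_outs_eq_Some_iff:
  "run_outs vs u = Some (bs, u') \<longleftrightarrow>
     (\<exists>ws. u = enc_list enc_unary ws @ u' \<and> (\<forall>i \<in> set ws. i < length vs) \<and> bs = map ((!) vs) ws)"
    (is "?L u bs \<longleftrightarrow> ?R u bs")
proof
  show "?L u bs \<Longrightarrow> ?R u bs"
  proof (induction vs u arbitrary: bs rule: run_outs.induct)
    case (2 vs u)
    then show ?case by (intro exI[of _ "[]"]) auto
  next
    case (3 vs u)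
    then obtain a u1 bs' where 1: "fetch vs u = Some (a, u1)" "run_outs vs u1 = Some (bs', u')" "bs = a # bs'"
      by (auto split: option.splits)
    with 3 obtain i ws where "u = enc_unary i @ u1" "i < length vs" "a = vs ! i"
      "u1 = enc_list enc_unary ws @ u'" "\<forall>i \<in> set ws. i < length vs" "bs' = map ((!) vs) ws"
      by (fastforce simp: fetch_eq_Some_iff)
    with 1(3) show ?case by (intro exI[of _ "i # ws"]) auto
  qed auto
  assume "?R u bs"
  then obtain ws where "u = enc_list enc_unary ws @ u'" "\<forall>i \<in> set ws. i < length vs" "bs = map ((!) vs) ws"
    by blast
  then show "?L u bs"
  proof (induction ws arbitrary: u bs)
    case (Cons i ws)
    then have "fetch vs (enc_unary i @ enc_list enc_unary ws @ u') = Some (vs ! i, enc_list enc_unary ws @ u')"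
      by (auto simp: fetch_eq_Some_iff)
    with Cons show ?case by simp
  qed auto
qed

definition run_circuit :: "bool list \<Rightarrow> bool list \<Rightarrow> (bool list \<times> bool list) option" where
  "run_circuit xs u = (case run_gates xs u of None \<Rightarrow> None | Some (vs, u') \<Rightarrow> run_outs vs u')"

text \<open>\<open>run_circuit\<close> starts behind the input count, which has been consumed to
  obtain \<open>xs\<close>; hence \<open>enc_unary (length xs)\<close> is put back in front before
  comparing with a circuit code.\<close>

lemma run_circuit_eq_Some_iff:
  "run_circuit xs u = Some (bs, u') \<longleftrightarrow>
     (\<exists>C. enc_unary (length xs) @ u = enc_circuit C @ u' \<and>
          circuit_type C (length xs) (length bs) \<and> bs = eval_circuit C xs)"
    (is "?L \<longleftrightarrow> ?R")
proof
  assume ?L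
  then obtain gs ws where "u = enc_list enc_gate gs @ enc_list enc_unary ws @ u'"
    "wf_gates (length xs) gs" "\<forall>i \<in> set ws. i < length xs + length gs" "bs = map ((!) (eval_gates xs gs)) ws"
    by (fastforce simp: run_circuit_def run_gates_eq_Some_iff run_outs_eq_Some_iff split: option.splits)
  then show ?R
    by (intro exI[of _ "\<lparr>num_inputs = length xs, gates = gs, output_wires = ws\<rparr>"])
       (auto simp: enc_circuit_def circuit_type_def eval_circuit_def wf_gates_def)
next
  assume ?R
  then obtain C where C: "enc_unary (length xs) @ u = enc_circuit C @ u'"
    "circuit_type C (length xs) (length bs)" "bs = eval_circuit C xs" by blast
  then have "u = enc_list enc_gate (gates C) @ enc_list enc_unary (output_wires C) @ u'"
    by (simp add: enc_circuit_def circuit_type_def)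
  moreover have "run_gates xs \<dots> = Some (eval_gates xs (gates C), enc_list enc_unary (output_wires C) @ u')"
    using C by (auto simp: run_gates_eq_Some_iff wf_gates_def circuit_type_def)
  moreover have "run_outs (eval_gates xs (gates C)) (enc_list enc_unary (output_wires C) @ u') = Some (bs, u')"
    using C by (auto simp: run_outs_eq_Some_iff circuit_type_def eval_circuit_def intro!: exI[of _ "output_wires C"])
  ultimately show ?L by (simp add: run_circuit_def)
qed

text \<open>Unlike the other parsers it returns no rest: the number closes the instance, so trailing
  bits must lead to rejection.\<close>

fun read_bits :: "bool list \<Rightarrow> bool list option" where
  "read_bits [False] = Some []"
| "read_bits (True # b # u) = map_option ((#) b) (read_bits u)"
| "read_bits u = None"

lemma read_bits_eq_Some_iff: "read_bits u = Some bs \<longleftrightarrow> u = enc_list (\<lambda>b. [b]) bs"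
proof (induction u arbitrary: bs rule: read_bits.induct)
  case 1
  then show ?case by (cases bs) auto
next
  case (2 b u)
  then show ?case by (cases bs) auto
qed (case_tac bs; auto)+

section \<open>Canonical binary numerals\<close>

lemma bits_to_nat_Nil [simp]: "bits_to_nat [] = 0"
  by (simp add: bits_to_nat_def)

lemma bits_to_nat_snoc [simp]: "bits_to_nat (bs @ [b]) = of_bool b + 2 * bits_to_nat bs"
  by (simp add: bits_to_nat_def)

lemma bits_to_nat_single [simp]: "bits_to_nat [b] = of_bool b"
  using bits_to_nat_snoc[of "[]" b] by simp

lemma bits_to_nat_pos: "bs \<noteq> [] \<Longrightarrow> hd bs \<Longrightarrow> 0 < bits_to_nat bs"
proof (induction bs rule: rev_induct)
  case (snoc b bs)
  then show ?case by (cases "bs = []") auto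
qed simp

text \<open>Together with \<open>nat_to_bits_hd\<close> this shows that the numerals of positive
  numbers are the lists with leading bit \<open>True\<close>. Looking at one bit thus settles both
  \<open>1 \<le> k\<close> and the absence of leading zeros.\<close>

lemma nat_to_bits_bits_to_nat: "bs \<noteq> [] \<Longrightarrow> hd bs \<Longrightarrow> nat_to_bits (bits_to_nat bs) = bs"
proof (induction bs rule: rev_induct)
  case (snoc b bs)
  then show ?case
  proof (cases "bs = []")
    case True
    with snoc show ?thesis by (simp add: nat_to_bits.simps)
  next
    case False
    with snoc have "hd bs" by simp
    with snoc False bits_to_nat_pos[of bs] show ?thesis
      by (subst nat_to_bits.simps) auto
  qed
qed simp

lemma nat_to_bits_hd: "1 \<le> k \<Longrightarrow> nat_to_bits k \<noteq> [] \<and> hd (nat_to_bits k)"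
proof (induction k rule: less_induct)
  case (less k)
  show ?case
  proof (cases "k = 1")
    case True
    then show ?thesis by (simp add: nat_to_bits.simps)
  next
    case False
    with less.prems have "nat_to_bits (k div 2) \<noteq> [] \<and> hd (nat_to_bits (k div 2))"
      by (intro less.IH) auto
    with less.prems show ?thesis by (subst (1 2) nat_to_bits.simps) auto
  qed
qed

text \<open>
  A challenge \<open>x\<^sub>2\<close> of the wrong length is truncated or padded instead of being detected: since \<open>x\<^sub>2\<close> is
  universally quantified, this does not change acceptance.
\<close>

definition pad :: "nat \<Rightarrow> bool list \<Rightarrow> bool list" where
  "pad m y = take m (y @ replicate m False)"

lemma length_pad [simp]: "length (pad m y) = m"
  by (simp add: pad_def)

lemma pad_id: "length y = m \<Longrightarrow> pad m y = y"
  by (simp add: pad_def)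

definition good_output :: "circuit \<Rightarrow> circuit \<Rightarrow> nat \<Rightarrow> bool list \<Rightarrow> bool list \<Rightarrow> bool" where
  "good_output C V k x y \<longleftrightarrow>
     eval_circuit V (eval_circuit C (x @ y)) = x @ y \<and> k \<le> bits_to_nat (eval_circuit C (x @ y))"

text \<open>The predicate that a single run decides, for one challenge \<open>y\<close>. Although
  quantified, \<open>m\<close> is fixed by \<open>u\<close> and \<open>x\<close>, namely as the
  input count of \<open>C\<close> minus \<open>length x\<close>.\<close>

definition checks :: "bool list \<Rightarrow> bool list \<Rightarrow> bool list \<Rightarrow> bool" where
  "checks u x y \<longleftrightarrow> (\<exists>C V k m.
     u = enc_instance C V k \<and> circuit_type C (length x + m) (m + 1) \<and> circuit_type V (m + 1) (length x + m) \<and>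
     1 \<le> k \<and> good_output C V k x (pad m y))"

text \<open>Replaces the quantified circuits by parser calls in the order in which the tape is read.
  The number of outputs of \<open>V\<close> gets no test of its own: it is forced by the equality of
  its output with the input of \<open>C\<close>.\<close>

lemma checks_iff:
  "checks u x y \<longleftrightarrow> (\<exists>N u1 z u2 u3 u4 ks. unary u = Some (N, u1) \<and> length x \<le> N \<and>
     run_circuit (x @ pad (N - length x) y) u1 = Some (z, u2) \<and>
     unary u2 = Some (length z, u3) \<and> length z = N - length x + 1 \<and>
     run_circuit z u3 = Some (x @ pad (N - length x) y, u4) \<and>
     read_bits u4 = Some ks \<and> ks \<noteq> [] \<and> hd ks \<and> bits_to_nat ks \<le> bits_to_nat z)" (is "_ \<longleftrightarrow> ?R")
proof
  assume "checks u x y"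
  then obtain C V k m where *: "u = enc_instance C V k" "circuit_type C (length x + m) (m + 1)"
    "circuit_type V (m + 1) (length x + m)" "1 \<le> k" "good_output C V k x (pad m y)"
    unfolding checks_def by blast
  let ?N = "length x + m"
  let ?u1 = "enc_list enc_gate (gates C) @ enc_list enc_unary (output_wires C) @ enc_circuit V @ enc_list (\<lambda>b. [b]) (nat_to_bits k)"
  let ?u3 = "enc_list enc_gate (gates V) @ enc_list enc_unary (output_wires V) @ enc_list (\<lambda>b. [b]) (nat_to_bits k)"
  let ?z = "eval_circuit C (x @ pad m y)"
  have z: "length ?z = m + 1" using * by (simp add: circuit_type_def eval_circuit_def)
  show ?R
    by (rule exI[of _ ?N], rule exI[of _ ?u1], rule exI[of _ ?z],
        rule exI[of _ "enc_circuit V @ enc_list (\<lambda>b. [b]) (nat_to_bits k)"], rule exI[of _ ?u3],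
        rule exI[of _ "enc_list (\<lambda>b. [b]) (nat_to_bits k)"], rule exI[of _ "nat_to_bits k"])
       (use * z nat_to_bits_hd[of k] in \<open>auto simp: unary_eq_Some_iff enc_instance_def enc_circuit_def circuit_type_def good_output_def
          run_circuit_eq_Some_iff read_bits_eq_Some_iff bits_to_nat_nat_to_bits intro: exI[of _ C] exI[of _ V]\<close>)
next
  assume ?R
  then obtain N u1 z u2 u3 u4 ks where *: "unary u = Some (N, u1)" "length x \<le> N"
     "run_circuit (x @ pad (N - length x) y) u1 = Some (z, u2)"
     "unary u2 = Some (length z, u3)" "length z = N - length x + 1"
     "run_circuit z u3 = Some (x @ pad (N - length x) y, u4)"
     "read_bits u4 = Some ks" "ks \<noteq> []" "hd ks" "bits_to_nat ks \<le> bits_to_nat z" by blast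
  then obtain C V where
    "u = enc_circuit C @ u2" "circuit_type C N (length z)" "z = eval_circuit C (x @ pad (N - length x) y)"
    "u2 = enc_circuit V @ u4" "circuit_type V (length z) N" "eval_circuit V z = x @ pad (N - length x) y"
    by (auto simp: unary_eq_Some_iff run_circuit_eq_Some_iff)
  with * bits_to_nat_pos[of ks] show "checks u x y"
    unfolding checks_def good_output_def
    by (intro exI[of _ C] exI[of _ V] exI[of _ "bits_to_nat ks"] exI[of _ "N - length x"])
       (auto simp: enc_instance_def nat_to_bits_bits_to_nat read_bits_eq_Some_iff)
qed

section \<open>Uniqueness of the witness by counting\<close>

lemma bits_to_nat_replicate_False: "bits_to_nat (replicate n False) = 0"
proof (induction n)
  case (Suc n)
  then have "bits_to_nat (replicate n False @ [False]) = 0" by simp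
  then show ?case by (simp add: replicate_append_same)
qed simp

lemma card_bool_lists: "card {y :: bool list. length y = m} = 2 ^ m" "finite {y :: bool list. length y = m}"
  using card_lists_length_eq[of "UNIV :: bool set" m] finite_lists_length_eq[of "UNIV :: bool set" m] by simp_all

lemma good_prefix_unique:
  assumes C: "circuit_type C (n + m) (m + 1)" and k: "1 \<le> k"
    and x: "length x = n" "\<And>y. length y = m \<Longrightarrow> good_output C V k x y"
    and x': "length x' = n" "\<And>y. length y = m \<Longrightarrow> good_output C V k x' y"
  shows "x = x'"
proof (rule ccontr)
  assume "x \<noteq> x'"
  let ?Y = "{y :: bool list. length y = m}"
  let ?A = "(@) x ` ?Y \<union> (@) x' ` ?Y"
  let ?Z = "{z :: bool list. length z = m + 1} - {replicate (m + 1) False}"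
  \<comment> \<open>Disjoint because \<open>x\<close> and \<open>x'\<close> are different strings of
    the same length \<open>n\<close>, so neither is a prefix of the other.\<close>
  have "(@) x ` ?Y \<inter> (@) x' ` ?Y = {}"
    using \<open>x \<noteq> x'\<close> x x' by auto
  then have "card ?A = 2 ^ m + 2 ^ m"
    by (subst card_Un_disjoint) (auto simp: card_image inj_on_def card_bool_lists)
  have "inj_on (eval_circuit C) ?A"
    by (rule inj_on_inverseI[of _ "eval_circuit V"]) (use x x' in \<open>auto simp: good_output_def\<close>)
  moreover have "eval_circuit C ` ?A \<subseteq> ?Z"
  proof
    fix z assume "z \<in> eval_circuit C ` ?A"
    then have "1 \<le> bits_to_nat z" "length z = m + 1"
      using x x' k C by (fastforce simp: good_output_def eval_circuit_def circuit_type_def)+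
    then have "z \<noteq> replicate (m + 1) False"
      using bits_to_nat_replicate_False[of "m + 1"] by (intro notI) simp
    with \<open>length z = m + 1\<close> show "z \<in> ?Z" by simp
  qed
  ultimately have "card ?A \<le> card ?Z"
    using card_bool_lists(2) by (intro card_inj_on_le) auto
  also have "\<dots> < 2 ^ (m + 1)"
    by (subst card_Diff_singleton) (auto simp: card_bool_lists)
  finally show False using \<open>card ?A = _\<close> by simp
qed

section \<open>Basic routines\<close>

lemma wp_mono: "wp p F Q t st \<Longrightarrow> (\<And>t st. Q t st \<Longrightarrow> Q' t st) \<Longrightarrow> wp p F Q' t st"
  unfolding wp_def by (metis (no_types, lifting) option.case_eq_if)

text \<open>\<open>S i\<close> is the store after \<open>i\<close> rounds and \<open>c\<close>
  bounds the body; the 2 pays for the test and the jump back. What happens after \<open>n\<close>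
  rounds is left open, which allows for loops whose next round fails inside the body.\<close>

lemma wp_Loop_upto:
  assumes step: "\<And>i t. i < n \<Longrightarrow> t \<le> t0 + i * (c + 2) + 1 \<Longrightarrow>
      b (reads (S i)) \<and> wp p F (\<lambda>t' st'. t' \<le> t + c \<and> st' = S (Suc i)) t (S i)"
    and rest: "\<And>t. t \<le> t0 + n * (c + 2) \<Longrightarrow> wp (Loop b p) F Q t (S n)"
  shows "wp (Loop b p) F Q t0 (S 0)"
proof -
  have "wp (Loop b p) F Q t (S i)" if "i \<le> n" "t \<le> t0 + i * (c + 2)" for i t
    using that
  proof (induction "n - i" arbitrary: i t)
    case 0
    then show ?case using rest by simp
  next
    case (Suc d)
    then have "i < n" by simp
    have "wp p F (\<lambda>t. wp (Loop b p) F Q (t + 1)) (t + 1) (S i)"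
    proof (rule wp_mono)
      show "wp p F (\<lambda>t' st'. t' \<le> (t + 1) + c \<and> st' = S (Suc i)) (t + 1) (S i)"
        using step[OF \<open>i < n\<close>, of "t + 1"] Suc.prems by simp
      show "wp (Loop b p) F Q (t' + 1) st'" if "t' \<le> t + 1 + c \<and> st' = S (Suc i)" for t' st'
        using that Suc.hyps(1)[of "Suc i" "t' + 1"] Suc.hyps(2) Suc.prems by simp
    qed
    then show ?case
      using step[OF \<open>i < n\<close>, of "t0 + i * (c + 2) + 1"] by (subst wp_Loop) simp
  qed
  then show ?thesis by simp
qed

lemma wp_Loop_count:
  assumes "\<And>i t. i < n \<Longrightarrow> t \<le> t0 + i * (c + 2) + 1 \<Longrightarrow>
      b (reads (S i)) \<and> wp p F (\<lambda>t' st'. t' \<le> t + c \<and> st' = S (Suc i)) t (S i)"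
    and "\<not> b (reads (S n))"
    and "\<And>t. t \<le> t0 + n * (c + 2) + 1 \<Longrightarrow> Q t (S n)"
  shows "wp (Loop b p) F Q t0 (S 0)"
  using assms(1)
proof (rule wp_Loop_upto[where n = n and c = c])
  fix t assume "t \<le> t0 + n * (c + 2)"
  then show "wp (Loop b p) F Q t (S n)"
    using assms(2,3) by (subst wp_Loop) simp
qed

definition move_right :: "tape \<Rightarrow> tape" where
  "move_right T = act_tape (read_tape T, MoveRight) T"

definition move_left :: "tape \<Rightarrow> tape" where
  "move_left T = act_tape (read_tape T, MoveLeft) T"

lemma move_simps [simp]:
  "move_right (c, h) = (c, h + 1)" "move_left (c, h) = (c, h - 1)"
  by (simp_all add: move_right_def move_left_def)

definition Upd :: "nat \<Rightarrow> ((nat \<Rightarrow> sym) \<Rightarrow> sym) \<Rightarrow> dir \<Rightarrow> prog" where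
  "Upd i g d = Act (\<lambda>r. (idle r)(i := (g r, d)))"

definition StepRight :: "nat \<Rightarrow> prog" where
  "StepRight i = Upd i (\<lambda>r. r i) MoveRight"

definition StepLeft :: "nat \<Rightarrow> prog" where
  "StepLeft i = Upd i (\<lambda>r. r i) MoveLeft"

text \<open>The language has no empty program, so success performs an idle step. This explains three
  steps on success (test, idle step, closing jump) and two on failure.\<close>

definition Check :: "((nat \<Rightarrow> sym) \<Rightarrow> bool) \<Rightarrow> prog" where
  "Check b = Cond b (Act idle) Fail"

lemma wp_Upd [simp]:
  "wp (Upd i g d) F Q t st = Q (t + 1) (st(i := act_tape (g (reads st), d) (st i)))"
proof -
  have "act (\<lambda>r. (idle r)(i := (g r, d))) st = st(i := act_tape (g (reads st), d) (st i))"
    using act_idle[of st] by (auto simp: fun_eq_iff act_def simp del: act_idle)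
  then show ?thesis by (simp add: Upd_def wp_Act)
qed

lemma wp_StepRight [simp]: "wp (StepRight i) F Q t st = Q (t + 1) (st(i := move_right (st i)))"
  by (simp add: StepRight_def move_right_def reads_def)

lemma wp_StepLeft [simp]: "wp (StepLeft i) F Q t st = Q (t + 1) (st(i := move_left (st i)))"
  by (simp add: StepLeft_def move_left_def reads_def)

lemma wp_Check [simp]:
  "wp (Check b) F Q t st = (if b (reads st) then Q (t + 3) st else F (t + 2))"
  by (simp add: Check_def wp_Act numeral_3_eq_3)

section \<open>Tape contents, registers and head movements\<close>

definition contents :: "bool list \<Rightarrow> int \<Rightarrow> sym" where
  "contents w i = (if 0 \<le> i \<and> i < int (length w) then Bit (w ! nat i) else Blank)"

lemma input_tape_eq: "input_tape w = (contents w, 0)"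
  by (auto simp: input_tape_def contents_def)

lemma contents_of_nat: "contents w (int i) = (if i < length w then Bit (w ! i) else Blank)"
  by (simp add: contents_def)

lemma contents_0 [simp]: "contents w 0 = (if w = [] then Blank else Bit (w ! 0))"
  by (simp add: contents_def)

lemma contents_neg [simp]: "i < 0 \<Longrightarrow> contents w i = Blank"
  by (simp add: contents_def)

lemma contents_snoc [simp]: "(contents w)(int (length w) := Bit b) = contents (w @ [b])"
  by (auto simp: contents_def nth_append fun_eq_iff)

lemma contents_snoc': "n = length w \<Longrightarrow> (contents w)(int n := Bit b) = contents (w @ [b])"
  by simp

text \<open>A tape whose head never moves acts as a variable; it may hold any symbol, in particular
  an encoded machine state.\<close>

definition reg :: "sym \<Rightarrow> tape" where
  "reg s = ((\<lambda>_. Blank)(0 := s), 0)"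

lemma read_reg [simp]: "read_tape (reg s) = s"
  and act_reg [simp]: "act_tape (s', Stay) (reg s) = reg s'"
  and input_tape_Nil: "input_tape [] = reg Blank"
  by (auto simp: reg_def input_tape_def fun_eq_iff)

lemma read_tape_holds: "tape_holds T u \<Longrightarrow> read_tape T = (case u of [] \<Rightarrow> Blank | b # _ \<Rightarrow> Bit b)"
  by (cases T; cases u) force+

text \<open>The instance is described by \<open>tape_holds\<close> rather than
  \<open>contents\<close>, because a simulated machine may leave arbitrary symbols to the left of
  the head and beyond the closing blank. Moving right preserves this description.\<close>

lemma tape_holds_move: "tape_holds T (b # u) \<Longrightarrow> tape_holds (move_right T) u"
  by (cases T) (force simp: algebra_simps)

lemma tape_holds_append: "tape_holds (c, h) (v @ u) \<Longrightarrow> tape_holds (c, h + int (length v)) u"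
proof (induction v arbitrary: h)
  case (Cons b v)
  then have "tape_holds (c, h + 1) (v @ u)" by (auto dest: tape_holds_move simp del: tape_holds.simps)
  from Cons.IH[OF this] show ?case by (simp add: ac_simps del: tape_holds.simps)
qed simp

lemma tape_holds_nth: "tape_holds (c, h) u \<Longrightarrow> i < length u \<Longrightarrow> c (h + int i) = Bit (u ! i)"
  by simp

declare tape_holds.simps [simp del]

text \<open>The head may stand on the blank just behind the text, where the loop would stop at once;
  hence the initial step to the left.\<close>

definition Rewind :: "nat \<Rightarrow> prog" where
  "Rewind v = StepLeft v ;; Loop (\<lambda>r. r v \<noteq> Blank) (StepLeft v) ;; StepRight v"

lemma wp_Rewind:
  assumes "st v = (contents w, int p)" "p \<le> length w"
    and Q: "\<And>t'. t' \<le> t + 3 * p + 4 \<Longrightarrow> Q t' (st(v := (contents w, 0)))"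
  shows "wp (Rewind v) F Q t st"
proof -
  define S where "S i = st(v := (contents w, int p - 1 - int i))" for i
  have "wp (Loop (\<lambda>r. r v \<noteq> Blank) (StepLeft v)) F (wp (StepRight v) F Q) (t + 1) (S 0)"
  proof (rule wp_Loop_count[where n = p and c = 1])
    fix i t assume "i < p"
    then have "int p - 1 - int i = int (p - 1 - i)" by simp
    then show "reads (S i) v \<noteq> Blank \<and> wp (StepLeft v) F (\<lambda>t' st'. t' \<le> t + 1 \<and> st' = S (Suc i)) t (S i)"
      using assms(2) \<open>i < p\<close> contents_of_nat[of w "p - 1 - i"] by (simp add: S_def reads_def diff_diff_eq)
  next
    show "\<not> reads (S p) v \<noteq> Blank" by (simp add: S_def reads_def)
  next
    fix t' assume "t' \<le> t + 1 + p * (1 + 2) + 1"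
    then show "wp (StepRight v) F Q t' (S p)"
      using Q[of "t' + 1"] by (simp add: S_def)
  qed
  then show ?thesis
    using assms(1) by (simp add: Rewind_def S_def)
qed

lemma unary_cases:
  obtains n u' where "u = replicate n True @ False # u'" "unary u = Some (n, u')"
  | n where "u = replicate n True" "unary u = None"
proof (cases "unary u")
  case None
  then show ?thesis using that(2) by (metis unary_eq_NoneE)
next
  case (Some a)
  then show ?thesis using that(1) by (cases a) (auto simp: unary_eq_Some_iff enc_unary_def)
qed

text \<open>
  The tapes of the decider are: 0 the input \<open>w\<close>, later the answer; 1 and 2 the strings \<open>x\<^sub>1\<close> and \<open>x\<^sub>2\<close>;
  3 the wire values of \<open>C\<close>; 4 the outputs of \<open>C\<close>; 5 the wire values of \<open>V\<close>; 6 the outputs of \<open>V\<close>;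
  7 the string \<open>xy\<close>; 8 the number \<open>k\<close>; 9 a unary counter holding \<open>m + 1\<close>; 10 and 11 one-cell registers.
  The reduction is simulated on the tapes from 12 on, so the instance appears on tape 12.
\<close>

definition Fetch :: "nat \<Rightarrow> nat \<Rightarrow> prog" where
  "Fetch v k = Loop (\<lambda>r. r 12 = Bit True) (StepRight 12 ;; StepRight v) ;; Check (\<lambda>r. r 12 = Bit False) ;; StepRight 12 ;;
     Check (\<lambda>r. r v \<noteq> Blank) ;; Upd k (\<lambda>r. r v) Stay ;; Rewind v"

text \<open>Each mark of the unary number moves the head of tape \<open>v\<close> by one cell, so
  the head ends on the requested wire, or on a blank if there is none. Four steps per mark and three
  per cell on the way back give the factor 7. As in the other rules, \<open>Q\<close> and
  \<open>F\<close> are arbitrary, so that routines are chained by applying their rules.\<close>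

lemma wp_Fetch:
  assumes st: "st v = (contents vs, 0)" "tape_holds (st 12) u" "st k = reg s"
    and ne: "v \<noteq> 12" "k \<noteq> 12" "k \<noteq> v"
    and Some: "\<And>a u' T t'. fetch vs u = Some (a, u') \<Longrightarrow> tape_holds T u' \<Longrightarrow> t' \<le> t + 7 * length u + 20 \<Longrightarrow>
       Q t' (st(12 := T, k := reg (Bit a)))"
    and None: "\<And>t'. fetch vs u = None \<Longrightarrow> t' \<le> t + 7 * length u + 20 \<Longrightarrow> F t'"
  shows "wp (Fetch v k) F Q t st"
proof -
  obtain c h where T: "st 12 = (c, h)" by fastforce
  define S where "S i = st(12 := (c, h + int i), v := (contents vs, int i))" for i
  let ?R = "Check (\<lambda>r. r 12 = Bit False) ;; StepRight 12 ;;
     Check (\<lambda>r. r v \<noteq> Blank) ;; Upd k (\<lambda>r. r v) Stay ;; Rewind v"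
  obtain n where n: "(\<exists>u'. u = replicate n True @ False # u' \<and> unary u = Some (n, u')) \<or> (u = replicate n True \<and> unary u = None)"
    by (metis unary_cases)
  have len: "n \<le> length u" using n by auto
  have "wp (Loop (\<lambda>r. r 12 = Bit True) (StepRight 12 ;; StepRight v)) F (wp ?R F Q) t (S 0)"
  proof (rule wp_Loop_count[where n = n and c = 2])
    fix i t assume "i < n"
    then have "i < length u" "u ! i = True" using n by (auto simp: nth_append)
    then have "c (h + int i) = Bit True"
      using st(2) tape_holds_nth[of c h u i] by (simp add: T)
    then show "reads (S i) 12 = Bit True \<and> wp (StepRight 12 ;; StepRight v) F (\<lambda>t' st'. t' \<le> t + 2 \<and> st' = S (Suc i)) t (S i)"
      using ne by (simp add: S_def reads_def fun_upd_twist ac_simps)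
  next
    have "tape_holds (c, h + int n) (drop n u)"
      using st(2) tape_holds_append[of c h "take n u" "drop n u"] len by (simp add: T)
    then have rd: "c (h + int n) = (case drop n u of [] \<Rightarrow> Blank | b # _ \<Rightarrow> Bit b)"
      by (auto dest: read_tape_holds)
    then show "\<not> reads (S n) 12 = Bit True"
      using n ne by (auto simp: S_def reads_def)
    fix t' assume t': "t' \<le> t + n * (2 + 2) + 1"
    from n show "wp ?R F Q t' (S n)"
    proof (elim disjE exE conjE)
      fix u' assume u: "u = replicate n True @ False # u'" and un: "unary u = Some (n, u')"
      have I: "tape_holds (c, h + int n + 1) u'"
        using \<open>tape_holds (c, h + int n) (drop n u)\<close> u by (auto dest: tape_holds_move)
      show ?thesis
      proof (cases "n < length vs")
        case True
        have "fetch vs u = Some (vs ! n, u')" using un True by (simp add: fetch_def)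
        note Q = Some[OF this I]
        have "wp (Rewind v) F Q (t' + 8) (st(12 := (c, h + int n + 1), v := (contents vs, int n), k := reg (Bit (vs ! n))))"
        proof (rule wp_Rewind[where p = n and w = vs])
          fix t2 assume "t2 \<le> t' + 8 + 3 * n + 4"
          with t' len have "t2 \<le> t + 7 * length u + 20" by simp
          from Q[OF this]
          show "Q t2 ((st(12 := (c, h + int n + 1), v := (contents vs, int n), k := reg (Bit (vs ! n))))(v := (contents vs, 0)))"
            using ne st(1) by (simp add: fun_upd_twist[of k v] fun_upd_twist[of 12 v] fun_upd_idem)
        qed (use ne True in auto)
        then show ?thesis
          using ne True rd u st(3) by (simp add: S_def reads_def contents_of_nat add.commute fun_upd_twist)
      next
        case False
        then have "fetch vs u = None" using un by (simp add: fetch_def)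
        from None[OF this] show ?thesis
          using ne False rd u t' by (simp add: S_def reads_def contents_of_nat)
      qed
    next
      assume "u = replicate n True" "unary u = None"
      then show ?thesis
        using ne rd t' None by (simp add: S_def reads_def fetch_def)
    qed
  qed
  moreover have "S 0 = st" using st(1) T ne by (simp add: S_def fun_upd_idem)
  ultimately show ?thesis by (simp add: Fetch_def)
qed

section \<open>Evaluating a circuit\<close>

definition Gate :: "nat \<Rightarrow> prog" where
  "Gate v =
     Cond (\<lambda>r. r 12 = Bit False)
       (StepRight 12 ;;
        Cond (\<lambda>r. r 12 = Bit False)
          (StepRight 12 ;; Check (\<lambda>r. r 12 \<noteq> Blank) ;; Upd 10 (\<lambda>r. r 12) Stay ;; StepRight 12)
          (Check (\<lambda>r. r 12 = Bit True) ;; StepRight 12 ;; Fetch v 10 ;;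
           Upd 10 (\<lambda>r. Bit (r 10 = Bit False)) Stay))
       (Check (\<lambda>r. r 12 = Bit True) ;; StepRight 12 ;;
        Cond (\<lambda>r. r 12 = Bit False)
          (StepRight 12 ;; Fetch v 10 ;; Fetch v 11 ;;
           Upd 10 (\<lambda>r. Bit (r 10 = Bit True \<and> r 11 = Bit True)) Stay)
          (Check (\<lambda>r. r 12 = Bit True) ;; StepRight 12 ;; Fetch v 10 ;; Fetch v 11 ;;
           Upd 10 (\<lambda>r. Bit (r 10 = Bit True \<or> r 11 = Bit True)) Stay))"

text \<open>Shared by conjunction and disjunction: \<open>f\<close> is the Boolean operation and
  \<open>g\<close> its form on the two registers.\<close>

lemma wp_Fetch2:
  assumes st: "st v = (contents vs, 0)" "tape_holds (st 12) u" "st 10 = reg s10" "st 11 = reg s11"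
    and ne: "v \<notin> {10, 11, 12}"
    and Some: "\<And>a1 u1 a2 u2 T t'. fetch vs u = Some (a1, u1) \<Longrightarrow> fetch vs u1 = Some (a2, u2) \<Longrightarrow>
       tape_holds T u2 \<Longrightarrow> t' \<le> t + 14 * length u + 41 \<Longrightarrow>
       Q t' (st(12 := T, 10 := reg (Bit (f a1 a2)), 11 := reg (Bit a2)))"
    and None: "\<And>t'. (case fetch vs u of None \<Rightarrow> True | Some (a1, u1) \<Rightarrow> fetch vs u1 = None) \<Longrightarrow>
       t' \<le> t + 14 * length u + 41 \<Longrightarrow> F t'"
    and g: "\<And>r a1 a2. r 10 = Bit a1 \<Longrightarrow> r 11 = Bit a2 \<Longrightarrow> g r = Bit (f a1 a2)"
  shows "wp (Fetch v 10 ;; Fetch v 11 ;; Upd 10 g Stay) F Q t st"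
  unfolding wp_Seq
proof (rule wp_Fetch[where vs = vs and u = u and s = s10])
  fix a1 u1 T1 t1
  assume 1: "fetch vs u = Some (a1, u1)" "tape_holds T1 u1" "t1 \<le> t + 7 * length u + 20"
  then have len: "length u1 < length u" by (auto dest: length_fetch)
  show "wp (Fetch v 11) F (wp (Upd 10 g Stay) F Q) t1 (st(12 := T1, 10 := reg (Bit a1)))"
  proof (rule wp_Fetch[where vs = vs and u = u1 and s = s11])
    fix a2 u2 T2 t2
    assume 2: "fetch vs u1 = Some (a2, u2)" "tape_holds T2 u2" "t2 \<le> t1 + 7 * length u1 + 20"
    then have "t2 + 1 \<le> t + 14 * length u + 41" using 1 len by simp
    from Some[OF 1(1) 2(1) 2(2) this]
    show "wp (Upd 10 g Stay) F Q t2 (st(12 := T1, 10 := reg (Bit a1), 12 := T2, 11 := reg (Bit a2)))"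
      by (subst wp_Upd, subst g[of _ a1 a2]) (simp_all add: reads_def fun_upd_twist)
  next
    fix t2 assume "fetch vs u1 = None" "t2 \<le> t1 + 7 * length u1 + 20"
    then show "F t2" using None[of t2] 1 len by simp
  qed (use st ne 1 in auto)
next
  fix t1 assume "fetch vs u = None" "t1 \<le> t + 7 * length u + 20"
  then show "F t1" using None[of t1] by simp
qed (use st ne in auto)

text \<open>The old register contents are arbitrary, since they stem from the previous gate or,
  before the first one, from the simulation, which leaves the halting state in register 10.\<close>

lemma wp_Gate:
  assumes st: "st v = (contents vs, 0)" "tape_holds (st 12) u" "st 10 = reg s10" "st 11 = reg s11"
    and ne: "v \<notin> {10, 11, 12}"
    and Some: "\<And>a u' T s t'. run_gate vs u = Some (a, u') \<Longrightarrow>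
       tape_holds T u' \<Longrightarrow> t' \<le> t + 14 * length u + 55 \<Longrightarrow>
       Q t' (st(12 := T, 10 := reg (Bit a), 11 := reg s))"
    and None: "\<And>t'. run_gate vs u = None \<Longrightarrow> t' \<le> t + 14 * length u + 55 \<Longrightarrow> F t'"
  shows "wp (Gate v) F Q t st"
proof -
  note rd = read_tape_holds[OF st(2)]
  note simps = Gate_def reads_def
  consider (N) "u = []" | (S) b where "u = [b]" | (FF) u' where "u = False # False # u'"
    | (FT) u' where "u = False # True # u'" | (T) b u' where "u = True # b # u'"
    by (metis (full_types) list.exhaust)
  then show ?thesis
  proof cases
    case N
    then show ?thesis using rd None by (simp add: simps)
  next
    case S
    then have "tape_holds (move_right (st 12)) []"
      using st(2) by (auto dest: tape_holds_move)
    then have "read_tape (move_right (st 12)) = Blank" by (auto dest: read_tape_holds)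
    with S show ?thesis using rd None by (cases b) (simp_all add: simps)
  next
    case FF
    have T1: "tape_holds (move_right (st 12)) (False # u')"
      using st(2) FF by (auto dest: tape_holds_move)
    then have T2: "tape_holds (move_right (move_right (st 12))) u'"
      by (auto dest: tape_holds_move)
    note rds = rd read_tape_holds[OF T1] read_tape_holds[OF T2]
    show ?thesis
    proof (cases u')
      case Nil
      then show ?thesis using rds FF None by (simp add: simps)
    next
      case (Cons b u2)
      then have T3: "tape_holds (move_right (move_right (move_right (st 12)))) u2"
        using T2 by (auto dest: tape_holds_move)
      have "run_gate vs u = Some (b, u2)" using FF Cons by simp
      from Some[OF this T3, of "11 + t" s11] show ?thesis
        using rds FF Cons st by (simp add: simps fun_upd_twist fun_upd_idem)
    qed
  next
    case FT
    have T1: "tape_holds (move_right (st 12)) (True # u')"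
      using st(2) FT by (auto dest: tape_holds_move)
    then have T2: "tape_holds (move_right (move_right (st 12))) u'"
      by (auto dest: tape_holds_move)
    have "wp (Fetch v 10 ;; Upd 10 (\<lambda>r. Bit (r 10 = Bit False)) Stay) F (\<lambda>t. Q (t + 1)) (7 + t)
      (st(12 := move_right (move_right (st 12))))"
      unfolding wp_Seq
    proof (rule wp_Fetch[where vs = vs and u = u' and s = s10])
      fix a u2 T t'
      assume f: "fetch vs u' = Some (a, u2)" "tape_holds T u2" "t' \<le> 7 + t + 7 * length u' + 20"
      have "run_gate vs u = Some (\<not> a, u2)" using FT f by simp
      from Some[OF this f(2), of "t' + 1 + 1" s11] f(3) st ne FT
      show "wp (Upd 10 (\<lambda>r. Bit (r 10 = Bit False)) Stay) F (\<lambda>t. Q (t + 1)) t'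
          (st(12 := move_right (move_right (st 12)), 12 := T, 10 := reg (Bit a)))"
        by (simp add: reads_def fun_upd_idem)
    qed (use st ne T2 FT None in auto)
    then show ?thesis
      using rd read_tape_holds[OF T1] FT by (simp add: simps)
  next
    case T
    have T1: "tape_holds (move_right (st 12)) (b # u')"
      using st(2) T by (auto dest: tape_holds_move)
    then have T2: "tape_holds (move_right (move_right (st 12))) u'"
      by (auto dest: tape_holds_move)
    define f where "f a1 a2 = (if b then a1 \<or> a2 else a1 \<and> a2)" for a1 a2
    define g where "g = (\<lambda>r :: nat \<Rightarrow> sym. Bit (if b then r 10 = Bit True \<or> r 11 = Bit True else r 10 = Bit True \<and> r 11 = Bit True))"
    \<comment> \<open>Conjunction sits in a \<open>then\<close> branch, whose closing jump shifts
      the continuation by one step; disjunction sits in an \<open>else\<close> branch after one more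
      \<open>Check\<close>. A variable start time and continuation cover both.\<close>
    have "wp (Fetch v 10 ;; Fetch v 11 ;; Upd 10 g Stay) F Q' t2 (st(12 := move_right (move_right (st 12))))"
      if "t2 \<le> 10 + t" "\<And>t st. Q t st \<Longrightarrow> Q (t + 1) st \<Longrightarrow> Q' t st" for Q' t2
    proof (rule wp_Fetch2[where u = u' and f = f and vs = vs])
      fix a1 u1 a2 u2 T t'
      assume f: "fetch vs u' = Some (a1, u1)" "fetch vs u1 = Some (a2, u2)" "tape_holds T u2"
        "t' \<le> t2 + 14 * length u' + 41"
      have "run_gate vs u = Some (f a1 a2, u2)" using f T by (simp add: f_def)
      from Some[OF this f(3), of "t' + 1" "Bit a2"] Some[OF this f(3), of t' "Bit a2"] f(4) that T
      show "Q' t' (st(12 := move_right (move_right (st 12)), 12 := T, 10 := reg (Bit (f a1 a2)), 11 := reg (Bit a2)))"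
        by simp
    next
      fix t' assume "case fetch vs u' of None \<Rightarrow> True | Some (a1, u1) \<Rightarrow> fetch vs u1 = None"
        "t' \<le> t2 + 14 * length u' + 41"
      then show "F t'" using T that None[of t'] by (auto split: option.splits)
    qed (use st ne T2 in \<open>auto simp: f_def g_def\<close>)
    note w = this
    show ?thesis
      using rd read_tape_holds[OF T1] T w[of "7 + t" "\<lambda>t. Q (t + 1)"] w[of "10 + t" Q]
      by (cases b) (simp_all add: simps g_def)
  qed
qed

definition Append :: "nat \<Rightarrow> prog" where
  "Append v = Loop (\<lambda>r. r v \<noteq> Blank) (StepRight v) ;; Upd v (\<lambda>r. r 10) Stay ;; Rewind v"

lemma wp_Append:
  assumes st: "st v = (contents vs, 0)" "st 10 = reg (Bit a)" and ne: "v \<noteq> 10"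
    and Q: "\<And>t'. t' \<le> t + 6 * length vs + 10 \<Longrightarrow> Q t' (st(v := (contents (vs @ [a]), 0)))"
  shows "wp (Append v) F Q t st"
proof -
  define S where "S i = st(v := (contents vs, int i))" for i
  have "wp (Loop (\<lambda>r. r v \<noteq> Blank) (StepRight v)) F (wp (Upd v (\<lambda>r. r 10) Stay ;; Rewind v) F Q) t (S 0)"
  proof (rule wp_Loop_count[where n = "length vs" and c = 1])
    fix i t assume "i < length vs"
    then show "reads (S i) v \<noteq> Blank \<and> wp (StepRight v) F (\<lambda>t' st'. t' \<le> t + 1 \<and> st' = S (Suc i)) t (S i)"
      by (simp add: S_def reads_def contents_of_nat ac_simps)
  next
    show "\<not> reads (S (length vs)) v \<noteq> Blank"
      by (simp add: S_def reads_def contents_of_nat)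
  next
    fix t' assume "t' \<le> t + length vs * (1 + 2) + 1"
    moreover have "wp (Rewind v) F Q (t' + 1) (st(v := (contents (vs @ [a]), int (length vs))))"
      by (rule wp_Rewind[where w = "vs @ [a]" and p = "length vs"]) (use Q \<open>t' \<le> _\<close> in auto)
    ultimately show "wp (Upd v (\<lambda>r. r 10) Stay ;; Rewind v) F Q t' (S (length vs))"
      using st ne by (simp add: S_def reads_def)
  qed
  moreover have "S 0 = st" using st by (simp add: S_def fun_upd_idem)
  ultimately show ?thesis by (simp add: Append_def)
qed

definition Gates :: "nat \<Rightarrow> prog" where
  "Gates v = Loop (\<lambda>r. r 12 = Bit True) (StepRight 12 ;; Gate v ;; Append v) ;;
     Check (\<lambda>r. r 12 = Bit False) ;; StepRight 12"

text \<open>A gate consumes code and adds one wire, so \<open>length u + length vs\<close> never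
  exceeds \<open>B\<close>. One round costs about \<open>14 * length u\<close> for the gate and
  \<open>6 * length vs\<close> for appending its value, hence at most \<open>20 * B\<close> plus a
  constant.\<close>

lemma wp_Gates:
  assumes "st v = (contents vs, 0)" "tape_holds (st 12) u" "st 10 = reg s10" "st 11 = reg s11"
    and ne: "v \<notin> {10, 11, 12}" and B: "length u + length vs \<le> B"
    and "\<And>vs' u' T s s' t'. run_gates vs u = Some (vs', u') \<Longrightarrow>
       tape_holds T u' \<Longrightarrow> t' \<le> t + (length u + 1) * (20 * B + 100) \<Longrightarrow>
       Q t' (st(12 := T, 10 := reg s, 11 := reg s', v := (contents vs', 0)))"
    and "\<And>t'. run_gates vs u = None \<Longrightarrow> t' \<le> t + (length u + 1) * (20 * B + 100) \<Longrightarrow> F t'"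
  shows "wp (Gates v) F Q t st"
  using assms(1-4,6-)
proof (induction vs u arbitrary: t st s10 s11 rule: run_gates.induct)
  case (1 vs)
  then show ?case by (subst Gates_def, subst wp_Seq, subst wp_Loop) (simp add: reads_def read_tape_holds)
next
  case (2 vs u)
  have "st(12 := T, 10 := reg s10, 11 := reg s11, v := (contents vs, 0)) = st(12 := T)" for T
    using "2.prems" ne by (simp add: fun_upd_idem fun_upd_idem_iff fun_upd_twist)
  moreover have "Q (5 + t) (st(12 := move_right (st 12), 10 := reg s10, 11 := reg s11, v := (contents vs, 0)))"
    by (rule "2.prems"(6)) (use "2.prems"(2) in \<open>auto dest: tape_holds_move\<close>)
  ultimately have "Q (5 + t) (st(12 := move_right (st 12)))" by simp
  with "2.prems"(2) show ?case
    by (subst Gates_def, subst wp_Seq, subst wp_Loop)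
       (simp add: reads_def read_tape_holds tape_holds_move)
next
  case (3 vs u)
  note IH = "3.IH" and st = "3.prems"(1-4) and B = "3.prems"(5) and Some = "3.prems"(6) and None = "3.prems"(7)
  let ?M = "20 * B + 100"
  have T: "tape_holds (move_right (st 12)) u" using st(2) by (rule tape_holds_move)
  let ?rest = "Check (\<lambda>r. r 12 = Bit False) ;; StepRight 12"
  \<comment> \<open>Folds the remaining iterations and the final test back into
    \<open>Gates v\<close>, the form of the induction hypothesis.\<close>
  have cont: "wp (Loop (\<lambda>r. r 12 = Bit True) (StepRight 12 ;; Gate v ;; Append v)) F (wp ?rest F Q) t st = wp (Gates v) F Q t st" for t st
    by (simp add: Gates_def)
  have "wp (Gate v ;; Append v) F (\<lambda>t. wp (Gates v) F Q (t + 1)) (t + 2) (st(12 := move_right (st 12)))"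
    unfolding wp_Seq
  proof (rule wp_Gate[where vs = vs and u = u and ?s10.0 = s10 and ?s11.0 = s11])
    fix a u1 T1 s t1
    assume 1: "run_gate vs u = Some (a, u1)" "tape_holds T1 u1" "t1 \<le> t + 2 + 14 * length u + 55"
    then have len: "length u1 < length u" by (auto dest: length_run_gate)
    show "wp (Append v) F (\<lambda>t. wp (Gates v) F Q (t + 1)) t1
      (st(12 := move_right (st 12), 12 := T1, 10 := reg (Bit a), 11 := reg s))"
    proof (rule wp_Append[where vs = vs and a = a])
      fix t2 assume t2: "t2 \<le> t1 + 6 * length vs + 10"
      have "t2 + 1 \<le> t + ?M" using t2 1(3) B by simp
      moreover have "?M + (length u1 + 1) * ?M \<le> (length (True # u) + 1) * ?M"
        using len mult_le_mono1[of "length u1 + 2" "length u + 2" ?M] by (simp add: algebra_simps)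
      ultimately have time: "t3 \<le> t + (length (True # u) + 1) * ?M"
        if "t3 \<le> t2 + 1 + (length u1 + 1) * ?M" for t3
        using that by linarith
      show "wp (Gates v) F Q (t2 + 1) (st(12 := move_right (st 12), 12 := T1, 10 := reg (Bit a),
            11 := reg s, v := (contents (vs @ [a]), 0)))"
      proof (rule IH[OF 1(1) refl])
        show "length u1 + length (vs @ [a]) \<le> B" using len B by simp
      next
        fix vs' u' T' s' s'' t3
        assume 3: "run_gates (vs @ [a]) u1 = Some (vs', u')" "tape_holds T' u'"
          "t3 \<le> t2 + 1 + (length u1 + 1) * ?M"
        have "Q t3 (st(12 := T', 10 := reg s', 11 := reg s'', v := (contents vs', 0)))"
          by (rule Some[OF _ 3(2) time[OF 3(3)]]) (use 1 3 in simp)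
        then show "Q t3 (st(12 := move_right (st 12), 12 := T1, 10 := reg (Bit a), 11 := reg s,
               v := (contents (vs @ [a]), 0), 12 := T', 10 := reg s', 11 := reg s'', v := (contents vs', 0)))"
          by (rule back_subst[of "Q t3"]) (use ne in \<open>auto simp: fun_eq_iff\<close>)
      next
        fix t3 assume "run_gates (vs @ [a]) u1 = None" "t3 \<le> t2 + 1 + (length u1 + 1) * ?M"
        with 1 None time show "F t3" by simp
      qed (use 1 ne in auto)
    qed (use st ne in auto)
  next
    fix t' assume "run_gate vs u = None" "t' \<le> t + 2 + 14 * length u + 55"
    moreover have "t + ?M \<le> t + (length (True # u) + 1) * ?M" by simp
    ultimately show "F t'" using B by (intro None) auto
  qed (use st T ne in auto)
  then have "wp (StepRight 12 ;; Gate v ;; Append v) F (\<lambda>t. wp (Gates v) F Q (t + 1)) (t + 1) st"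
    by (simp add: numeral_2_eq_2)
  then show ?case
    using st by (subst Gates_def, subst wp_Seq, subst wp_Loop, unfold cont) (simp add: reads_def read_tape_holds)
qed

definition Outs :: "nat \<Rightarrow> nat \<Rightarrow> prog" where
  "Outs v z = Loop (\<lambda>r. r 12 = Bit True) (StepRight 12 ;; Fetch v 10 ;; Upd z (\<lambda>r. r 10) MoveRight) ;;
     Check (\<lambda>r. r 12 = Bit False) ;; StepRight 12"

text \<open>The head of tape \<open>z\<close> stays behind what has been written, so output bits
  need no rewinding; \<open>zs\<close> collects those already there. The time per wire is that of
  \<open>wp_Fetch\<close>.\<close>

lemma wp_Outs:
  assumes "st v = (contents vs, 0)" "st z = (contents zs, int (length zs))" "tape_holds (st 12) u" "st 10 = reg s10"
    and ne: "v \<notin> {10, 12}" "z \<notin> {10, 12, v}"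
    and "\<And>bs u' T s t'. run_outs vs u = Some (bs, u') \<Longrightarrow>
       tape_holds T u' \<Longrightarrow> t' \<le> t + (length u + 1) * (7 * length u + 30) \<Longrightarrow>
       Q t' (st(12 := T, 10 := reg s, z := (contents (zs @ bs), int (length (zs @ bs)))))"
    and "\<And>t'. run_outs vs u = None \<Longrightarrow> t' \<le> t + (length u + 1) * (7 * length u + 30) \<Longrightarrow> F t'"
  shows "wp (Outs v z) F Q t st"
  using assms(1-4,7-)
proof (induction vs u arbitrary: t st s10 zs rule: run_outs.induct)
  case (1 vs)
  then show ?case by (subst Outs_def, subst wp_Seq, subst wp_Loop) (simp add: reads_def read_tape_holds)
next
  case (2 vs u)
  have "st(12 := T, 10 := reg s10, z := (contents zs, int (length zs))) = st(12 := T)" for T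
    using "2.prems" ne by (simp add: fun_upd_idem fun_upd_idem_iff fun_upd_twist)
  moreover have "Q (5 + t) (st(12 := move_right (st 12), 10 := reg s10, z := (contents (zs @ []), int (length (zs @ [])))))"
    by (rule "2.prems"(5)) (use "2.prems"(3) in \<open>auto dest: tape_holds_move\<close>)
  ultimately have "Q (5 + t) (st(12 := move_right (st 12)))" by simp
  with "2.prems"(3) show ?case
    by (subst Outs_def, subst wp_Seq, subst wp_Loop)
       (simp add: reads_def read_tape_holds tape_holds_move)
next
  case (3 vs u)
  note IH = "3.IH" and st = "3.prems"(1-4) and Some = "3.prems"(5) and None = "3.prems"(6)
  let ?M = "7 * length (True # u) + 30"
  have T: "tape_holds (move_right (st 12)) u" using st(3) by (rule tape_holds_move)
  let ?body = "StepRight 12 ;; Fetch v 10 ;; Upd z (\<lambda>r. r 10) MoveRight"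
  let ?rest = "Check (\<lambda>r. r 12 = Bit False) ;; StepRight 12"
  have cont: "wp (Loop (\<lambda>r. r 12 = Bit True) ?body) F (wp ?rest F Q) t st = wp (Outs v z) F Q t st" for t st
    by (simp add: Outs_def)
  have "wp (Fetch v 10) F (\<lambda>t st. wp (Outs v z) F Q (t + 2) (st(z := act_tape (reads st 10, MoveRight) (st z))))
     (t + 2) (st(12 := move_right (st 12)))"
  proof (rule wp_Fetch[where vs = vs and u = u and s = s10])
    fix a u1 T1 t1
    assume 1: "fetch vs u = Some (a, u1)" "tape_holds T1 u1" "t1 \<le> t + 2 + 7 * length u + 20"
    then have len: "length u1 < length u" by (auto dest: length_fetch)
    have "(length u1 + 1) * (7 * length u1 + 30) \<le> (length u1 + 1) * ?M"
      using len by (intro mult_le_mono2) simp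
    moreover have "?M + (length u1 + 1) * ?M \<le> (length (True # u) + 1) * ?M"
      using len mult_le_mono1[of "length u1 + 2" "length u + 2" ?M] by (simp add: algebra_simps)
    moreover have "t1 + 2 \<le> t + ?M" using 1(3) by simp
    ultimately have time: "t3 \<le> t + (length (True # u) + 1) * ?M"
      if "t3 \<le> t1 + 2 + (length u1 + 1) * (7 * length u1 + 30)" for t3
      using that by linarith
    have "wp (Outs v z) F Q (t1 + 2) (st(12 := T1, 10 := reg (Bit a), z := (contents (zs @ [a]), int (length (zs @ [a])))))"
    proof (rule IH[OF 1(1) refl])
      fix bs u' T' s' t3
      assume 3: "run_outs vs u1 = Some (bs, u')" "tape_holds T' u'"
        "t3 \<le> t1 + 2 + (length u1 + 1) * (7 * length u1 + 30)"
      have "Q t3 (st(12 := T', 10 := reg s', z := (contents (zs @ a # bs), int (length (zs @ a # bs)))))"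
        by (rule Some[OF _ 3(2) time[OF 3(3)]]) (use 1 3 in simp)
      then show "Q t3 (st(12 := T1, 10 := reg (Bit a), z := (contents (zs @ [a]), int (length (zs @ [a]))),
            12 := T', 10 := reg s', z := (contents ((zs @ [a]) @ bs), int (length ((zs @ [a]) @ bs)))))"
        by (rule back_subst[of "Q t3"]) (use ne in \<open>auto simp: fun_eq_iff\<close>)
    next
      fix t3 assume "run_outs vs u1 = None" "t3 \<le> t1 + 2 + (length u1 + 1) * (7 * length u1 + 30)"
      with 1 None time show "F t3" by simp
    qed (use 1 st ne in auto)
    then show "wp (Outs v z) F Q (t1 + 2) ((st(12 := move_right (st 12), 12 := T1, 10 := reg (Bit a)))
      (z := act_tape (reads (st(12 := move_right (st 12), 12 := T1, 10 := reg (Bit a))) 10, MoveRight)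
         ((st(12 := move_right (st 12), 12 := T1, 10 := reg (Bit a))) z)))"
      using st ne by (simp add: reads_def ac_simps)
  next
    fix t' assume "fetch vs u = None" "t' \<le> t + 2 + 7 * length u + 20"
    moreover have "t + ?M \<le> t + (length (True # u) + 1) * ?M" by simp
    ultimately show "F t'" by (intro None) auto
  qed (use st T ne in auto)
  moreover have "wp (Upd z (\<lambda>r. r 10) MoveRight) F (\<lambda>t. wp (Outs v z) F Q (t + 1)) =
      (\<lambda>t st. wp (Outs v z) F Q (t + 2) (st(z := act_tape (reads st 10, MoveRight) (st z))))"
    by (intro ext) simp
  ultimately have "wp ?body F (\<lambda>t. wp (Outs v z) F Q (t + 1)) (t + 1) st"
    by (simp add: numeral_2_eq_2)
  then show ?case
    using st by (subst Outs_def, subst wp_Seq, subst wp_Loop, unfold cont) (simp add: reads_def read_tape_holds)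
qed

section \<open>Loading inputs and comparing outputs\<close>

text \<open>The input count of \<open>C\<close> drives the copying: tape 1 supplies bits until it is
  exhausted, then tape 2 does, where a blank counts as \<open>False\<close> and thus pads. Tape 9
  receives a mark for each bit taken from tape 2 and a last one without moving, so it ends with
  \<open>m + 1\<close> marks and its head on the last.\<close>

definition LoadC :: prog where
  "LoadC =
     Loop (\<lambda>r. r 12 = Bit True)
       (StepRight 12 ;;
        Cond (\<lambda>r. r 1 \<noteq> Blank)
          (Upd 3 (\<lambda>r. r 1) MoveRight ;; Upd 7 (\<lambda>r. r 1) MoveRight ;; StepRight 1)
          (Upd 3 (\<lambda>r. Bit (r 2 = Bit True)) MoveRight ;; Upd 7 (\<lambda>r. Bit (r 2 = Bit True)) MoveRight ;;
           StepRight 2 ;; Upd 9 (\<lambda>r. Bit True) MoveRight)) ;;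
     Check (\<lambda>r. r 12 = Bit False) ;; StepRight 12 ;; Check (\<lambda>r. r 1 = Blank) ;; Upd 9 (\<lambda>r. Bit True) Stay"

lemma wp_LoadC:
  assumes st: "tape_holds (st 12) u" "st 1 = (contents x, 0)" "st 2 = (contents y, 0)"
      "st 3 = (contents [], 0)" "st 7 = (contents [], 0)" "st 9 = (contents [], 0)"
    and Some: "\<And>N m u' T t'. unary u = Some (N, u') \<Longrightarrow> length x \<le> N \<Longrightarrow> m = N - length x \<Longrightarrow>
       tape_holds T u' \<Longrightarrow> t' \<le> t + 8 * length u + 20 \<Longrightarrow>
       Q t' (st(12 := T, 1 := (contents x, int (length x)), 2 := (contents y, int m),
         3 := (contents (x @ pad m y), int N), 7 := (contents (x @ pad m y), int N),
         9 := (contents (replicate (Suc m) True), int m)))"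
    and None: "\<And>t'. (case unary u of None \<Rightarrow> True | Some (N, u') \<Rightarrow> N < length x) \<Longrightarrow>
       t' \<le> t + 8 * length u + 20 \<Longrightarrow> F t'"
  shows "wp LoadC F Q t st"
proof -
  obtain c h where T: "st 12 = (c, h)" by fastforce
  obtain n where n: "(\<exists>u'. u = replicate n True @ False # u' \<and> unary u = Some (n, u')) \<or> (u = replicate n True \<and> unary u = None)"
    by (metis unary_cases)
  have len: "n \<le> length u" using n by auto
  \<comment> \<open>The string whose first \<open>i\<close> bits have been copied after
    \<open>i\<close> marks; \<open>n\<close> padding bits always suffice. In \<open>S\<close>,
    truncated subtraction keeps the heads of tapes 2 and 9 at rest while \<open>x\<close> is being
    copied.\<close>
  define W where "W = x @ y @ replicate n False"
  define S where "S i = st(12 := (c, h + int i), 1 := (contents x, int (min i (length x))),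
    2 := (contents y, int (i - length x)), 3 := (contents (take i W), int i), 7 := (contents (take i W), int i),
    9 := (contents (replicate (i - length x) True), int (i - length x)))" for i
  let ?R = "Check (\<lambda>r. r 12 = Bit False) ;; StepRight 12 ;; Check (\<lambda>r. r 1 = Blank) ;; Upd 9 (\<lambda>r. Bit True) Stay"
  let ?B = "StepRight 12 ;;
        Cond (\<lambda>r. r 1 \<noteq> Blank)
          (Upd 3 (\<lambda>r. r 1) MoveRight ;; Upd 7 (\<lambda>r. r 1) MoveRight ;; StepRight 1)
          (Upd 3 (\<lambda>r. Bit (r 2 = Bit True)) MoveRight ;; Upd 7 (\<lambda>r. Bit (r 2 = Bit True)) MoveRight ;;
           StepRight 2 ;; Upd 9 (\<lambda>r. Bit True) MoveRight)"
  have "wp (Loop (\<lambda>r. r 12 = Bit True) ?B) F (wp ?R F Q) t (S 0)"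
  proof (rule wp_Loop_count[where n = n and c = 6])
    fix i t assume "i < n"
    then have "i < length u" "u ! i = True" using n by (auto simp: nth_append)
    then have rd: "c (h + int i) = Bit True"
      using st(1) tape_holds_nth[of c h u i] by (simp add: T)
    have "i < length W" using \<open>i < n\<close> by (simp add: W_def)
    then have W: "take (Suc i) W = take i W @ [W ! i]" "length (take i W) = i"
      by (auto simp: take_Suc_conv_app_nth)
    have up: "(contents (take i W))(int i := Bit (W ! i)) = contents (take (Suc i) W)"
      using contents_snoc'[OF W(2)[symmetric]] W(1) by simp
    have "wp ?B F (\<lambda>t' st'. t' \<le> t + 6 \<and> st' = S (Suc i)) t (S i)"
    proof (cases "i < length x")
      case True
      then have "W ! i = x ! i" by (simp add: W_def nth_append)
      with up True show ?thesis
        by (simp add: S_def reads_def contents_of_nat) (auto simp: fun_eq_iff)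
    next
      case False
      have "(contents y (int i - int (length x)) = Bit True) = (i - length x < length y \<and> y ! (i - length x))"
        using False contents_of_nat[of y "i - length x"] by (simp add: of_nat_diff)
      then have W1: "(contents y (int i - int (length x)) = Bit True) = W ! i"
        using False \<open>i < n\<close> by (auto simp: W_def nth_append)
      have "(contents (replicate (i - length x) True))(int (i - length x) := Bit True) = contents (replicate (Suc i - length x) True)"
        using False contents_snoc'[of "i - length x" "replicate (i - length x) True" True] by (simp add: Suc_diff_le replicate_append_same)
      with up W1 False show ?thesis
        by (simp add: S_def reads_def contents_of_nat of_nat_diff) (auto simp: fun_eq_iff of_nat_diff)
    qed
    with rd show "reads (S i) 12 = Bit True \<and> wp ?B F (\<lambda>t' st'. t' \<le> t + 6 \<and> st' = S (Suc i)) t (S i)"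
      by (simp add: S_def reads_def del: wp_Seq)
  next
    have I: "tape_holds (c, h + int n) (drop n u)"
      using st(1) tape_holds_append[of c h "take n u" "drop n u"] len by (simp add: T)
    then have rd: "c (h + int n) = (case drop n u of [] \<Rightarrow> Blank | b # _ \<Rightarrow> Bit b)"
      by (auto dest: read_tape_holds)
    then show "\<not> reads (S n) 12 = Bit True"
      using n by (auto simp: S_def reads_def)
    fix t' assume t': "t' \<le> t + n * (6 + 2) + 1"
    from n show "wp ?R F Q t' (S n)"
    proof (elim disjE exE conjE)
      fix u' assume u: "u = replicate n True @ False # u'" and un: "unary u = Some (n, u')"
      have I1: "tape_holds (c, h + int n + 1) u'"
        using I u by (auto dest: tape_holds_move)
      show ?thesis
      proof (cases "length x \<le> n")
        case True
        have "take n W = x @ pad (n - length x) y"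
          using True by (simp add: W_def pad_def)
        moreover have "(contents (replicate (n - length x) True))(int (n - length x) := Bit True) = contents (replicate (Suc (n - length x)) True)"
          using contents_snoc'[of "n - length x" "replicate (n - length x) True" True] by (simp add: replicate_append_same)
        moreover have "8 + t' \<le> t + 8 * length u + 20" using t' len by simp
        note Some[OF un True refl I1 this]
        ultimately show ?thesis
          using rd u True by (simp add: S_def reads_def contents_of_nat fun_upd_twist of_nat_diff)
      next
        case False
        then show ?thesis
          using None un rd u t' by (simp add: S_def reads_def contents_of_nat)
      qed
    next
      assume "u = replicate n True" "unary u = None"
      then show ?thesis
        using rd t' None by (simp add: S_def reads_def)
    qed
  qed
  moreover have "S 0 = st" using st T by (simp add: S_def fun_upd_idem)
  ultimately show ?thesis by (simp add: LoadC_def)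
qed

text \<open>
  Tape 9 is walked down from its last mark, so that the loop checks that the number of inputs of \<open>V\<close>, the
  number of outputs of \<open>C\<close> and \<open>m + 1\<close> coincide.
\<close>

definition LoadV :: prog where
  "LoadV =
     Loop (\<lambda>r. r 12 = Bit True)
       (StepRight 12 ;; Check (\<lambda>r. r 4 \<noteq> Blank \<and> r 9 \<noteq> Blank) ;; Upd 5 (\<lambda>r. r 4) MoveRight ;; StepRight 4 ;; StepLeft 9) ;;
     Check (\<lambda>r. r 12 = Bit False) ;; StepRight 12 ;; Check (\<lambda>r. r 4 = Blank \<and> r 9 = Blank)"

lemma wp_LoadV:
  assumes st: "tape_holds (st 12) u" "st 4 = (contents z, 0)" "st 5 = (contents [], 0)"
      "st 9 = (contents (replicate (Suc m) True), int m)"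
    and Some: "\<And>u' T t'. unary u = Some (length z, u') \<Longrightarrow> length z = Suc m \<Longrightarrow>
       tape_holds T u' \<Longrightarrow> t' \<le> t + 9 * length u + 20 \<Longrightarrow>
       Q t' (st(12 := T, 4 := (contents z, int (length z)), 5 := (contents z, int (length z)),
         9 := (contents (replicate (Suc m) True), - 1)))"
    and None: "\<And>t'. (\<And>u'. unary u = Some (length z, u') \<Longrightarrow> length z \<noteq> Suc m) \<Longrightarrow>
       t' \<le> t + 9 * length u + 20 \<Longrightarrow> F t'"
  shows "wp LoadV F Q t st"
proof -
  obtain c h where T: "st 12 = (c, h)" by fastforce
  obtain N where N: "(\<exists>u'. u = replicate N True @ False # u' \<and> unary u = Some (N, u')) \<or> (u = replicate N True \<and> unary u = None)"
    by (metis unary_cases)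
  have len: "N \<le> length u" using N by auto
  \<comment> \<open>The number of complete rounds. If \<open>n < N\<close>, one more round starts
    and its \<open>Check\<close> fails because tape 4 or tape 9 is exhausted; this is why the loop
    rule with an open end is used.\<close>
  define n where "n = min N (min (length z) (Suc m))"
  define S where "S i = st(12 := (c, h + int i), 4 := (contents z, int i), 5 := (contents (take i z), int i),
    9 := (contents (replicate (Suc m) True), int m - int i))" for i
  let ?R = "Check (\<lambda>r. r 12 = Bit False) ;; StepRight 12 ;; Check (\<lambda>r. r 4 = Blank \<and> r 9 = Blank)"
  let ?B = "StepRight 12 ;; Check (\<lambda>r. r 4 \<noteq> Blank \<and> r 9 \<noteq> Blank) ;; Upd 5 (\<lambda>r. r 4) MoveRight ;; StepRight 4 ;; StepLeft 9"
  have read12: "c (h + int i) = Bit True" if "i < N" for i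
  proof -
    have "i < length u" "u ! i = True" using that N by (auto simp: nth_append)
    then show ?thesis using st(1) tape_holds_nth[of c h u i] by (simp add: T)
  qed
  have read9: "contents (replicate (Suc m) True) (int m - int i) = (if i \<le> m then Bit True else Blank)" for i
    by (simp add: contents_def nth_append del: replicate_Suc)
  have "wp (Loop (\<lambda>r. r 12 = Bit True) ?B) F (wp ?R F Q) t (S 0)"
  proof (rule wp_Loop_upto[where n = n and c = 7])
    fix i t assume i: "i < n"
    have "take (Suc i) z = take i z @ [z ! i]" "i = length (take i z)"
      using i by (auto simp: n_def take_Suc_conv_app_nth)
    then have up: "(contents (take i z))(int i := Bit (z ! i)) = contents (take (Suc i) z)"
      using contents_snoc'[of i "take i z"] by simp
    then show "reads (S i) 12 = Bit True \<and> wp ?B F (\<lambda>t' st'. t' \<le> t + 7 \<and> st' = S (Suc i)) t (S i)"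
      using i read12[of i] read9[of i]
      by (simp add: S_def reads_def contents_of_nat n_def del: replicate_Suc) (auto simp: fun_eq_iff)
  next
    fix t' assume t': "t' \<le> t + n * (7 + 2)"
    have I: "tape_holds (c, h + int N) (drop N u)"
      using st(1) tape_holds_append[of c h "take N u" "drop N u"] len by (simp add: T)
    then have rd: "c (h + int N) = (case drop N u of [] \<Rightarrow> Blank | b # _ \<Rightarrow> Bit b)"
      by (auto dest: read_tape_holds)
    have "n \<le> length u" using len by (simp add: n_def)
    then have time: "t' \<le> t + 9 * length u" using t' by simp
    show "wp (Loop (\<lambda>r. r 12 = Bit True) ?B) F (wp ?R F Q) t' (S n)"
    proof (cases "n < N")
      case True
      then have "n = length z \<or> n = Suc m" by (auto simp: n_def)
      then have "contents z (int n) = Blank \<or> contents (replicate (Suc m) True) (int m - int n) = Blank"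
        by (auto simp: contents_def)
      moreover have "F (Suc (Suc (Suc (Suc t'))))"
        using time True N by (intro None) (auto simp: n_def)
      ultimately show ?thesis
        using read12[OF True] by (subst wp_Loop) (auto simp: S_def reads_def simp del: replicate_Suc)
    next
      case False
      then have "n = N" by (simp add: n_def)
      from N show ?thesis
      proof (elim disjE exE conjE)
        fix u' assume u: "u = replicate N True @ False # u'" and un: "unary u = Some (N, u')"
        have I1: "tape_holds (c, h + int N + 1) u'"
          using I u by (auto dest: tape_holds_move)
        show ?thesis
        proof (cases "N = length z \<and> N = Suc m")
          case True
          then have "Q (8 + t') (st(12 := (c, h + int N + 1), 4 := (contents z, int (length z)),
              5 := (contents z, int (length z)), 9 := (contents (replicate (Suc m) True), - 1)))"
            using un I1 time by (intro Some) auto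
          then show ?thesis
            using rd u True \<open>n = N\<close> read9[of N]
            by (subst wp_Loop)
              (simp add: S_def reads_def contents_of_nat of_nat_diff del: replicate_Suc,
               erule back_subst[of "Q (8 + t')"], auto simp: fun_eq_iff)
        next
          case False
          then have "F (7 + t')" using time un by (intro None) auto
          moreover have "\<not> (contents z (int N) = Blank \<and> contents (replicate (Suc m) True) (int m - int N) = Blank)"
            using False \<open>n = N\<close> read9[of N] by (auto simp: contents_of_nat n_def simp del: replicate_Suc)
          ultimately show ?thesis
            using rd u \<open>n = N\<close> 
            by (subst wp_Loop) (auto simp: S_def reads_def simp del: replicate_Suc)
        qed
      next
        assume "u = replicate N True" "unary u = None"
        then show ?thesis
          using rd time None \<open>n = N\<close> by (subst wp_Loop) (simp add: S_def reads_def del: replicate_Suc)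
      qed
    qed
  qed
  moreover have "S 0 = st" using st T by (simp add: S_def fun_upd_idem)
  ultimately show ?thesis by (simp add: LoadV_def)
qed

definition Compare :: prog where
  "Compare = StepLeft 6 ;; StepLeft 7 ;;
     Loop (\<lambda>r. r 6 \<noteq> Blank \<and> r 6 = r 7) (StepLeft 6 ;; StepLeft 7) ;; Check (\<lambda>r. r 6 = Blank \<and> r 7 = Blank)"

text \<open>The heads stand at the right ends after writing, so the strings are compared backwards
  and the prefixes not yet seen form the invariant. Different lengths show when one head reaches its
  left blank before the other.\<close>

lemma wp_Compare_aux:
  assumes "st 6 = (contents a, int p - 1)" "p \<le> length a" "st 7 = (contents b, int q - 1)" "q \<le> length b"
    and "\<And>t'. take p a = take q b \<Longrightarrow> t' \<le> t + 4 * p + 10 \<Longrightarrow> Q t' (st(6 := (contents a, - 1), 7 := (contents b, - 1)))"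
    and "\<And>t'. take p a \<noteq> take q b \<Longrightarrow> t' \<le> t + 4 * p + 10 \<Longrightarrow> F t'"
  shows "wp (Loop (\<lambda>r. r 6 \<noteq> Blank \<and> r 6 = r 7) (StepLeft 6 ;; StepLeft 7) ;; Check (\<lambda>r. r 6 = Blank \<and> r 7 = Blank)) F Q t st"
  using assms
proof (induction p arbitrary: q t st)
  case 0
  show ?case
  proof (cases "q = 0")
    case True
    have "Q (4 + t) (st(6 := (contents a, - 1), 7 := (contents b, - 1)))"
      by (rule 0(5)) (use True in auto)
    moreover have "st(6 := (contents a, - 1), 7 := (contents b, - 1)) = st"
      using 0 True by (simp add: fun_upd_idem)
    ultimately show ?thesis
      using 0(1,3) True by (subst wp_Seq, subst wp_Loop) (simp add: reads_def)
  next
    case False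
    then have "F (3 + t)" using 0(4) by (intro 0(6)) auto
    moreover have "contents b (int q - 1) \<noteq> Blank"
      using \<open>q \<le> length b\<close> False by (auto simp: contents_def)
    ultimately show ?thesis
      using 0(1,3) by (subst wp_Seq, subst wp_Loop) (simp add: reads_def numeral_3_eq_3)
  qed
next
  case (Suc p)
  have rd6: "contents a (int p) = Bit (a ! p)" using Suc.prems by (simp add: contents_of_nat)
  show ?case
  proof (cases "\<exists>q'. q = Suc q' \<and> a ! p = b ! q'")
    case True
    then obtain q' where q: "q = Suc q'" "a ! p = b ! q'" by blast
    have eq: "take (Suc p) a = take q b \<longleftrightarrow> take p a = take q' b"
      using Suc.prems q by (simp add: take_Suc_conv_app_nth)
    have "wp (Loop (\<lambda>r. r 6 \<noteq> Blank \<and> r 6 = r 7) (StepLeft 6 ;; StepLeft 7) ;; Check (\<lambda>r. r 6 = Blank \<and> r 7 = Blank)) F Q (Suc (Suc (Suc (Suc t))))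
       (st(6 := (contents a, int p - 1), 7 := (contents b, int q' - 1)))"
    proof (rule Suc.IH[where q = q'])
      fix t' assume *: "take p a = take q' b" "t' \<le> Suc (Suc (Suc (Suc t))) + 4 * p + 10"
      have "Q t' (st(6 := (contents a, - 1), 7 := (contents b, - 1)))"
        by (rule Suc.prems(5)) (use * eq in auto)
      then show "Q t' (st(6 := (contents a, int p - 1), 7 := (contents b, int q' - 1), 6 := (contents a, - 1), 7 := (contents b, - 1)))"
        by (rule back_subst[of "Q t'"]) (auto simp: fun_eq_iff)
    qed (use Suc.prems eq q in auto)
    moreover have "contents b (int q') = Bit (b ! q')" using Suc.prems q by (simp add: contents_of_nat)
    ultimately show ?thesis
      using rd6 q Suc.prems(1,3) by (subst wp_Seq, subst wp_Loop) (simp add: reads_def)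
  next
    case False
    have "contents b (int q - 1) = (if q = 0 then Blank else Bit (b ! (q - 1)))"
      using Suc.prems(4) by (auto simp: contents_def nat_diff_distrib')
    moreover have "take (Suc p) a \<noteq> take q b"
    proof
      assume eq: "take (Suc p) a = take q b"
      then have "length (take (Suc p) a) = length (take q b)" by simp
      then have "q = Suc p" using Suc.prems by simp
      with eq False Suc.prems show False by (simp add: take_Suc_conv_app_nth)
    qed
    ultimately show ?thesis
      using rd6 Suc.prems False by (subst wp_Seq, subst wp_Loop) (auto simp: reads_def)
  qed
qed

lemma wp_Compare:
  assumes "st 6 = (contents a, int (length a))" "st 7 = (contents b, int (length b))"
    and "\<And>t'. a = b \<Longrightarrow> t' \<le> t + 4 * length a + 12 \<Longrightarrow> Q t' (st(6 := (contents a, - 1), 7 := (contents b, - 1)))"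
    and "\<And>t'. a \<noteq> b \<Longrightarrow> t' \<le> t + 4 * length a + 12 \<Longrightarrow> F t'"
  shows "wp Compare F Q t st"
proof -
  have "wp (Loop (\<lambda>r. r 6 \<noteq> Blank \<and> r 6 = r 7) (StepLeft 6 ;; StepLeft 7) ;; Check (\<lambda>r. r 6 = Blank \<and> r 7 = Blank)) F Q (t + 2)
    (st(6 := (contents a, int (length a) - 1), 7 := (contents b, int (length b) - 1)))"
    by (rule wp_Compare_aux[where p = "length a" and q = "length b"])
       (use assms in \<open>auto simp: fun_upd_twist\<close>)
  then show ?thesis using assms(1,2) by (simp add: Compare_def numeral_2_eq_2)
qed

definition ReadBits :: prog where
  "ReadBits =
     Loop (\<lambda>r. r 12 = Bit True)
       (StepRight 12 ;; Check (\<lambda>r. r 12 \<noteq> Blank) ;; Upd 8 (\<lambda>r. r 12) MoveRight ;; StepRight 12) ;;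
     Check (\<lambda>r. r 12 = Bit False) ;; StepRight 12 ;; Check (\<lambda>r. r 12 = Blank)"

lemma wp_ReadBits:
  assumes "tape_holds (st 12) u" "st 8 = (contents ks, int (length ks))"
    and "\<And>bs T t'. read_bits u = Some bs \<Longrightarrow> t' \<le> t + 8 * length u + 10 \<Longrightarrow>
       Q t' (st(12 := T, 8 := (contents (ks @ bs), int (length (ks @ bs)))))"
    and "\<And>t'. read_bits u = None \<Longrightarrow> t' \<le> t + 8 * length u + 10 \<Longrightarrow> F t'"
  shows "wp ReadBits F Q t st"
  using assms
proof (induction u arbitrary: t st ks rule: read_bits.induct)
  case 1
  have "Q (t + 8) (st(12 := move_right (st 12), 8 := (contents (ks @ []), int (length (ks @ [])))))"
    by (rule 1(3)) auto
  then have "Q (8 + t) (st(12 := move_right (st 12)))"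
    using 1(2) by (simp add: fun_upd_idem ac_simps)
  moreover have "read_tape (move_right (st 12)) = Blank"
    using tape_holds_move[OF 1(1)] by (auto dest: read_tape_holds)
  ultimately show ?case
    using 1(1) by (subst ReadBits_def, subst wp_Seq, subst wp_Loop) (simp add: reads_def read_tape_holds)
next
  case (2 b u)
  have T1: "tape_holds (move_right (st 12)) (b # u)" using 2(2) by (rule tape_holds_move)
  then have T2: "tape_holds (move_right (move_right (st 12))) u" by (rule tape_holds_move)
  let ?st = "st(12 := move_right (move_right (st 12)), 8 := (contents (ks @ [b]), int (length (ks @ [b]))))"
  have "wp ReadBits F Q (8 + t) ?st"
  proof (rule "2.IH"[where ks = "ks @ [b]"])
    fix bs T t' assume *: "read_bits u = Some bs" "t' \<le> 8 + t + 8 * length u + 10"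
    have "Q t' (st(12 := T, 8 := (contents (ks @ b # bs), int (length (ks @ b # bs)))))"
      by (rule 2(4)) (use * in auto)
    then show "Q t' (?st(12 := T, 8 := (contents ((ks @ [b]) @ bs), int (length ((ks @ [b]) @ bs)))))"
      by (rule back_subst[of "Q t'"]) (auto simp: fun_eq_iff)
  qed (use 2 T2 in auto)
  then have "wp ReadBits F Q (8 + t) (st(12 := move_right (move_right (st 12)), 8 := (contents (ks @ [b]), int (length ks) + 1)))"
    by (simp add: ac_simps)
  then show ?case
    using 2(2,3) read_tape_holds[OF T1]
    apply (subst ReadBits_def, subst wp_Seq, subst wp_Loop)
    apply (simp add: reads_def read_tape_holds fun_upd_twist)
    apply (simp add: ReadBits_def)
    done
next
  case "3_1"
  then show ?case
    by (subst ReadBits_def, subst wp_Seq, subst wp_Loop) (simp add: reads_def read_tape_holds)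
next
  case "3_2"
  have "read_tape (move_right (st 12)) = Blank"
    using tape_holds_move[OF "3_2"(1)] by (auto dest: read_tape_holds)
  then show ?case
    using "3_2" by (subst ReadBits_def, subst wp_Seq, subst wp_Loop) (simp add: reads_def read_tape_holds)
next
  case ("3_3" v u)
  have "read_tape (move_right (st 12)) \<noteq> Blank"
    using tape_holds_move[OF "3_3"(1)] by (auto dest: read_tape_holds)
  then show ?case
    using "3_3" by (subst ReadBits_def, subst wp_Seq, subst wp_Loop) (simp add: reads_def read_tape_holds)
qed

text \<open>The first bit is read outside the loop and must be \<open>True\<close>: this enforces
  that \<open>k\<close> is positive and its numeral canonical.\<close>

definition ReadK :: prog where
  "ReadK = Check (\<lambda>r. r 12 = Bit True) ;; StepRight 12 ;; Check (\<lambda>r. r 12 = Bit True) ;;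
     Upd 8 (\<lambda>r. r 12) MoveRight ;; StepRight 12 ;; ReadBits"

lemma wp_ReadK:
  assumes "tape_holds (st 12) u" "st 8 = (contents [], 0)"
    and Some: "\<And>ks T t'. read_bits u = Some ks \<Longrightarrow> ks \<noteq> [] \<Longrightarrow> hd ks \<Longrightarrow> t' \<le> t + 8 * length u + 20 \<Longrightarrow>
       Q t' (st(12 := T, 8 := (contents ks, int (length ks))))"
    and None: "\<And>t'. (\<And>ks. read_bits u = Some ks \<Longrightarrow> ks = [] \<or> \<not> hd ks) \<Longrightarrow> t' \<le> t + 8 * length u + 20 \<Longrightarrow> F t'"
  shows "wp ReadK F Q t st"
proof -
  consider (N) "u = []" | (1) b where "u = [b]" | (F) b u' where "u = False # b # u'"
    | (TF) u' where "u = True # False # u'" | (TT) u' where "u = True # True # u'"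
    by (metis (full_types) list.exhaust)
  then show ?thesis
  proof cases
    case N
    then show ?thesis using assms by (simp add: ReadK_def reads_def read_tape_holds)
  next
    case 1
    then have "tape_holds (move_right (st 12)) []" using assms(1) by (auto dest: tape_holds_move)
    moreover have "read_bits u = Some ks \<Longrightarrow> ks = []" for ks using 1 by (cases b) auto
    ultimately show ?thesis using assms 1 by (simp add: ReadK_def reads_def read_tape_holds)
  next
    case F
    then show ?thesis using assms by (simp add: ReadK_def reads_def read_tape_holds)
  next
    case TF
    then have "tape_holds (move_right (st 12)) (False # u')" using assms(1) by (auto dest: tape_holds_move)
    moreover have "read_bits u = Some ks \<Longrightarrow> \<not> hd ks" for ks using TF by auto
    ultimately show ?thesis using assms TF by (simp add: ReadK_def reads_def read_tape_holds)
  next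
    case TT
    then have T1: "tape_holds (move_right (st 12)) (True # u')" using assms(1) by (auto dest: tape_holds_move)
    then have T2: "tape_holds (move_right (move_right (st 12))) u'" by (rule tape_holds_move)
    let ?st = "st(12 := move_right (move_right (st 12)), 8 := (contents [True], int (length [True])))"
    have "wp ReadBits F Q (9 + t) ?st"
    proof (rule wp_ReadBits[where ks = "[True]" and u = u'])
      fix bs T t' assume *: "read_bits u' = Some bs" "t' \<le> 9 + t + 8 * length u' + 10"
      have "Q t' (st(12 := T, 8 := (contents (True # bs), int (length (True # bs)))))"
        by (rule Some) (use * TT in auto)
      then show "Q t' (?st(12 := T, 8 := (contents ([True] @ bs), int (length ([True] @ bs)))))"
        by (rule back_subst[of "Q t'"]) (auto simp: fun_eq_iff)
    qed (use TT T2 None in auto)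
    moreover have "(contents [])(0 := Bit True) = contents [True]"
      using contents_snoc[of "[]" True] by simp
    ultimately show ?thesis
      using TT assms(1,2) read_tape_holds[OF T1] by (simp add: ReadK_def reads_def read_tape_holds fun_upd_twist)
  qed
qed

text \<open>The residue of the number modulo \<open>2 ^ i\<close>; for \<open>i\<close> beyond the
  length it is the number itself, so numerals of different lengths can be treated together.\<close>

definition low_bits :: "bool list \<Rightarrow> nat \<Rightarrow> nat" where
  "low_bits z i = bits_to_nat (drop (length z - i) z)"

lemma bits_to_nat_Cons: "bits_to_nat (b # bs) = of_bool b * 2 ^ length bs + bits_to_nat bs"
proof (induction bs rule: rev_induct)
  case (snoc c bs)
  have "bits_to_nat (b # bs @ [c]) = of_bool c + 2 * bits_to_nat (b # bs)"
    using bits_to_nat_snoc[of "b # bs" c] by simp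
  with snoc show ?case by (simp add: algebra_simps)
qed simp

lemma bits_to_nat_less: "bits_to_nat bs < 2 ^ length bs"
proof (induction bs)
  case (Cons b bs)
  then show ?case by (auto simp: bits_to_nat_Cons)
qed simp

lemma low_bits_0 [simp]: "low_bits z 0 = 0"
  by (simp add: low_bits_def)

lemma low_bits_all: "length z \<le> i \<Longrightarrow> low_bits z i = bits_to_nat z"
  by (simp add: low_bits_def)

lemma low_bits_less: "low_bits z i < 2 ^ i"
proof -
  have "low_bits z i < 2 ^ length (drop (length z - i) z)"
    unfolding low_bits_def by (rule bits_to_nat_less)
  also have "\<dots> \<le> 2 ^ i" by (intro power_increasing) auto
  finally show ?thesis .
qed

lemma low_bits_Suc: "low_bits z (Suc i) = of_bool (i < length z \<and> z ! (length z - 1 - i)) * 2 ^ i + low_bits z i"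
proof (cases "i < length z")
  case True
  then have "drop (length z - Suc i) z = z ! (length z - Suc i) # drop (length z - i) z"
    by (metis Cons_nth_drop_Suc Suc_diff_Suc diff_less length_greater_0_conv list.size(3) not_less_zero zero_less_Suc)
  with True show ?thesis by (simp add: low_bits_def bits_to_nat_Cons)
qed (simp add: low_bits_all)

text \<open>
  The bits are compared from the least significant one; register 10 records whether \<open>k \<le> z\<close> holds
  for the parts seen so far. Cells beyond the left end of the shorter number are blank and count as 0.
\<close>

definition CompareK :: prog where
  "CompareK = Upd 10 (\<lambda>r. Bit True) Stay ;; StepLeft 4 ;; StepLeft 8 ;;
     Loop (\<lambda>r. r 4 \<noteq> Blank \<or> r 8 \<noteq> Blank)
       (Upd 10 (\<lambda>r. if (r 4 = Bit True) = (r 8 = Bit True) then r 10 else Bit (r 4 = Bit True)) Stay ;; StepLeft 4 ;; StepLeft 8) ;;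
     Check (\<lambda>r. r 10 = Bit True)"

lemma wp_CompareK:
  assumes st: "st 4 = (contents z, int (length z))" "st 8 = (contents ks, int (length ks))" "st 10 = reg s"
    and Some: "\<And>T4 T8 T10 t'. bits_to_nat ks \<le> bits_to_nat z \<Longrightarrow> t' \<le> t + 5 * (length z + length ks) + 20 \<Longrightarrow>
        Q t' (st(4 := T4, 8 := T8, 10 := T10))"
    and None: "\<And>t'. \<not> bits_to_nat ks \<le> bits_to_nat z \<Longrightarrow> t' \<le> t + 5 * (length z + length ks) + 20 \<Longrightarrow> F t'"
  shows "wp CompareK F Q t st"
proof -
  define S where "S i = st(4 := (contents z, int (length z) - 1 - int i), 8 := (contents ks, int (length ks) - 1 - int i),
    10 := reg (Bit (low_bits ks i \<le> low_bits z i)))" for i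
  define n where "n = max (length z) (length ks)"
  have bit: "contents w (int (length w) - 1 - int i) = (if i < length w then Bit (w ! (length w - 1 - i)) else Blank)" for w i
  proof (cases "i < length w")
    case True
    then have "int (length w) - 1 - int i = int (length w - 1 - i)" by simp
    with True show ?thesis by (simp only: contents_of_nat) simp
  qed simp
  let ?B = "Upd 10 (\<lambda>r. if (r 4 = Bit True) = (r 8 = Bit True) then r 10 else Bit (r 4 = Bit True)) Stay ;; StepLeft 4 ;; StepLeft 8"
  have "wp (Loop (\<lambda>r. r 4 \<noteq> Blank \<or> r 8 \<noteq> Blank) ?B) F (wp (Check (\<lambda>r. r 10 = Bit True)) F Q) (3 + t) (S 0)"
  proof (rule wp_Loop_count[where n = n and c = 3])
    fix i t assume i: "i < n"
    define a where "a = (i < length z \<and> z ! (length z - 1 - i))"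
    define b where "b = (i < length ks \<and> ks ! (length ks - 1 - i))"
    have ab: "(contents z (int (length z) - 1 - int i) = Bit True) = a" "(contents ks (int (length ks) - 1 - int i) = Bit True) = b"
      by (auto simp: bit a_def b_def)
    \<comment> \<open>If the new bits differ, they decide, since both lower parts are below
      \<open>2 ^ i\<close>; if they agree, the earlier verdict stands.\<close>
    have "(low_bits ks (Suc i) \<le> low_bits z (Suc i)) = (if a = b then low_bits ks i \<le> low_bits z i else a)"
    proof -
      have "low_bits z (Suc i) = of_bool a * 2 ^ i + low_bits z i" "low_bits ks (Suc i) = of_bool b * 2 ^ i + low_bits ks i"
        by (simp_all only: low_bits_Suc a_def b_def)
      then show ?thesis using low_bits_less[of z i] low_bits_less[of ks i] by auto
    qed
    then have "wp ?B F (\<lambda>t' st'. t' \<le> t + 3 \<and> st' = S (Suc i)) t (S i)"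
      using ab by (simp add: S_def reads_def) (auto simp: fun_eq_iff)
    moreover have "reads (S i) 4 \<noteq> Blank \<or> reads (S i) 8 \<noteq> Blank"
      using i by (auto simp: S_def reads_def bit n_def)
    ultimately show "(reads (S i) 4 \<noteq> Blank \<or> reads (S i) 8 \<noteq> Blank) \<and> wp ?B F (\<lambda>t' st'. t' \<le> t + 3 \<and> st' = S (Suc i)) t (S i)"
      by blast
  next
    show "\<not> (reads (S n) 4 \<noteq> Blank \<or> reads (S n) 8 \<noteq> Blank)"
      by (simp add: S_def reads_def bit n_def)
  next
    fix t' assume t': "t' \<le> 3 + t + n * (3 + 2) + 1"
    moreover have "n \<le> length z + length ks" by (simp add: n_def)
    ultimately have "t' + 3 \<le> t + 5 * (length z + length ks) + 20" by simp
    moreover have "low_bits z n = bits_to_nat z" "low_bits ks n = bits_to_nat ks"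
      by (auto simp: n_def intro!: low_bits_all)
    ultimately show "wp (Check (\<lambda>r. r 10 = Bit True)) F Q t' (S n)"
      using Some None by (simp add: S_def reads_def)
  qed
  then show ?thesis
    using st by (simp add: CompareK_def S_def fun_upd_twist numeral_3_eq_3)
qed

section \<open>The checker\<close>

text \<open>What remains to be checked once \<open>V\<close> has been evaluated. With
  \<open>accepts_inverse\<close> it cuts \<open>checks\<close> at the places where the program is
  cut, so each stage fails exactly if its remainder is false.\<close>

definition accepts_output :: "bool list \<Rightarrow> bool list \<Rightarrow> bool list \<Rightarrow> bool list \<Rightarrow> bool" where
  "accepts_output bs xy z u \<longleftrightarrow>
     bs = xy \<and> (\<exists>ks. read_bits u = Some ks \<and> ks \<noteq> [] \<and> hd ks \<and> bits_to_nat ks \<le> bits_to_nat z)"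

definition accepts_inverse :: "bool list \<Rightarrow> bool list \<Rightarrow> nat \<Rightarrow> bool list \<Rightarrow> bool" where
  "accepts_inverse xy z m u \<longleftrightarrow>
     (\<exists>u1 bs u2. unary u = Some (length z, u1) \<and> length z = Suc m \<and>
        run_circuit z u1 = Some (bs, u2) \<and> accepts_output bs xy z u2)"

lemma checks_iff_accepts:
  "checks u x y \<longleftrightarrow> (\<exists>N u1 z u2. unary u = Some (N, u1) \<and> length x \<le> N \<and>
     run_circuit (x @ pad (N - length x) y) u1 = Some (z, u2) \<and>
     accepts_inverse (x @ pad (N - length x) y) z (N - length x) u2)"
  unfolding checks_iff accepts_inverse_def accepts_output_def by fastforce

lemma length_read_bits: "read_bits u = Some ks \<Longrightarrow> length ks \<le> length u"
  by (induction u arbitrary: ks rule: read_bits.induct) auto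

lemma length_unary: "unary u = Some (n, u') \<Longrightarrow> n + length u' < length u"
  by (auto simp: unary_eq_Some_iff enc_unary_def)

lemma length_run_gates: "run_gates vs u = Some (vs', u') \<Longrightarrow> length u' < length u"
  by (auto simp: run_gates_eq_Some_iff enc_list_def)

lemma length_run_outs: "run_outs vs u = Some (bs, u') \<Longrightarrow> length bs + length u' < length u"
proof (induction vs u arbitrary: bs rule: run_outs.induct)
  case (3 vs u)
  then show ?case by (fastforce split: option.splits dest: length_fetch)
qed auto

definition Decide :: prog where
  "Decide = Compare ;; ReadK ;; CompareK ;; Upd 0 (\<lambda>r. Bit True) Stay"

definition CheckV :: prog where
  "CheckV = LoadV ;; Rewind 5 ;; Gates 5 ;; Outs 5 6 ;; Decide"

definition Checker :: prog where
  "Checker = LoadC ;; Rewind 3 ;; Gates 3 ;; Outs 3 4 ;; Rewind 4 ;; CheckV"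

text \<open>The bound of \<open>wp_Gates\<close> for \<open>B = L\<close>, where \<open>L\<close>
  bounds the code still to be read and the strings decoded from it. It also dominates evaluating the
  outputs and the linear routines, and so serves as the unit of time.\<close>

definition cost :: "nat \<Rightarrow> nat" where
  "cost L = (L + 1) * (20 * L + 100)"

lemma cost_ge: "20 * L + 100 \<le> cost L"
  by (simp add: cost_def)

lemma gates_cost: "l \<le> L \<Longrightarrow> (l + 1) * (20 * L + 100) \<le> cost L"
  unfolding cost_def by (intro mult_le_mono) auto

lemma outs_cost: "l \<le> L \<Longrightarrow> (l + 1) * (7 * l + 30) \<le> cost L"
  unfolding cost_def by (intro mult_le_mono) auto

lemma wp_Decide:
  assumes st: "st 6 = (contents bs, int (length bs))" "st 7 = (contents xy, int (length xy))"
      "st 4 = (contents z, int (length z))" "st 8 = (contents [], 0)" "tape_holds (st 12) u" "st 10 = reg s"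
    and len: "length z \<le> L" "length u \<le> L" "length bs \<le> L"
    and Q: "\<And>t' st'. accepts_output bs xy z u \<Longrightarrow> t' \<le> t + 4 * cost L \<Longrightarrow>
        st' 0 = act_tape (Bit True, Stay) (st 0) \<Longrightarrow> Q t' st'"
    and F: "\<And>t'. \<not> accepts_output bs xy z u \<Longrightarrow> t' \<le> t + 4 * cost L \<Longrightarrow> F t'"
  shows "wp Decide F Q t st"
  unfolding Decide_def wp_Seq
proof (rule wp_Compare)
  note c = cost_ge[of L]
  fix t1 assume 1: "bs = xy" "t1 \<le> t + 4 * length bs + 12"
  let ?st1 = "st(6 := (contents bs, - 1), 7 := (contents xy, - 1))"
  show "wp ReadK F (wp CompareK F (wp (Upd 0 (\<lambda>r. Bit True) Stay) F Q)) t1 ?st1"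
  proof (rule wp_ReadK)
    fix ks T t2
    assume 2: "read_bits u = Some ks" "ks \<noteq> []" "hd ks" "t2 \<le> t1 + 8 * length u + 20"
    let ?st2 = "?st1(12 := T, 8 := (contents ks, int (length ks)))"
    have "length ks \<le> L" using length_read_bits[OF 2(1)] len by simp
    then have time: "t3 + 1 \<le> t + 4 * cost L" if "t3 \<le> t2 + 5 * (length z + length ks) + 20" for t3
      using that 1 2 c len by simp
    show "wp CompareK F (wp (Upd 0 (\<lambda>r. Bit True) Stay) F Q) t2 ?st2"
    proof (rule wp_CompareK)
      fix T4 T8 T10 t3
      assume "bits_to_nat ks \<le> bits_to_nat z" "t3 \<le> t2 + 5 * (length z + length ks) + 20"
      with 1 2 time show "wp (Upd 0 (\<lambda>r. Bit True) Stay) F Q t3 (?st2(4 := T4, 8 := T8, 10 := T10))"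
        by (subst wp_Upd, intro Q) (auto simp: accepts_output_def)
    next
      fix t3 assume "\<not> bits_to_nat ks \<le> bits_to_nat z" "t3 \<le> t2 + 5 * (length z + length ks) + 20"
      with 2 time[of t3] show "F t3" by (intro F) (auto simp: accepts_output_def)
    qed (use st in auto)
  next
    fix t2 assume "\<And>ks. read_bits u = Some ks \<Longrightarrow> ks = [] \<or> \<not> hd ks" "t2 \<le> t1 + 8 * length u + 20"
    with 1 c len show "F t2" by (intro F) (auto simp: accepts_output_def)
  qed (use st in auto)
next
  fix t1 assume "bs \<noteq> xy" "t1 \<le> t + 4 * length bs + 12"
  with cost_ge[of L] len show "F t1" by (intro F) (auto simp: accepts_output_def)
qed (use st in auto)

lemma wp_CheckV:
  assumes st: "tape_holds (st 12) u" "st 4 = (contents z, 0)" "st 5 = (contents [], 0)" "st 6 = (contents [], 0)"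
      "st 7 = (contents xy, int (length xy))" "st 8 = (contents [], 0)"
      "st 9 = (contents (replicate (Suc m) True), int m)" "st 10 = reg s" "st 11 = reg s'"
    and len: "length u \<le> L"
    and Q: "\<And>t' st'. accepts_inverse xy z m u \<Longrightarrow> t' \<le> t + 8 * cost L \<Longrightarrow>
        st' 0 = act_tape (Bit True, Stay) (st 0) \<Longrightarrow> Q t' st'"
    and F: "\<And>t'. \<not> accepts_inverse xy z m u \<Longrightarrow> t' \<le> t + 8 * cost L \<Longrightarrow> F t'"
  shows "wp CheckV F Q t st"
  unfolding CheckV_def wp_Seq
proof (rule wp_LoadV)
  note c = cost_ge[of L]
  fix u1 T1 t1
  assume 1: "unary u = Some (length z, u1)" "length z = Suc m" "tape_holds T1 u1" "t1 \<le> t + 9 * length u + 20"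
  let ?st1 = "st(12 := T1, 4 := (contents z, int (length z)), 5 := (contents z, int (length z)),
         9 := (contents (replicate (Suc m) True), - 1))"
  have len1: "length u1 + length z \<le> L" using length_unary[OF 1(1)] len by simp
  show "wp (Rewind 5) F (wp (Gates 5) F (wp (Outs 5 6) F (wp Decide F Q))) t1 ?st1"
  proof (rule wp_Rewind[where w = z and p = "length z"])
    fix t2 assume 2: "t2 \<le> t1 + 3 * length z + 4"
    let ?st2 = "?st1(5 := (contents z, 0))"
    have t2: "t2 \<le> t + 2 * cost L" using 1(4) 2 c len len1 by simp
    show "wp (Gates 5) F (wp (Outs 5 6) F (wp Decide F Q)) t2 ?st2"
    proof (rule wp_Gates[where vs = z and u = u1 and B = L])
      fix vs u2 T3 s3 s3' t3
      assume 3: "run_gates z u1 = Some (vs, u2)" "tape_holds T3 u2" "t3 \<le> t2 + (length u1 + 1) * (20 * L + 100)"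
      let ?st3 = "?st2(12 := T3, 10 := reg s3, 11 := reg s3', 5 := (contents vs, 0))"
      have len2: "length u2 \<le> L" using length_run_gates[OF 3(1)] len1 by simp
      have t3: "t3 \<le> t + 3 * cost L" using t2 3(3) gates_cost[of "length u1" L] len1 by simp
      show "wp (Outs 5 6) F (wp Decide F Q) t3 ?st3"
      proof (rule wp_Outs[where zs = "[]" and vs = vs and u = u2])
        fix bs u3 T4 s4 t4
        assume 4: "run_outs vs u2 = Some (bs, u3)" "tape_holds T4 u3" "t4 \<le> t3 + (length u2 + 1) * (7 * length u2 + 30)"
        let ?st4 = "?st3(12 := T4, 10 := reg s4, 6 := (contents ([] @ bs), int (length ([] @ bs))))"
        have t4: "t4 \<le> t + 4 * cost L" using t3 4(3) outs_cost[of "length u2" L] len2 by simp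
        \<comment> \<open>The parses made so far are deterministic, so the condition of this stage
          reduces to that of the next one.\<close>
        have acc: "accepts_inverse xy z m u = accepts_output bs xy z u3"
          using 1 3 4 by (simp add: accepts_inverse_def run_circuit_def)
        show "wp Decide F Q t4 ?st4"
        proof (rule wp_Decide[where L = L and bs = bs and xy = xy and z = z and u = u3])
          show "length u3 \<le> L" "length bs \<le> L" using length_run_outs[OF 4(1)] len2 by simp_all
        qed (use st 4 acc t4 Q F len1 in auto)
      next
        fix t4 assume "run_outs vs u2 = None" "t4 \<le> t3 + (length u2 + 1) * (7 * length u2 + 30)"
        then show "F t4" using t3 outs_cost[of "length u2" L] len2 1 3
          by (intro F) (simp_all add: accepts_inverse_def run_circuit_def)
      qed (use st 3 in auto)
    next
      fix t3 assume "run_gates z u1 = None" "t3 \<le> t2 + (length u1 + 1) * (20 * L + 100)"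
      then show "F t3" using t2 gates_cost[of "length u1" L] len1 1
        by (intro F) (simp_all add: accepts_inverse_def run_circuit_def)
    qed (use st 1 len1 in auto)
  qed auto
next
  fix t' assume "\<And>u'. unary u = Some (length z, u') \<Longrightarrow> length z \<noteq> Suc m" "t' \<le> t + 9 * length u + 20"
  then show "F t'" using cost_ge[of L] len by (intro F) (auto simp: accepts_inverse_def)
qed (use st in auto)

text \<open>One unit of \<open>cost\<close> each goes to loading, gates, outputs and rewinding, and
  eight to \<open>CheckV\<close>; the bound of 13 leaves one spare. The final store is described
  only on tape 0, where the answer is.\<close>

lemma wp_Checker:
  assumes st: "tape_holds (st 12) u" "st 1 = (contents x, 0)" "st 2 = (contents y, 0)"
      "\<And>i. 3 \<le> i \<Longrightarrow> i \<le> 9 \<Longrightarrow> st i = (contents [], 0)" "st 10 = reg s" "st 11 = reg s'"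
    and Q: "\<And>t' st'. checks u x y \<Longrightarrow> t' \<le> t + 13 * cost (length u) \<Longrightarrow>
        st' 0 = act_tape (Bit True, Stay) (st 0) \<Longrightarrow> Q t' st'"
    and F: "\<And>t'. \<not> checks u x y \<Longrightarrow> t' \<le> t + 13 * cost (length u) \<Longrightarrow> F t'"
  shows "wp Checker F Q t st"
  unfolding Checker_def wp_Seq
proof (rule wp_LoadC)
  define L where "L = length u"
  note c = cost_ge[of L]
  fix N m u1 T1 t1
  assume 1: "unary u = Some (N, u1)" "length x \<le> N" "m = N - length x" "tape_holds T1 u1" "t1 \<le> t + 8 * length u + 20"
  define xy where "xy = x @ pad m y"
  have xy: "length xy = N" using 1 by (simp add: xy_def)
  let ?st1 = "st(12 := T1, 1 := (contents x, int (length x)), 2 := (contents y, int m),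
         3 := (contents (x @ pad m y), int N), 7 := (contents (x @ pad m y), int N),
         9 := (contents (replicate (Suc m) True), int m))"
  have len1: "length u1 + length xy \<le> L" using length_unary[OF 1(1)] xy by (simp add: L_def)
  show "wp (Rewind 3) F (wp (Gates 3) F (wp (Outs 3 4) F (wp (Rewind 4) F (wp CheckV F Q)))) t1 ?st1"
  proof (rule wp_Rewind[where w = xy and p = N])
    fix t2 assume 2: "t2 \<le> t1 + 3 * N + 4"
    let ?st2 = "?st1(3 := (contents xy, 0))"
    have t2: "t2 \<le> t + cost L" using 1(5) 2 c len1 xy by (simp add: L_def)
    show "wp (Gates 3) F (wp (Outs 3 4) F (wp (Rewind 4) F (wp CheckV F Q))) t2 ?st2"
    proof (rule wp_Gates[where vs = xy and u = u1 and B = L])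
      fix vs u2 T3 s3 s3' t3
      assume 3: "run_gates xy u1 = Some (vs, u2)" "tape_holds T3 u2" "t3 \<le> t2 + (length u1 + 1) * (20 * L + 100)"
      let ?st3 = "?st2(12 := T3, 10 := reg s3, 11 := reg s3', 3 := (contents vs, 0))"
      have len2: "length u2 \<le> L" using length_run_gates[OF 3(1)] len1 by simp
      have t3: "t3 \<le> t + 2 * cost L" using t2 3(3) gates_cost[of "length u1" L] len1 by simp
      show "wp (Outs 3 4) F (wp (Rewind 4) F (wp CheckV F Q)) t3 ?st3"
      proof (rule wp_Outs[where zs = "[]" and vs = vs and u = u2])
        fix z u3 T4 s4 t4
        assume 4: "run_outs vs u2 = Some (z, u3)" "tape_holds T4 u3" "t4 \<le> t3 + (length u2 + 1) * (7 * length u2 + 30)"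
        let ?st4 = "?st3(12 := T4, 10 := reg s4, 4 := (contents ([] @ z), int (length ([] @ z))))"
        have t4: "t4 \<le> t + 3 * cost L" using t3 4(3) outs_cost[of "length u2" L] len2 by simp
        have len3: "length z \<le> L" "length u3 \<le> L" using length_run_outs[OF 4(1)] len2 by simp_all
        have acc: "checks u x y = accepts_inverse xy z m u3"
          using 1 3 4 by (simp add: checks_iff_accepts run_circuit_def xy_def)
        show "wp (Rewind 4) F (wp CheckV F Q) t4 ?st4"
        proof (rule wp_Rewind[where w = z and p = "length z"])
          fix t5 assume "t5 \<le> t4 + 3 * length z + 4"
          then have t5: "t5 \<le> t + 4 * cost L" using t4 len3 c by simp
          show "wp CheckV F Q t5 (?st4(4 := (contents z, 0)))"
            by (rule wp_CheckV[where u = u3 and z = z and xy = xy and m = m and L = L and s = s4 and s' = s3'])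
               (use st 4 acc t5 Q F len3 xy in \<open>auto simp: L_def xy_def\<close>)
        qed auto
      next
        fix t4 assume "run_outs vs u2 = None" "t4 \<le> t3 + (length u2 + 1) * (7 * length u2 + 30)"
        then show "F t4" using t3 outs_cost[of "length u2" L] len2 1 3
          by (intro F) (simp_all add: checks_iff_accepts run_circuit_def L_def xy_def)
      qed (use st 3 in auto)
    next
      fix t3 assume "run_gates xy u1 = None" "t3 \<le> t2 + (length u1 + 1) * (20 * L + 100)"
      then show "F t3" using t2 gates_cost[of "length u1" L] len1 1
        by (intro F) (simp_all add: checks_iff_accepts run_circuit_def L_def xy_def)
    qed (use st 1 len1 in auto)
  qed (use xy in \<open>auto simp: xy_def\<close>)
next
  fix t' assume "case unary u of None \<Rightarrow> True | Some (N, u') \<Rightarrow> N < length x" "t' \<le> t + 8 * length u + 20"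
  then show "F t'" using cost_ge[of "length u"] by (intro F) (auto simp: checks_iff_accepts)
qed (use st in auto)

section \<open>Simulating the reduction\<close>

text \<open>The simulated machine works on a copy because tape 0 must carry the answer; its head is
  left on the blank behind \<open>w\<close>, ready for that.\<close>

definition CopyIn :: prog where
  "CopyIn = Loop (\<lambda>r. r 0 \<noteq> Blank) (Upd 12 (\<lambda>r. r 0) MoveRight ;; StepRight 0) ;; Rewind 12"

lemma wp_CopyIn:
  assumes st: "st 0 = (contents w, 0)" "st 12 = (contents [], 0)"
    and Q: "\<And>t'. t' \<le> t + 7 * length w + 10 \<Longrightarrow>
      Q t' (st(0 := (contents w, int (length w)), 12 := (contents w, 0)))"
  shows "wp CopyIn F Q t st"
proof -
  define S where "S i = st(0 := (contents w, int i), 12 := (contents (take i w), int i))" for i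
  have "wp (Loop (\<lambda>r. r 0 \<noteq> Blank) (Upd 12 (\<lambda>r. r 0) MoveRight ;; StepRight 0)) F (wp (Rewind 12) F Q) t (S 0)"
  proof (rule wp_Loop_count[where n = "length w" and c = 2])
    fix i t assume i: "i < length w"
    then have "(contents (take i w))(int i := Bit (w ! i)) = contents (take (Suc i) w)"
      using contents_snoc'[of i "take i w"] by (simp add: take_Suc_conv_app_nth)
    with i show "reads (S i) 0 \<noteq> Blank \<and>
        wp (Upd 12 (\<lambda>r. r 0) MoveRight ;; StepRight 0) F (\<lambda>t' st'. t' \<le> t + 2 \<and> st' = S (Suc i)) t (S i)"
      by (simp add: S_def reads_def contents_of_nat) (auto simp: fun_eq_iff)
  next
    show "\<not> reads (S (length w)) 0 \<noteq> Blank"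
      by (simp add: S_def reads_def contents_of_nat)
  next
    fix t' assume "t' \<le> t + length w * (2 + 2) + 1"
    then show "wp (Rewind 12) F Q t' (S (length w))"
      by (intro wp_Rewind[where w = w and p = "length w"]) (use Q in \<open>auto simp: S_def\<close>)
  qed
  moreover have "S 0 = st" using st by (simp add: S_def fun_upd_idem)
  ultimately show ?thesis by (simp add: CopyIn_def)
qed

text \<open>
  The state of the simulated machine is kept as a symbol on tape 10.
\<close>

definition sim_act :: "tm \<Rightarrow> (nat \<Rightarrow> sym) \<Rightarrow> nat \<Rightarrow> sym \<times> dir" where
  "sim_act M r =
     (let q = (case r 10 of Aux q \<Rightarrow> q | _ \<Rightarrow> halt_state M); ss = map (\<lambda>i. r (12 + i)) [0..<ntapes M] in
      if q \<in> states M \<and> q \<noteq> halt_state M \<and> set ss \<subseteq> symbols M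
      then (let (q', as) = delta M q ss in
        (\<lambda>j. if j = 10 then (Aux q', Stay) else if 12 \<le> j \<and> j < 12 + ntapes M then as ! (j - 12) else (r j, Stay)))
      else idle r)"

definition Simulate :: "tm \<Rightarrow> prog" where
  "Simulate M = Upd 10 (\<lambda>r. Aux (start_state M)) Stay ;;
     Loop (\<lambda>r. r 10 \<noteq> Aux (halt_state M)) (Act (sim_act M))"

definition sim_symbols :: "tm \<Rightarrow> sym set" where
  "sim_symbols M = symbols M \<union> Aux ` states M"

lemma wf_tm_delta:
  assumes "wf_tm M" "q \<in> states M" "q \<noteq> halt_state M" "length ss = ntapes M" "set ss \<subseteq> symbols M" "delta M q ss = (q', as)"
  shows "q' \<in> states M" "length as = ntapes M" "fst ` set as \<subseteq> symbols M"
  using assms unfolding wf_tm_def by force+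

text \<open>\<open>wf_tm\<close> controls \<open>delta\<close> only on states and symbols of
  \<open>M\<close>, whereas tapes here range over the larger alphabet \<open>sim_symbols\<close>.
  The guard in \<open>sim_act\<close> makes all other cases idle.\<close>

lemma closed_sim_act:
  assumes "wf_tm M"
  shows "closed_act (12 + ntapes M) (sim_symbols M) (sim_act M)"
  unfolding closed_act_def
proof (intro conjI allI impI)
  fix r r' :: "nat \<Rightarrow> sym" assume a: "agree (12 + ntapes M) r r'"
  then have eq: "map (\<lambda>i. r (12 + i)) [0..<ntapes M] = map (\<lambda>i. r' (12 + i)) [0..<ntapes M]" "r 10 = r' 10"
    by (auto simp: agree_def)
  show "agree (12 + ntapes M) (sim_act M r) (sim_act M r')"
    unfolding sim_act_def Let_def eq using a by (simp add: agree_def split: prod.split)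
next
  fix r :: "nat \<Rightarrow> sym" and j assume r: "\<forall>i<12 + ntapes M. r i \<in> sim_symbols M" and j: "j < 12 + ntapes M"
  define q where "q = (case r 10 of Aux q \<Rightarrow> q | _ \<Rightarrow> halt_state M)"
  define ss where "ss = map (\<lambda>i. r (12 + i)) [0..<ntapes M]"
  obtain q' as where d: "delta M q ss = (q', as)" by fastforce
  show "fst (sim_act M r j) \<in> sim_symbols M"
  proof (cases "q \<in> states M \<and> q \<noteq> halt_state M \<and> set ss \<subseteq> symbols M")
    case True
    then have "q' \<in> states M" "length as = ntapes M" "fst ` set as \<subseteq> symbols M"
      using wf_tm_delta[OF assms _ _ _ _ d] by (auto simp: ss_def)
    moreover have "as ! (j - 12) \<in> set as" if "12 \<le> j"
      using that j \<open>length as = _\<close> by (intro nth_mem) simp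
    ultimately show ?thesis
      using True d j r by (auto simp: sim_act_def q_def[symmetric] ss_def[symmetric] sim_symbols_def Let_def)
  next
    case False
    then show ?thesis
      using r j by (auto simp: sim_act_def q_def[symmetric] ss_def[symmetric] Let_def)
  qed
qed

section \<open>Runs of the reduction machine and the length of its output\<close>

definition valid_config :: "tm \<Rightarrow> config \<Rightarrow> bool" where
  "valid_config M c \<longleftrightarrow> fst c \<in> states M \<and> length (snd c) = ntapes M \<and>
     (\<forall>T \<in> set (snd c). \<forall>i. fst T i \<in> symbols M)"

lemma act_tape_idle: "act_tape (read_tape T, Stay) T = T"
  by (cases T) simp

lemma read_tape_eq: "read_tape T = fst T (snd T)"
  by (cases T) simp

lemma valid_config_reads:
  "valid_config M (q, ts) \<Longrightarrow> set (map read_tape ts) \<subseteq> symbols M"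
  by (auto simp: valid_config_def read_tape_eq)

text \<open>Preservation of validity ensures that in a genuine run the guard of
  \<open>sim_act\<close> holds at every step before halting, so the simulation is faithful.\<close>

lemma valid_config_step:
  assumes "wf_tm M" "valid_config M c"
  shows "valid_config M (tm_step M c)"
proof (cases c)
  case (Pair q ts)
  show ?thesis
  proof (cases "q = halt_state M")
    case True
    then show ?thesis using assms Pair by (simp add: tm_step.simps)
  next
    case False
    obtain q' as where d: "delta M q (map read_tape ts) = (q', as)" by fastforce
    have v: "q \<in> states M" "length ts = ntapes M" "\<And>T i. T \<in> set ts \<Longrightarrow> fst T i \<in> symbols M"
      using assms Pair by (auto simp: valid_config_def)
    have w: "q' \<in> states M" "length as = ntapes M" "fst ` set as \<subseteq> symbols M"
      using wf_tm_delta[OF assms(1) v(1) False _ _ d] v(2) valid_config_reads assms(2) Pair by auto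
    have "fst T i \<in> symbols M" if "T \<in> set (map2 act_tape as ts)" for T i
    proof -
      from that obtain a T' where aT: "(a, T') \<in> set (zip as ts)" "T = act_tape a T'" by auto
      then have "fst a \<in> symbols M" "fst T' i \<in> symbols M"
        using v(3)[OF set_zip_rightD[OF aT(1)]] w(3) set_zip_leftD[OF aT(1)] by auto
      with aT(2) show ?thesis by (cases a; cases T') auto
    qed
    with v w d False Pair show ?thesis
      by (simp add: valid_config_def tm_step.simps)
  qed
qed

lemma valid_config_init:
  assumes "wf_tm M"
  shows "valid_config M (init_config M ws)"
proof -
  have "Bit b \<in> symbols M" for b
    using assms by (cases b) (auto simp: wf_tm_def)
  with assms show ?thesis
    by (auto simp: valid_config_def init_config_def wf_tm_def input_tape_def)
qed

lemma valid_config_after: "wf_tm M \<Longrightarrow> valid_config M (config_after M ws t)"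
  unfolding config_after_def
  by (induction t) (auto simp: valid_config_init valid_config_step)

lemma config_after_Suc: "config_after M ws (Suc t) = tm_step M (config_after M ws t)"
  by (simp add: config_after_def)

lemma config_after_mono:
  assumes "halted_after M ws t" "t \<le> t'"
  shows "config_after M ws t' = config_after M ws t"
  using assms(2)
proof (induction t' rule: dec_induct)
  case (step n)
  obtain q ts where "config_after M ws t = (q, ts)" by fastforce
  with step assms(1) show ?case
    by (simp add: config_after_Suc tm_step.simps halted_after_def)
qed simp

text \<open>A halted configuration no longer changes, so the time witnessing the output can be
  exchanged for any known halting time, in particular one within the polynomial bound.\<close>

lemma outputs_iff:
  assumes "halted_after M ws t"
  shows "outputs M ws u \<longleftrightarrow> tape_holds (snd (config_after M ws t) ! 0) u"
proof
  assume "outputs M ws u"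
  then obtain t' where "halted_after M ws t'" "tape_holds (snd (config_after M ws t') ! 0) u"
    by (auto simp: outputs_def)
  moreover have "config_after M ws t' = config_after M ws t"
    using config_after_mono[OF assms, of t'] config_after_mono[OF \<open>halted_after M ws t'\<close>, of t] nat_le_linear[of t t'] by auto
  ultimately show "tape_holds (snd (config_after M ws t) ! 0) u" by simp
qed (use assms in \<open>auto simp: outputs_def\<close>)

definition used :: "tape \<Rightarrow> int set" where
  "used T = {i. fst T i \<noteq> Blank}"

lemma used_act_tape: "used (act_tape a T) \<subseteq> insert (snd T) (used T)"
  by (cases a; cases T) (auto simp: used_def)

text \<open>A step writes only the cell under the head and so adds at most one nonblank cell.
  Counting cells avoids tracking where on the two-way tape the output begins.\<close>

lemma used_config_after:
  assumes "wf_tm M"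
  shows "finite (used (snd (config_after M [w] t) ! 0)) \<and> card (used (snd (config_after M [w] t) ! 0)) \<le> length w + t"
proof (induction t)
  case 0
  have "used (snd (config_after M [w] 0) ! 0) = {0..<int (length w)}"
    using assms by (auto simp: config_after_def init_config_def wf_tm_def used_def input_tape_def split: if_splits)
  then show ?case by simp
next
  case (Suc t)
  obtain q ts where c: "config_after M [w] t = (q, ts)" by fastforce
  obtain q' as where d: "delta M q (map read_tape ts) = (q', as)" by fastforce
  have v: "valid_config M (q, ts)" using valid_config_after[OF assms, of "[w]" t] c by simp
  have "1 \<le> ntapes M" using assms by (simp add: wf_tm_def)
  have "\<exists>x. used (snd (config_after M [w] (Suc t)) ! 0) \<subseteq> insert x (used (ts ! 0))"
  proof (cases "q = halt_state M")
    case True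
    then show ?thesis by (auto simp: config_after_Suc c tm_step.simps)
  next
    case False
    then have "length as = ntapes M" "length ts = ntapes M"
      using wf_tm_delta(2)[OF assms _ False _ valid_config_reads[OF v] d] v by (auto simp: valid_config_def)
    with False d used_act_tape[of "as ! 0" "ts ! 0"] \<open>1 \<le> ntapes M\<close> show ?thesis
      by (auto simp: config_after_Suc c tm_step.simps)
  qed
  then obtain x where x: "used (snd (config_after M [w] (Suc t)) ! 0) \<subseteq> insert x (used (ts ! 0))" by blast
  have fin: "finite (used (ts ! 0))" "card (used (ts ! 0)) \<le> length w + t" using Suc c by simp_all
  with x have "finite (used (snd (config_after M [w] (Suc t)) ! 0))" by (meson finite_insert finite_subset)
  moreover have "card (used (snd (config_after M [w] (Suc t)) ! 0)) \<le> Suc (card (used (ts ! 0)))"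
    using card_mono[OF _ x] fin by (simp add: card_insert_if split: if_splits)
  ultimately show ?case using fin by simp
qed

lemma length_output:
  assumes "wf_tm M" "tape_holds (snd (config_after M [w] t) ! 0) u"
  shows "length u \<le> length w + t"
proof -
  obtain c h where T: "snd (config_after M [w] t) ! 0 = (c, h)" by fastforce
  have "{h..<h + int (length u)} \<subseteq> used (c, h)"
  proof
    fix i assume "i \<in> {h..<h + int (length u)}"
    then have "c (h + int (nat (i - h))) = Bit (u ! nat (i - h))"
      using assms(2) T by (intro tape_holds_nth) auto
    with \<open>i \<in> _\<close> show "i \<in> used (c, h)" by (simp add: used_def)
  qed
  then have "card {h..<h + int (length u)} \<le> card (used (c, h))"
    using used_config_after[OF assms(1), of w t] T by (intro card_mono) auto
  then show ?thesis using used_config_after[OF assms(1), of w t] T by simp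
qed

lemma wp_Simulate:
  assumes M: "wf_tm M" "halted_after M [w] t0"
    and st: "st 10 = reg s" "st 12 = input_tape w" "\<And>i. 0 < i \<Longrightarrow> i < ntapes M \<Longrightarrow> st (12 + i) = input_tape []"
    and Q: "\<And>t' st'. t' \<le> t + 3 * t0 + 2 \<Longrightarrow> (\<And>i. i \<le> 11 \<Longrightarrow> i \<noteq> 10 \<Longrightarrow> st' i = st i) \<Longrightarrow>
       st' 10 = reg (Aux (halt_state M)) \<Longrightarrow> st' 12 = snd (config_after M [w] t0) ! 0 \<Longrightarrow> Q t' st'"
  shows "wp (Simulate M) F Q t st"
proof -
  \<comment> \<open>The loop stops at the first halting time, while \<open>t0\<close> is any halting
    time; the configurations at both times coincide.\<close>
  define n where "n = (LEAST n. halted_after M [w] n)"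
  have hn: "halted_after M [w] n" unfolding n_def using M(2) by (rule LeastI)
  have "n \<le> t0" unfolding n_def using M(2) by (rule Least_le)
  define c where "c i = config_after M [w] i" for i
  define S where "S i = (\<lambda>j. if j = 10 then reg (Aux (fst (c i))) else
    if 12 \<le> j \<and> j < 12 + ntapes M then snd (c i) ! (j - 12) else st j)" for i
  have "1 \<le> ntapes M" using M(1) by (simp add: wf_tm_def)
  have "wp (Loop (\<lambda>r. r 10 \<noteq> Aux (halt_state M)) (Act (sim_act M))) F Q (t + 1) (S 0)"
  proof (rule wp_Loop_count[where n = n and c = 1])
    fix i t assume "i < n"
    then have nh: "fst (c i) \<noteq> halt_state M"
      using not_less_Least[of i "halted_after M [w]"] by (auto simp: n_def halted_after_def c_def)
    obtain q ts where ci: "c i = (q, ts)" by fastforce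
    obtain q' as where d: "delta M q (map read_tape ts) = (q', as)" by fastforce
    have v: "valid_config M (q, ts)" using valid_config_after[OF M(1), of "[w]" i] ci by (simp add: c_def)
    then have q: "q \<in> states M" "length ts = ntapes M" by (simp_all add: valid_config_def)
    have w: "length as = ntapes M"
      using wf_tm_delta(2)[OF M(1) q(1) _ _ valid_config_reads[OF v] d] nh ci q by simp
    have ss: "map (\<lambda>j. reads (S i) (12 + j)) [0..<ntapes M] = map read_tape ts"
      using q by (auto simp: S_def reads_def ci intro!: nth_equalityI)
    have r10: "reads (S i) 10 = Aux q" by (simp add: reads_def S_def ci)
    have c': "c (Suc i) = (q', map2 act_tape as ts)"
      using nh ci d by (simp add: c_def config_after_Suc tm_step.simps)
    have sim: "sim_act M (reads (S i)) = (\<lambda>j. if j = 10 then (Aux q', Stay)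
        else if 12 \<le> j \<and> j < 12 + ntapes M then as ! (j - 12) else (reads (S i) j, Stay))"
      using q nh ci d valid_config_reads[OF v] by (simp add: sim_act_def ss r10 Let_def)
    have "act (sim_act M) (S i) = S (Suc i)"
    proof
      fix j
      show "act (sim_act M) (S i) j = S (Suc i) j"
        unfolding act_def sim using q w by (auto simp: reads_def act_tape_idle S_def ci c')
    qed
    then show "reads (S i) 10 \<noteq> Aux (halt_state M) \<and>
        wp (Act (sim_act M)) F (\<lambda>t' st'. t' \<le> t + 1 \<and> st' = S (Suc i)) t (S i)"
      using r10 nh ci by (simp add: wp_Act)
  next
    show "\<not> reads (S n) 10 \<noteq> Aux (halt_state M)"
      using hn by (simp add: S_def reads_def c_def halted_after_def)
  next
    fix t' assume "t' \<le> t + 1 + n * (1 + 2) + 1"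
    then have "t' \<le> t + 3 * t0 + 2" using \<open>n \<le> t0\<close> by simp
    moreover have "c t0 = c n" unfolding c_def by (rule config_after_mono[OF hn \<open>n \<le> t0\<close>])
    moreover have "fst (c n) = halt_state M" using hn by (simp add: c_def halted_after_def)
    ultimately show "Q t' (S n)"
      using \<open>1 \<le> ntapes M\<close> by (intro Q) (auto simp: S_def c_def)
  qed
  moreover have "S 0 = st(10 := reg (Aux (start_state M)))"
  proof
    fix j
    have "st j = input_tape []" if "12 < j" "j < 12 + ntapes M"
      using st(3)[of "j - 12"] that by simp
    then show "S 0 j = (st(10 := reg (Aux (start_state M)))) j"
      using st(2) by (cases "j = 12") (auto simp: S_def c_def config_after_def init_config_def)
  qed
  ultimately show ?thesis using st(1) by (simp add: Simulate_def)
qed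

section \<open>The decider\<close>

definition Decider :: "tm \<Rightarrow> prog" where
  "Decider M = CopyIn ;; Simulate M ;; Checker"

text \<open>Outside the simulated step, programs inspect only tapes 0 to 12, and tape 12 exists
  because the simulated machine has at least one tape.\<close>

lemma local_testI:
  assumes "12 < K" "\<And>r r'. (\<And>i. i \<le> 12 \<Longrightarrow> r i = r' i) \<Longrightarrow> b r = b r'"
  shows "local_test K b"
  unfolding local_test_def agree_def
proof (intro allI impI)
  fix r r' :: "nat \<Rightarrow> sym" assume "\<forall>i<K. r i = r' i"
  with assms(1) have "r i = r' i" if "i \<le> 12" for i
    using that by (meson le_less_trans)
  then show "b r = b r'" by (rule assms(2))
qed

lemma wf_Upd:
  assumes "12 < K" "\<And>r r'. (\<And>i. i \<le> 12 \<Longrightarrow> r i = r' i) \<Longrightarrow> g r = g r'"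
    and "\<And>r. (\<And>i. i \<le> 12 \<Longrightarrow> r i \<in> S) \<Longrightarrow> g r \<in> S"
  shows "wf_prog K S (Upd i g d)"
  unfolding Upd_def wf_prog.simps closed_act_def
proof (intro conjI allI impI)
  fix r r' :: "nat \<Rightarrow> sym" assume a: "agree K r r'"
  have "local_test K g"
  proof (rule local_testI[OF assms(1)])
    fix r r' :: "nat \<Rightarrow> sym" assume "\<And>i. i \<le> 12 \<Longrightarrow> r i = r' i"
    then show "g r = g r'" by (rule assms(2))
  qed
  with a have "g r = g r'" by (simp add: local_test_def)
  with a show "agree K ((idle r)(i := (g r, d))) ((idle r')(i := (g r', d)))"
    by (simp add: agree_def)
next
  fix r :: "nat \<Rightarrow> sym" and j assume r: "\<forall>i<K. r i \<in> S" "j < K"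
  with assms(1) have "r i \<in> S" if "i \<le> 12" for i
    using that by (meson le_less_trans)
  then have "g r \<in> S" by (rule assms(3))
  with r show "fst (((idle r)(i := (g r, d))) j) \<in> S" by simp
qed

lemma wf_Move:
  assumes "12 < K" "i \<le> 12"
  shows "wf_prog K S (StepRight i)" "wf_prog K S (StepLeft i)"
  unfolding StepRight_def StepLeft_def using assms by (auto intro!: wf_Upd)

lemma wf_Check: "wf_prog K S (Check b) = local_test K b"
  using closed_act_idle by (simp add: Check_def)

lemma wf_Rewind: "12 < K \<Longrightarrow> v \<le> 12 \<Longrightarrow> wf_prog K S (Rewind v)"
  by (simp add: Rewind_def wf_Move local_testI)

lemma wf_Fetch: "12 < K \<Longrightarrow> v \<le> 12 \<Longrightarrow> wf_prog K S (Fetch v k)"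
  by (simp add: Fetch_def wf_Move wf_Check wf_Rewind wf_Upd local_testI)

lemma wf_Gates: "12 < K \<Longrightarrow> v \<le> 12 \<Longrightarrow> (\<And>b. Bit b \<in> S) \<Longrightarrow> wf_prog K S (Gates v)"
  by (simp add: Gates_def Gate_def Append_def wf_Move wf_Check wf_Rewind wf_Fetch wf_Upd local_testI)

lemma wf_Outs: "12 < K \<Longrightarrow> v \<le> 12 \<Longrightarrow> wf_prog K S (Outs v z)"
  by (simp add: Outs_def wf_Move wf_Check wf_Fetch wf_Upd local_testI)

lemma wf_Decider:
  assumes "wf_tm M"
  shows "wf_prog (12 + ntapes M) (sim_symbols M) (Decider M)"
proof -
  have K: "12 < 12 + ntapes M" using assms by (simp add: wf_tm_def)
  have "Bit False \<in> sim_symbols M" "Bit True \<in> sim_symbols M"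
    using assms by (auto simp: wf_tm_def sim_symbols_def)
  then have B: "Bit b \<in> sim_symbols M" for b by (cases b) simp_all
  have A: "Aux (start_state M) \<in> sim_symbols M"
    using assms by (auto simp: wf_tm_def sim_symbols_def)
  note simps = wf_Move[OF K] wf_Check wf_Rewind[OF K] wf_Gates[OF K] wf_Outs[OF K] wf_Upd[OF K] local_testI[OF K] B A
  have "wf_prog (12 + ntapes M) (sim_symbols M) CopyIn"
    by (simp add: CopyIn_def simps)
  moreover have "wf_prog (12 + ntapes M) (sim_symbols M) (Simulate M)"
    using closed_sim_act[OF assms] by (simp add: Simulate_def simps)
  moreover have "wf_prog (12 + ntapes M) (sim_symbols M) LoadC"
    by (simp add: LoadC_def simps)
  moreover have "wf_prog (12 + ntapes M) (sim_symbols M) LoadV"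
    by (simp add: LoadV_def simps)
  moreover have "wf_prog (12 + ntapes M) (sim_symbols M) Decide"
    by (simp add: Decide_def Compare_def ReadK_def ReadBits_def CompareK_def simps)
  ultimately show ?thesis
    by (simp add: Decider_def Checker_def CheckV_def simps)
qed

definition start_store :: "bool list \<Rightarrow> bool list \<Rightarrow> bool list \<Rightarrow> store" where
  "start_store w x y = (\<lambda>i. if i = 0 then input_tape w else if i = 1 then input_tape x
     else if i = 2 then input_tape y else input_tape [])"

lemma init_config_machine:
  "init_config (machine K S p) [w, x, y] = (0, map (start_store w x y) [0..<K])"
  by (auto simp: init_config_def machine_def start_store_def nth_Cons' intro!: nth_equalityI)

lemma reg_Blank: "reg Blank = (contents [], 0)"
  by (simp flip: input_tape_Nil add: input_tape_eq)

lemma wp_Decider: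
  assumes M: "wf_tm M" "halted_after M [w] t0" "tape_holds (snd (config_after M [w] t0) ! 0) u"
    and Q: "\<And>t' st'. checks u x y \<Longrightarrow> t' \<le> 7 * length w + 3 * t0 + 12 + 13 * cost (length u) \<Longrightarrow>
      tape_holds (st' 0) [True] \<Longrightarrow> Q t' st'"
    and F: "\<And>t'. \<not> checks u x y \<Longrightarrow> t' \<le> 7 * length w + 3 * t0 + 12 + 13 * cost (length u) \<Longrightarrow> F t'"
  shows "wp (Decider M) F Q 0 (start_store w x y)"
  unfolding Decider_def wp_Seq
proof (rule wp_CopyIn)
  fix t1 assume 1: "t1 \<le> 0 + 7 * length w + 10"
  let ?st1 = "(start_store w x y)(0 := (contents w, int (length w)), 12 := (contents w, 0))"
  show "wp (Simulate M) F (wp Checker F Q) t1 ?st1"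
  proof (rule wp_Simulate[OF M(1,2)])
    fix t2 st2
    assume 2: "t2 \<le> t1 + 3 * t0 + 2" "\<And>i. i \<le> 11 \<Longrightarrow> i \<noteq> 10 \<Longrightarrow> st2 i = ?st1 i"
      "st2 10 = reg (Aux (halt_state M))" "st2 12 = snd (config_after M [w] t0) ! 0"
    \<comment> \<open>The head of tape 0 is still on the blank behind \<open>w\<close>, so the
      written bit is followed by a blank and forms the whole output.\<close>
    have "act_tape (Bit True, Stay) (contents w, int (length w)) = ((contents w)(int (length w) := Bit True), int (length w))"
      by simp
    moreover have "tape_holds ((contents w)(int (length w) := Bit True), int (length w)) [True]"
      by (simp add: tape_holds.simps contents_def)
    ultimately show "wp Checker F Q t2 st2"
      using 1 2 M(3)
      by (intro wp_Checker[where u = u and x = x and y = y and s = "Aux (halt_state M)" and s' = Blank])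
         (auto simp: start_store_def input_tape_eq reg_Blank intro!: Q F)
  qed (auto simp: start_store_def input_tape_eq reg_Blank[symmetric])
qed (auto simp: start_store_def input_tape_eq)

definition decider_tm :: "tm \<Rightarrow> tm" where
  "decider_tm M = machine (12 + ntapes M) (sim_symbols M) (Decider M)"

lemma wf_decider_tm:
  assumes "wf_tm M"
  shows "wf_tm (decider_tm M)"
  unfolding decider_tm_def
  using assms by (intro wf_machine wf_Decider) (auto simp: wf_tm_def sim_symbols_def)

text \<open>The bound is free of \<open>x\<close> and \<open>y\<close>: how much of them is read
  depends on the input count in \<open>u\<close> alone.\<close>

lemma decider_tm_run:
  assumes M: "wf_tm M" "halted_after M [w] t0" "tape_holds (snd (config_after M [w] t0) ! 0) u"
  shows "\<exists>t \<le> 7 * length w + 3 * t0 + 12 + 13 * cost (length u). halted_after (decider_tm M) [w, x, y] t"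
    and "outputs (decider_tm M) [w, x, y] [True] \<longleftrightarrow> checks u x y"
proof -
  let ?T = "7 * length w + 3 * t0 + 12 + 13 * cost (length u)"
  let ?K = "12 + ntapes M" and ?S = "sim_symbols M" and ?P = "Decider M"
  have "wp ?P (\<lambda>t. t \<le> ?T \<and> \<not> checks u x y) (\<lambda>t st. t \<le> ?T \<and> checks u x y \<and> tape_holds (st 0) [True]) 0 (start_store w x y)"
    using M by (rule wp_Decider) auto
  then obtain t r where r: "exec ?P (start_store w x y) t r" "t \<le> ?T"
    "case r of None \<Rightarrow> \<not> checks u x y | Some st \<Rightarrow> checks u x y \<and> tape_holds (st 0) [True]"
    unfolding wp_def by (auto split: option.splits)
  have S: "Blank \<in> ?S" using M(1) by (auto simp: wf_tm_def sim_symbols_def)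
  note ex = exec_steps[OF r(1) wf_Decider[OF M(1)] S, where pre = "[]" and post = "[]", simplified]
  have halt: "halt_state (decider_tm M) = plen ?P" by (simp add: decider_tm_def machine_def)
  have c: "config_after (decider_tm M) [w, x, y] t =
      (tm_step (machine ?K ?S ?P) ^^ t) (0, map (start_store w x y) [0..<?K])"
    by (simp add: config_after_def decider_tm_def init_config_machine)
  have "halted_after (decider_tm M) [w, x, y] t \<and>
      (tape_holds (snd (config_after (decider_tm M) [w, x, y] t) ! 0) [True] \<longleftrightarrow> checks u x y)"
  proof (cases r)
    case None
    with ex obtain st' where st': "config_after (decider_tm M) [w, x, y] t = (plen ?P, map st' [0..<?K])"
      "read_tape (st' 0) = Blank" by (auto simp: c)
    \<comment> \<open>A failed run scans a blank on tape 0, so its output is empty and cannot be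
      mistaken for acceptance.\<close>
    then have "\<not> tape_holds (st' 0) [True]" by (auto dest: read_tape_holds)
    with st' None r(3) halt show ?thesis by (simp add: halted_after_def nth_append del: upt_Suc)
  next
    case (Some st')
    with ex have "config_after (decider_tm M) [w, x, y] t = (plen ?P, map st' [0..<?K])" by (simp add: c)
    with Some r(3) halt show ?thesis by (simp add: halted_after_def del: upt_Suc)
  qed
  with r(2) show "\<exists>t \<le> ?T. halted_after (decider_tm M) [w, x, y] t"
    and "outputs (decider_tm M) [w, x, y] [True] \<longleftrightarrow> checks u x y"
    using outputs_iff by blast+
qed

section \<open>Quantification over challenges and polynomial bounds\<close>

lemma poly_nat_mono:
  fixes p :: "nat poly"
  assumes "a \<le> b"
  shows "poly p a \<le> poly p b"
  using assms by (induction p) (auto intro: add_mono mult_mono)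

text \<open>Holds because input counts are coded in unary. It bounds \<open>length x + m\<close>,
  hence both the witness and the relevant challenges, by the length of the instance.\<close>

lemma num_inputs_le: "num_inputs C \<le> length (enc_instance C V k)"
  by (simp add: enc_instance_def enc_circuit_def enc_unary_def)

text \<open>Moves the universal quantifier inside the decoding. The bound \<open>l\<close> admits
  all challenges of length \<open>m\<close>, as \<open>m\<close> is at most the input count of
  \<open>C\<close>; those of other lengths add nothing, since \<open>pad\<close> turns them into
  strings of length \<open>m\<close>.\<close>

lemma all_checks_iff:
  assumes "length u \<le> l"
  shows "(\<forall>y. length y \<le> l \<longrightarrow> checks u x y) \<longleftrightarrow>
    (\<exists>C V k m. u = enc_instance C V k \<and> circuit_type C (length x + m) (m + 1) \<and>
       circuit_type V (m + 1) (length x + m) \<and> 1 \<le> k \<and> (\<forall>y. length y = m \<longrightarrow> good_output C V k x y))"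
    (is "?L \<longleftrightarrow> ?R")
proof
  assume L: ?L
  \<comment> \<open>The empty challenge meets any length bound and, thanks to padding, already
    yields the circuits and \<open>k\<close>.\<close>
  then have "checks u x []" by simp
  then obtain C V k m where *: "u = enc_instance C V k" "circuit_type C (length x + m) (m + 1)"
    "circuit_type V (m + 1) (length x + m)" "1 \<le> k" unfolding checks_def by blast
  have "good_output C V k x y" if "length y = m" for y
  proof -
    have "length x + m \<le> length u"
      using num_inputs_le[of C V k] * by (simp add: circuit_type_def)
    with that assms L have "checks u x y" by simp
    \<comment> \<open>Each challenge comes with a decoding of its own; injectivity of the encoding
      identifies the circuits, and the input count then identifies \<open>m\<close>.\<close>
    then obtain C' V' k' m' where 2: "u = enc_instance C' V' k'" "circuit_type C' (length x + m') (m' + 1)"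
      "good_output C' V' k' x (pad m' y)" unfolding checks_def by blast
    with * enc_instance_inject have "C' = C" "V' = V" "k' = k" by metis+
    with 2 * that have "m' = m" by (simp add: circuit_type_def)
    with 2 that \<open>C' = C\<close> \<open>V' = V\<close> \<open>k' = k\<close> show ?thesis by (simp add: pad_id)
  qed
  with * show ?R by blast
next
  assume ?R
  then show ?L unfolding checks_def by (metis length_pad)
qed

theorem theorem5p2: "PMA \<subseteq> USigma2P"
proof
  fix L assume "L \<in> PMA"
  then obtain f M where M: "poly_time_tm 1 M" "\<And>w. outputs M [w] (f w)" and red: "\<And>w. w \<in> L \<longleftrightarrow> f w \<in> Edge_Majority"
    by (auto simp: PMA_def poly_reducible_def poly_time_computable_def)
  then have wf: "wf_tm M" by (simp add: poly_time_tm_def)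
  from M(1) obtain p where "\<And>ws. length ws = 1 \<Longrightarrow> \<exists>t \<le> poly p (sum_list (map length ws)). halted_after M ws t"
    unfolding poly_time_tm_def by blast
  from this[of "[_]"] have p: "\<exists>t \<le> poly p (length w). halted_after M [w] t" for w by simp
  \<comment> \<open>Input length plus running time, the bound of \<open>length_output\<close> on
    \<open>f w\<close>; it also serves as the bound on both quantified strings.\<close>
  define q where "q = [:0, 1:] + p"
  have run: "\<exists>t0 \<le> poly p (length w). halted_after M [w] t0 \<and> tape_holds (snd (config_after M [w] t0) ! 0) (f w)" for w
    using p[of w] M(2)[of w] outputs_iff by blast
  have len: "length (f w) \<le> poly q (length w)" for w
    using run[of w] length_output[OF wf, of w _ "f w"] by (fastforce simp: q_def)
  \<comment> \<open>The running time of the decider with \<open>q\<close> substituted into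
    \<open>13 * cost\<close>; \<open>7 * q\<close> absorbs \<open>7 * length w + 3 * t0\<close>, as
    \<open>q\<close> is the input length plus \<open>p\<close>.\<close>
  define b where "b = smult 13 ((q + 1) * (smult 20 q + [:100:])) + smult 7 q + [:12:]"
  have b: "7 * length w + 3 * t0 + 12 + 13 * cost (length (f w)) \<le> poly b (length w)" if "t0 \<le> poly p (length w)" for w t0
  proof -
    have "cost (length (f w)) \<le> (poly q (length w) + 1) * (20 * poly q (length w) + 100)"
      unfolding cost_def using len[of w] by (intro mult_le_mono) auto
    then have "13 * cost (length (f w)) \<le> 13 * ((poly q (length w) + 1) * (20 * poly q (length w) + 100))"
      by (rule mult_le_mono2)
    moreover have "7 * length w + 3 * t0 \<le> 7 * poly q (length w)"
      using that by (simp add: q_def)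
    ultimately show ?thesis by (simp add: b_def del: mult_Suc)
  qed
  have acc: "outputs (decider_tm M) [w, x, y] [True] \<longleftrightarrow> checks (f w) x y" for w x y
    using run[of w] decider_tm_run(2)[OF wf] by blast
  have poly: "poly_time_tm 3 (decider_tm M)"
    unfolding poly_time_tm_def
  proof (intro conjI exI[of _ b] allI impI)
    show "wf_tm (decider_tm M)" by (rule wf_decider_tm[OF wf])
    show "3 \<le> ntapes (decider_tm M)" by (simp add: decider_tm_def machine_def)
    fix ws :: "bool list list" assume "length ws = 3"
    then obtain w x y where ws: "ws = [w, x, y]" by (auto simp: numeral_3_eq_3 length_Suc_conv)
    obtain t0 where t0: "t0 \<le> poly p (length w)" "halted_after M [w] t0" "tape_holds (snd (config_after M [w] t0) ! 0) (f w)"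
      using run by blast
    from decider_tm_run(1)[OF wf t0(2,3), of x y] b[OF t0(1)]
    obtain t where "t \<le> poly b (length w)" "halted_after (decider_tm M) [w, x, y] t"
      using le_trans by blast
    moreover have "poly b (length w) \<le> poly b (sum_list (map length ws))"
      by (rule poly_nat_mono) (simp add: ws)
    ultimately show "\<exists>t \<le> poly b (sum_list (map length ws)). halted_after (decider_tm M) ws t"
      unfolding ws using le_trans by blast
  qed
  define good where "good w x \<longleftrightarrow> (\<exists>C V k m. f w = enc_instance C V k \<and> circuit_type C (length x + m) (m + 1) \<and>
       circuit_type V (m + 1) (length x + m) \<and> 1 \<le> k \<and> (\<forall>y. length y = m \<longrightarrow> good_output C V k x y))" for w x
  have all: "all_accepted (decider_tm M) (poly q (length w)) w x \<longleftrightarrow> good w x" for w x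
    unfolding all_accepted_def acc good_def by (rule all_checks_iff[OF len])
  have short: "length x \<le> poly q (length w)" if "good w x" for w x
    using that len[of w] num_inputs_le unfolding good_def circuit_type_def by (metis le_add1 le_trans)
  have mem: "w \<in> L \<longleftrightarrow> (\<exists>x. good w x)" for w
    unfolding red Edge_Majority_def good_def good_output_def by blast
  have unique: "x = x'" if "good w x" "good w x'" for w x x'
  proof -
    from that(1) obtain C V k m where 1: "f w = enc_instance C V k" "circuit_type C (length x + m) (m + 1)" "1 \<le> k"
      "\<And>y. length y = m \<Longrightarrow> good_output C V k x y" unfolding good_def by blast
    from that(2) obtain C' V' k' m' where 2: "f w = enc_instance C' V' k'" "circuit_type C' (length x' + m') (m' + 1)"
      "\<And>y. length y = m' \<Longrightarrow> good_output C' V' k' x' y" unfolding good_def by blast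
    from 1 2 enc_instance_inject have eq: "C' = C" "V' = V" "k' = k" by metis+
    \<comment> \<open>The output count of \<open>C\<close> fixes \<open>m\<close>, and its input
      count then fixes the length of the witness; only now does the counting argument for equal
      lengths apply.\<close>
    with 1 2 have "m' = m" "length x' = length x" by (simp_all add: circuit_type_def)
    with 1 2 eq show ?thesis by (intro good_prefix_unique[of C "length x" m k x V x']) auto
  qed
  show "L \<in> USigma2P"
    unfolding USigma2P_def mem_Collect_eq
  proof (intro exI[of _ "decider_tm M"] exI[of _ q] conjI allI poly)
    fix w
    show "w \<in> L \<longleftrightarrow> (\<exists>x. length x \<le> poly q (length w) \<and> all_accepted (decider_tm M) (poly q (length w)) w x)"
      unfolding all mem using short by blast
    show "\<exists>\<^sub>\<le>\<^sub>1 x. length x \<le> poly q (length w) \<and> all_accepted (decider_tm M) (poly q (length w)) w x"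
      unfolding all using unique by (intro Uniq_I) blast
  qed
qed

end
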